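(* (ZFC) If $\kappa$ is the first (least) supercompact cardinal, then $\langle V_{\kappa+1},\in\rangle$ satisfies Semi-Weak Vopěnka's Principle and the statement ``there is no supercompact cardinal.''
   Context: A graph is a structure $\langle G,E\rangle$ where $G$ is a set and $E$ is an arbitrary binary relation on $G$. A homomorphism from $\langle G,E\rangle$ to $\langle G',E'\rangle$ is a function $h: G\to G'$ such that $\langle v,w\rangle\in E$ implies $\langle h(v),h(w)\rangle\in E'$. Semi-Weak Vopěnka's Principle (SWVP), a statement of second-order set theory, says that no sequence of graphs $\langle G_\alpha:\alpha\in\mathrm{Ord}\rangle$ has both of the following properties: whenever $\alpha\le\alpha'$ there is a homomorphism $G_{\alpha'}\to G_\alpha$ (not necessarily unique), and whenever $\alpha<\alpha'$ there is no homomorphism $G_\alpha\to G_{\alpha'}$. $V_\alpha$ denotes the $\alpha$-th level of the cumulative hierarchy (the set of all sets of rank less than $\alpha$). For $\kappa$ inaccessible, the structure $\langle V_{\kappa+1},\in\rangle$ is regarded as a model of second-order set theory whose sets are the elements of $V_\kappa$ and whose classes are the elements of $V_{\kappa+1}$ (supercompact cardinals are inaccessible). Thus SWVP in $\langle V_{\kappa+1},\in\rangle$ concerns sequences $\langle G_\alpha:\alpha<\kappa\rangle$ of graphs with each $G_\alpha\in V_\kappa$, and the first-order statement ``there is no supercompact cardinal'' holds in $\langle V_{\kappa+1},\in\rangle$ if and only if it holds in $\langle V_\kappa,\in\rangle$, i.e. no $\kappa_0<\kappa$ is $X$-supercompact for every $X\in V_\kappa$. For a cardinal $\kappa$ and a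 set $X$, $\mathcal{P}_\kappa(X)=\{A\subset X: |A|<\kappa\}$. For an uncountable cardinal $\kappa$ and a set $X$, $\kappa$ is $X$-supercompact if there is a normal fine $\kappa$-complete ultrafilter $U$ on $\mathcal{P}_\kappa(X)$, where: fine means that for every $x\in X$ the set $\{A\in\mathcal{P}_\kappa(X): x\in A\}$ is in $U$; $\kappa$-complete means that the intersection of fewer than $\kappa$ many sets in $U$ is in $U$; normal means that every choice function (a function $f$ with $f(A)\in A$ for all $A$ in its domain) defined on a set in $U$ is constant on a set in $U$. An uncountable cardinal $\kappa$ is supercompact if it is $X$-supercompact for every set $X$. *)

theory Defs
  imports Main
begin

text \<open>
  "ZFC proves P" is rendered as "P holds in every model of first-order ZFC". A model is an
  arbitrary type with an arbitrary binary relation; it need not be well-founded, and Separation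
  and Replacement are assumed only for first-order formulas with parameters. The deep embedding
  of formulas serves only to state these two schemas.
\<close>

datatype fm = Mem nat nat | Eq nat nat | Neg fm | Conj fm fm | Ex nat fm

primrec sat :: "('v \<Rightarrow> 'v \<Rightarrow> bool) \<Rightarrow> (nat \<Rightarrow> 'v) \<Rightarrow> fm \<Rightarrow> bool" where
  "sat E \<rho> (Mem i j) \<longleftrightarrow> E (\<rho> i) (\<rho> j)"
| "sat E \<rho> (Eq i j) \<longleftrightarrow> \<rho> i = \<rho> j"
| "sat E \<rho> (Neg \<phi>) \<longleftrightarrow> \<not> sat E \<rho> \<phi>"
| "sat E \<rho> (Conj \<phi> \<psi>) \<longleftrightarrow> sat E \<rho> \<phi> \<and> sat E \<rho> \<psi>"
| "sat E \<rho> (Ex i \<phi>) \<longleftrightarrow> (\<exists>x. sat E (\<rho>(i := x)) \<phi>)"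

definition extensionality :: "('v \<Rightarrow> 'v \<Rightarrow> bool) \<Rightarrow> bool" where
  "extensionality E \<longleftrightarrow> (\<forall>a b. (\<forall>x. E x a \<longleftrightarrow> E x b) \<longrightarrow> a = b)"

definition foundation :: "('v \<Rightarrow> 'v \<Rightarrow> bool) \<Rightarrow> bool" where
  "foundation E \<longleftrightarrow> (\<forall>a. (\<exists>x. E x a) \<longrightarrow> (\<exists>x. E x a \<and> \<not> (\<exists>y. E y x \<and> E y a)))"

definition pairing :: "('v \<Rightarrow> 'v \<Rightarrow> bool) \<Rightarrow> bool" where
  "pairing E \<longleftrightarrow> (\<forall>a b. \<exists>c. \<forall>x. E x c \<longleftrightarrow> x = a \<or> x = b)"

definition union_axiom :: "('v \<Rightarrow> 'v \<Rightarrow> bool) \<Rightarrow> bool" where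
  "union_axiom E \<longleftrightarrow> (\<forall>a. \<exists>b. \<forall>x. E x b \<longleftrightarrow> (\<exists>y. E y a \<and> E x y))"

definition power_axiom :: "('v \<Rightarrow> 'v \<Rightarrow> bool) \<Rightarrow> bool" where
  "power_axiom E \<longleftrightarrow> (\<forall>a. \<exists>b. \<forall>x. E x b \<longleftrightarrow> (\<forall>y. E y x \<longrightarrow> E y a))"

definition infinity_axiom :: "('v \<Rightarrow> 'v \<Rightarrow> bool) \<Rightarrow> bool" where
  "infinity_axiom E \<longleftrightarrow>
     (\<exists>w. (\<exists>e. E e w \<and> (\<forall>z. \<not> E z e)) \<and>
          (\<forall>x. E x w \<longrightarrow> (\<exists>s. E s w \<and> (\<forall>z. E z s \<longleftrightarrow> E z x \<or> z = x))))"

text \<open>In both schemas the values of \<open>\<rho>\<close> at the remaining variables act as parameters.\<close>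

definition separation_schema :: "('v \<Rightarrow> 'v \<Rightarrow> bool) \<Rightarrow> bool" where
  "separation_schema E \<longleftrightarrow>
     (\<forall>\<phi> \<rho> a. \<exists>b. \<forall>x. E x b \<longleftrightarrow> E x a \<and> sat E (\<rho>(0 := x)) \<phi>)"

definition replacement_schema :: "('v \<Rightarrow> 'v \<Rightarrow> bool) \<Rightarrow> bool" where
  "replacement_schema E \<longleftrightarrow>
     (\<forall>\<phi> \<rho> a. (\<forall>x. E x a \<longrightarrow> (\<exists>!y. sat E (\<rho>(0 := x, 1 := y)) \<phi>)) \<longrightarrow>
        (\<exists>b. \<forall>y. E y b \<longleftrightarrow> (\<exists>x. E x a \<and> sat E (\<rho>(0 := x, 1 := y)) \<phi>)))"

definition choice_axiom :: "('v \<Rightarrow> 'v \<Rightarrow> bool) \<Rightarrow> bool" where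
  "choice_axiom E \<longleftrightarrow>
     (\<forall>a. (\<forall>x. E x a \<longrightarrow> (\<exists>z. E z x)) \<and>
          (\<forall>x y. E x a \<and> E y a \<and> x \<noteq> y \<longrightarrow> \<not> (\<exists>z. E z x \<and> E z y)) \<longrightarrow>
          (\<exists>c. \<forall>x. E x a \<longrightarrow> (\<exists>!z. E z x \<and> E z c)))"

definition ZFC :: "('v \<Rightarrow> 'v \<Rightarrow> bool) \<Rightarrow> bool" where
  "ZFC E \<longleftrightarrow> extensionality E \<and> foundation E \<and> pairing E \<and> union_axiom E \<and> power_axiom E \<and>
     infinity_axiom E \<and> separation_schema E \<and> replacement_schema E \<and> choice_axiom E"


text \<open>
  Set-theoretic notions, interpreted in a structure with domain \<open>M\<close>: all quantifiers over sets
  are restricted to \<open>M\<close>. The case \<open>M = UNIV\<close> gives the notion in the ambient model, and letting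
  \<open>M\<close> be the collection of members of \<open>V\<^sub>\<kappa>\<close> gives satisfaction in \<open>V\<^sub>\<kappa>\<close>.
\<close>

locale membership_structure =
  fixes M :: "'v set" and mem :: "'v \<Rightarrow> 'v \<Rightarrow> bool"  (infix "\<epsilon>" 50)
begin

definition subset_of :: "'v \<Rightarrow> 'v \<Rightarrow> bool" where
  "subset_of a b \<longleftrightarrow> (\<forall>x\<in>M. x \<epsilon> a \<longrightarrow> x \<epsilon> b)"

definition is_upair :: "'v \<Rightarrow> 'v \<Rightarrow> 'v \<Rightarrow> bool" where
  "is_upair p a b \<longleftrightarrow> (\<forall>x\<in>M. x \<epsilon> p \<longleftrightarrow> x = a \<or> x = b)"

definition is_pair :: "'v \<Rightarrow> 'v \<Rightarrow> 'v \<Rightarrow> bool" where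
  "is_pair p a b \<longleftrightarrow> (\<exists>s\<in>M. \<exists>t\<in>M. is_upair s a a \<and> is_upair t a b \<and> is_upair p s t)"

definition related :: "'v \<Rightarrow> 'v \<Rightarrow> 'v \<Rightarrow> bool" where
  "related r x y \<longleftrightarrow> (\<exists>p\<in>M. is_pair p x y \<and> p \<epsilon> r)"

text \<open>The domain is a predicate, so that functions on the class of all ordinals are covered.\<close>

definition function_on :: "'v \<Rightarrow> ('v \<Rightarrow> bool) \<Rightarrow> bool" where
  "function_on f D \<longleftrightarrow>
     (\<forall>p\<in>M. p \<epsilon> f \<longrightarrow> (\<exists>x\<in>M. \<exists>y\<in>M. D x \<and> is_pair p x y)) \<and>
     (\<forall>x\<in>M. D x \<longrightarrow> (\<exists>!y. y \<in> M \<and> related f x y))"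

definition function_from_to :: "'v \<Rightarrow> 'v \<Rightarrow> 'v \<Rightarrow> bool" where
  "function_from_to f a b \<longleftrightarrow>
     function_on f (\<lambda>x. x \<epsilon> a) \<and> (\<forall>x\<in>M. \<forall>y\<in>M. related f x y \<longrightarrow> y \<epsilon> b)"

definition injection :: "'v \<Rightarrow> 'v \<Rightarrow> 'v \<Rightarrow> bool" where
  "injection f a b \<longleftrightarrow> function_from_to f a b \<and>
     (\<forall>x\<in>M. \<forall>x'\<in>M. \<forall>y\<in>M. related f x y \<and> related f x' y \<longrightarrow> x = x')"

definition card_le :: "'v \<Rightarrow> 'v \<Rightarrow> bool" where
  "card_le a b \<longleftrightarrow> (\<exists>f\<in>M. injection f a b)"

definition card_less :: "'v \<Rightarrow> 'v \<Rightarrow> bool" where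
  "card_less a b \<longleftrightarrow> card_le a b \<and> \<not> card_le b a"

definition transitive :: "'v \<Rightarrow> bool" where
  "transitive a \<longleftrightarrow> (\<forall>x\<in>M. x \<epsilon> a \<longrightarrow> subset_of x a)"

text \<open>By Foundation, ordinals are the transitive sets all of whose members are transitive.\<close>

definition ordinal :: "'v \<Rightarrow> bool" where
  "ordinal a \<longleftrightarrow> transitive a \<and> (\<forall>x\<in>M. x \<epsilon> a \<longrightarrow> transitive x)"

definition limit_ordinal :: "'v \<Rightarrow> bool" where
  "limit_ordinal a \<longleftrightarrow> ordinal a \<and> (\<exists>x\<in>M. x \<epsilon> a) \<and>
     (\<forall>x\<in>M. x \<epsilon> a \<longrightarrow> (\<exists>y\<in>M. y \<epsilon> a \<and> x \<epsilon> y))"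

definition is_omega :: "'v \<Rightarrow> bool" where
  "is_omega w \<longleftrightarrow> limit_ordinal w \<and> \<not> (\<exists>x\<in>M. x \<epsilon> w \<and> limit_ordinal x)"

definition cardinal :: "'v \<Rightarrow> bool" where
  "cardinal k \<longleftrightarrow> ordinal k \<and> (\<forall>a\<in>M. a \<epsilon> k \<longrightarrow> card_less a k)"

definition uncountable :: "'v \<Rightarrow> bool" where
  "uncountable k \<longleftrightarrow> (\<exists>w\<in>M. is_omega w \<and> card_less w k)"

text \<open>\<open>b = {x \<in> a. Q x}\<close>\<close>

definition is_Collect :: "'v \<Rightarrow> 'v \<Rightarrow> ('v \<Rightarrow> bool) \<Rightarrow> bool" where
  "is_Collect b a Q \<longleftrightarrow> (\<forall>x\<in>M. x \<epsilon> b \<longleftrightarrow> x \<epsilon> a \<and> Q x)"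

text \<open>\<open>p = \<P>\<^sub>k(X)\<close>\<close>

definition is_Pk :: "'v \<Rightarrow> 'v \<Rightarrow> 'v \<Rightarrow> bool" where
  "is_Pk p k X \<longleftrightarrow> (\<forall>A\<in>M. A \<epsilon> p \<longleftrightarrow> subset_of A X \<and> card_less A k)"

definition ultrafilter_on :: "'v \<Rightarrow> 'v \<Rightarrow> bool" where
  "ultrafilter_on U p \<longleftrightarrow>
     (\<forall>B\<in>M. B \<epsilon> U \<longrightarrow> subset_of B p) \<and>
     p \<epsilon> U \<and>
     (\<forall>B\<in>M. B \<epsilon> U \<longrightarrow> (\<exists>x\<in>M. x \<epsilon> B)) \<and>
     (\<forall>B\<in>M. \<forall>C\<in>M. B \<epsilon> U \<and> subset_of B C \<and> subset_of C p \<longrightarrow> C \<epsilon> U) \<and>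
     (\<forall>B\<in>M. \<forall>C\<in>M. B \<epsilon> U \<and> C \<epsilon> U \<longrightarrow> (\<exists>D\<in>M. D \<epsilon> U \<and> is_Collect D B (\<lambda>x. x \<epsilon> C))) \<and>
     (\<forall>B\<in>M. subset_of B p \<longrightarrow> B \<epsilon> U \<or> (\<exists>D\<in>M. D \<epsilon> U \<and> is_Collect D p (\<lambda>x. \<not> x \<epsilon> B)))"

text \<open>The intersection is taken inside \<open>p\<close>, so the empty intersection is \<open>p\<close> itself.\<close>

definition complete_filter :: "'v \<Rightarrow> 'v \<Rightarrow> 'v \<Rightarrow> bool" where
  "complete_filter U p k \<longleftrightarrow>
     (\<forall>S\<in>M. subset_of S U \<and> card_less S k \<longrightarrow>
        (\<exists>I\<in>M. I \<epsilon> U \<and> is_Collect I p (\<lambda>A. \<forall>B\<in>M. B \<epsilon> S \<longrightarrow> A \<epsilon> B)))"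

definition fine_filter :: "'v \<Rightarrow> 'v \<Rightarrow> 'v \<Rightarrow> bool" where
  "fine_filter U p X \<longleftrightarrow>
     (\<forall>x\<in>M. x \<epsilon> X \<longrightarrow> (\<exists>B\<in>M. B \<epsilon> U \<and> is_Collect B p (\<lambda>A. x \<epsilon> A)))"

definition normal_filter :: "'v \<Rightarrow> bool" where
  "normal_filter U \<longleftrightarrow>
     (\<forall>D\<in>M. \<forall>f\<in>M. D \<epsilon> U \<and> function_on f (\<lambda>A. A \<epsilon> D) \<and>
          (\<forall>A\<in>M. \<forall>y\<in>M. related f A y \<longrightarrow> y \<epsilon> A) \<longrightarrow>
        (\<exists>B\<in>M. B \<epsilon> U \<and> subset_of B D \<and> (\<exists>c\<in>M. \<forall>A\<in>M. A \<epsilon> B \<longrightarrow> related f A c)))"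

definition supercompact_for :: "'v \<Rightarrow> 'v \<Rightarrow> bool" where
  "supercompact_for k X \<longleftrightarrow>
     (\<exists>p\<in>M. is_Pk p k X \<and>
        (\<exists>U\<in>M. ultrafilter_on U p \<and> complete_filter U p k \<and> fine_filter U p X \<and> normal_filter U))"

definition supercompact :: "'v \<Rightarrow> bool" where
  "supercompact k \<longleftrightarrow> cardinal k \<and> uncountable k \<and> (\<forall>X\<in>M. supercompact_for k X)"

definition least_supercompact :: "'v \<Rightarrow> bool" where
  "least_supercompact k \<longleftrightarrow> supercompact k \<and> (\<forall>m\<in>M. supercompact m \<longrightarrow> k = m \<or> k \<epsilon> m)"

definition is_graph :: "'v \<Rightarrow> 'v \<Rightarrow> 'v \<Rightarrow> bool" where
  "is_graph g v e \<longleftrightarrow> is_pair g v e \<and>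
     (\<forall>p\<in>M. p \<epsilon> e \<longrightarrow> (\<exists>x\<in>M. \<exists>y\<in>M. x \<epsilon> v \<and> y \<epsilon> v \<and> is_pair p x y))"

definition graph :: "'v \<Rightarrow> bool" where
  "graph g \<longleftrightarrow> (\<exists>v\<in>M. \<exists>e\<in>M. is_graph g v e)"

definition graph_hom :: "'v \<Rightarrow> 'v \<Rightarrow> 'v \<Rightarrow> bool" where
  "graph_hom h g g' \<longleftrightarrow>
     (\<exists>v\<in>M. \<exists>e\<in>M. \<exists>v'\<in>M. \<exists>e'\<in>M. is_graph g v e \<and> is_graph g' v' e' \<and> function_from_to h v v' \<and>
        (\<forall>x\<in>M. \<forall>y\<in>M. \<forall>x'\<in>M. \<forall>y'\<in>M.
           related e x y \<and> related h x x' \<and> related h y y' \<longrightarrow> related e' x' y'))"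

text \<open>
  Second-order statement: \<open>M\<close> is the range of the set quantifiers, and \<open>C\<close> that of the class
  quantifiers. A sequence of graphs indexed by the ordinals is a class of ordered pairs.
\<close>

definition SWVP :: "'v set \<Rightarrow> bool" where
  "SWVP C \<longleftrightarrow>
     \<not> (\<exists>G\<in>C. function_on G ordinal \<and>
          (\<forall>a\<in>M. \<forall>g\<in>M. related G a g \<longrightarrow> graph g) \<and>
          (\<forall>a\<in>M. \<forall>a'\<in>M. \<forall>g\<in>M. \<forall>g'\<in>M.
             related G a g \<and> related G a' g' \<and> (a \<epsilon> a' \<or> a = a') \<longrightarrow>
             (\<exists>h\<in>M. graph_hom h g' g)) \<and>
          (\<forall>a\<in>M. \<forall>a'\<in>M. \<forall>g\<in>M. \<forall>g'\<in>M.
             related G a g \<and> related G a' g' \<and> a \<epsilon> a' \<longrightarrow>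
             \<not> (\<exists>h\<in>M. graph_hom h g g')))"

definition is_succ :: "'v \<Rightarrow> 'v \<Rightarrow> bool" where
  "is_succ s a \<longleftrightarrow> (\<forall>x\<in>M. x \<epsilon> s \<longleftrightarrow> x \<epsilon> a \<or> x = a)"

text \<open>
  \<open>v = V\<^sub>a\<close>, as witnessed by the sequence \<open>f\<close> of all levels up to \<open>a\<close>, which satisfies the
  recursion \<open>V\<^sub>b = (\<Union>c<b. Pow V\<^sub>c)\<close>.
\<close>

definition is_level :: "'v \<Rightarrow> 'v \<Rightarrow> bool" where
  "is_level v a \<longleftrightarrow> ordinal a \<and>
     (\<exists>f\<in>M. function_on f (\<lambda>b. b \<epsilon> a \<or> b = a) \<and>
        (\<forall>b\<in>M. \<forall>u\<in>M. related f b u \<longrightarrow>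
           (\<forall>x\<in>M. x \<epsilon> u \<longleftrightarrow> (\<exists>c\<in>M. \<exists>w\<in>M. c \<epsilon> b \<and> related f c w \<and> subset_of x w))) \<and>
        related f a v)"

end

definition members :: "('v \<Rightarrow> 'v \<Rightarrow> bool) \<Rightarrow> 'v \<Rightarrow> 'v set" where
  "members E a = {x. E x a}"

definition succ :: "('v \<Rightarrow> 'v \<Rightarrow> bool) \<Rightarrow> 'v \<Rightarrow> 'v" where
  "succ E a = (THE s. membership_structure.is_succ UNIV E s a)"

definition V_level :: "('v \<Rightarrow> 'v \<Rightarrow> bool) \<Rightarrow> 'v \<Rightarrow> 'v" where
  "V_level E a = (THE v. membership_structure.is_level UNIV E v a)"

end

theory Submission
  imports Defs
begin

text \<open>
  Everything is done with the normal ultrafilters themselves, without elementary embeddings.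

  SWVP: let \<open>U\<close> be a normal fine measure on \<open>\<P>\<^sub>\<kappa>(X)\<close> with \<open>X = V\<^sub>\<kappa>\<^sub>+\<^sub>1\<close>. For almost every \<open>A\<close>, the set
  \<open>A \<inter> \<kappa>\<close> is an ordinal \<open>c < \<kappa>\<close>; if elements \<open>F, F'\<close> of \<open>A\<close> satisfy a fixed definable relation at all
  \<open>\<xi> < c\<close>, they satisfy it at all \<open>\<xi> < \<kappa>\<close> (normality); and every function on \<open>c\<close> choosing a vertex
  of each \<open>G\<^sub>\<xi>\<close> extends to some \<open>F\<close> in \<open>A\<close>. Fix homomorphisms \<open>h\<^sub>\<xi>\<close> from \<open>G\<^sub>c\<close> to \<open>G\<^sub>\<xi>\<close> for \<open>\<xi> < c\<close>, and for a
  vertex \<open>x\<close> of \<open>G\<^sub>c\<close> let \<open>F\<^sub>x\<close> in \<open>A\<close> extend \<open>\<xi> \<mapsto> h\<^sub>\<xi>(x)\<close>. Then \<open>x \<mapsto> F\<^sub>x(c + 1)\<close> is a homomorphism from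
  \<open>G\<^sub>c\<close> to \<open>G\<^sub>c\<^sub>+\<^sub>1\<close>, as edges are preserved at all \<open>\<xi> < c\<close>.

  No supercompact cardinal in \<open>V\<^sub>\<kappa>\<close>: if \<open>V\<^sub>\<kappa>\<close> believes that \<open>\<mu>\<close> is supercompact, then every \<open>A\<close> of size less
  than \<open>\<kappa>\<close> carries a measure on \<open>\<P>\<^sub>\<mu>(A)\<close>, and the limit of these measures along a normal measure on
  \<open>\<P>\<^sub>\<kappa>(X)\<close> is one on \<open>\<P>\<^sub>\<mu>(X)\<close>. So \<open>\<mu>\<close> is supercompact, contradicting that \<open>\<kappa>\<close> is the least.
\<close>

section \<open>First-order definability\<close>

text \<open>In terms of the ultrapower embedding j, the ordinal c stands for \<kappa> and F(c + 1)
  for j(F)(\<kappa> + 1). An ultrapower of the universe is awkward here: the model may be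
  ill-founded, and comprehension covers first-order formulas only. A measure, however, is a set of
  the model, and only definable predicates have to be measured; hence every predicate is shown
  definable before it enters a comprehension. The choice of X has two reasons: a function from
  \<kappa> to \<open>V\<^sub>\<kappa>\<close> is a subset of \<open>V\<^sub>\<kappa>\<close>, so an
  element of X and therefore of almost every A; and \<kappa> is a subset of X, so a failure at an
  ordinal can be reflected into A. The index c + 1 is the first one to which SWVP forbids a
  homomorphism from stage c. In the second half the sets A need not lie in
  \<open>V\<^sub>\<kappa>\<close>. They inject into \<kappa>, and since \<kappa> is regular the
  image is bounded, hence in \<open>V\<^sub>\<kappa>\<close>; there the assumption on \<mu> supplies
  a measure, which is pulled back to A.\<close>

primrec rename :: "(nat \<Rightarrow> nat) \<Rightarrow> fm \<Rightarrow> fm" where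
  "rename f (Mem i j) = Mem (f i) (f j)"
| "rename f (Eq i j) = Eq (f i) (f j)"
| "rename f (Neg \<phi>) = Neg (rename f \<phi>)"
| "rename f (Conj \<phi> \<psi>) = Conj (rename f \<phi>) (rename f \<psi>)"
| "rename f (Ex i \<phi>) = Ex (f i) (rename f \<phi>)"

text \<open>Bound variables are renamed along with free ones, so injectivity of \<open>f\<close> is
  what prevents capture.\<close>

lemma sat_rename: "inj f \<Longrightarrow> sat E \<rho> (rename f \<phi>) \<longleftrightarrow> sat E (\<rho> \<circ> f) \<phi>"
proof (induction \<phi> arbitrary: \<rho>)
  case (Ex i \<phi>)
  have "\<rho>(f i := x) \<circ> f = (\<rho> \<circ> f)(i := x)" for x
    using Ex.prems by (auto simp: fun_eq_iff inj_eq)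
  then show ?case by (simp only: rename.simps sat.simps Ex.IH[OF Ex.prems])
qed auto

text \<open>A formula sees a single environment: the even slots serve as variables, the odd ones as
  a store of parameters.\<close>

definition interleave :: "(nat \<Rightarrow> 'v) \<Rightarrow> (nat \<Rightarrow> 'v) \<Rightarrow> nat \<Rightarrow> 'v" where
  "interleave \<rho> \<sigma> k = (if even k then \<rho> (k div 2) else \<sigma> (k div 2))"

definition atomic :: "((nat \<Rightarrow> 'v) \<Rightarrow> 'v) \<Rightarrow> bool" where
  "atomic t \<longleftrightarrow> (\<exists>n. t = (\<lambda>\<rho>. \<rho> n)) \<or> (\<exists>c. t = (\<lambda>\<rho>. c))"

lemma atomic_interleave:
  assumes "atomic t" "atomic s"
  shows "\<exists>\<sigma> i j. (\<forall>\<rho>. t \<rho> = interleave \<rho> \<sigma> i) \<and> (\<forall>\<rho>. s \<rho> = interleave \<rho> \<sigma> j)"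
proof -
  have *: "\<exists>i c. \<forall>\<sigma>. \<sigma> k = c \<longrightarrow> (\<forall>\<rho>. t \<rho> = interleave \<rho> \<sigma> i)" if "atomic t" for t :: "(nat \<Rightarrow> 'a) \<Rightarrow> 'a" and k
    using that unfolding atomic_def
  proof (elim disjE exE)
    fix n assume "t = (\<lambda>\<rho>. \<rho> n)"
    then show ?thesis by (intro exI[of _ "2 * n"]) (simp add: interleave_def)
  next
    fix c assume "t = (\<lambda>\<rho>. c)"
    then show ?thesis by (intro exI[of _ "2 * k + 1"] exI[of _ c]) (simp add: interleave_def)
  qed
  obtain i c where i: "\<And>\<sigma>. \<sigma> 0 = c \<Longrightarrow> \<forall>\<rho>. t \<rho> = interleave \<rho> \<sigma> i" using *[OF assms(1), of 0] by blast
  obtain j d where j: "\<And>\<sigma>. \<sigma> 1 = d \<Longrightarrow> \<forall>\<rho>. s \<rho> = interleave \<rho> \<sigma> j" using *[OF assms(2), of 1] by blast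
  show ?thesis
    by (intro exI[of _ "\<lambda>k. if k = 0 then c else d"] exI[of _ i] exI[of _ j] conjI i j) auto
qed

locale zfc_model =
  fixes E :: "'v \<Rightarrow> 'v \<Rightarrow> bool"  (infix "\<epsilon>" 50)
  assumes ZFC: "ZFC E"
begin

text \<open>
  Definability with parameters. A quantifier pushes the bound variable to the front of the
  environment, so that definability of a predicate written as a HOL term is proved by resolution
  along its syntax.
\<close>

inductive dpred :: "((nat \<Rightarrow> 'v) \<Rightarrow> bool) \<Rightarrow> bool" where
  dp_atom_mem: "atomic t \<Longrightarrow> atomic s \<Longrightarrow> dpred (\<lambda>\<rho>. t \<rho> \<epsilon> s \<rho>)"
| dp_atom_eq: "atomic t \<Longrightarrow> atomic s \<Longrightarrow> dpred (\<lambda>\<rho>. t \<rho> = s \<rho>)"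
| dp_not: "dpred P \<Longrightarrow> dpred (\<lambda>\<rho>. \<not> P \<rho>)"
| dp_conj: "dpred P \<Longrightarrow> dpred Q \<Longrightarrow> dpred (\<lambda>\<rho>. P \<rho> \<and> Q \<rho>)"
| dp_ex: "dpred (\<lambda>\<rho>. P (\<lambda>i. \<rho> (Suc i)) (\<rho> 0)) \<Longrightarrow> dpred (\<lambda>\<rho>. \<exists>x. P \<rho> x)"

lemma atomic_subst: "atomic t \<Longrightarrow> (\<And>i. atomic (\<lambda>\<rho>. s \<rho> i)) \<Longrightarrow> atomic (\<lambda>\<rho>. t (s \<rho>))"
  unfolding atomic_def by auto

text \<open>Under a quantifier the substitution is lifted as for de Bruijn indices: the bound index
  0 stays and the old values are shifted past it.\<close>

lemma dpred_subst: "dpred P \<Longrightarrow> (\<And>i. atomic (\<lambda>\<rho>. s \<rho> i)) \<Longrightarrow> dpred (\<lambda>\<rho>. P (s \<rho>))"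
proof (induction arbitrary: s rule: dpred.induct)
  case (dp_ex P)
  let ?s = "\<lambda>\<rho> i. case i of 0 \<Rightarrow> \<rho> 0 | Suc j \<Rightarrow> s (\<lambda>i. \<rho> (Suc i)) j"
  have "atomic (\<lambda>\<rho>. ?s \<rho> i)" for i
  proof (cases i)
    case 0 then show ?thesis by (auto simp: atomic_def)
  next
    case (Suc j)
    have "atomic (\<lambda>\<rho>. s \<rho> j)" by (rule dp_ex.prems)
    then show ?thesis using Suc by (auto simp: atomic_def fun_eq_iff)
  qed
  from dp_ex.IH[of ?s, OF this] show ?case
    by (intro dpred.dp_ex) simp
qed (rule dpred.intros atomic_subst; assumption | rule dpred.intros; blast intro: atomic_subst)+

text \<open>The two schemas accept only formulas, so the semantic closure conditions are translated
  one by one; the constants occurring in \<open>P\<close> end up in the parameter slots.\<close>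

lemma dpred_formula: "dpred P \<Longrightarrow> \<exists>\<phi> \<sigma>. \<forall>\<rho>. P \<rho> \<longleftrightarrow> sat E (interleave \<rho> \<sigma>) \<phi>"
proof (induction rule: dpred.induct)
  case (dp_atom_mem t s)
  then obtain \<sigma> i j where "\<forall>\<rho>. t \<rho> = interleave \<rho> \<sigma> i" "\<forall>\<rho>. s \<rho> = interleave \<rho> \<sigma> j"
    using atomic_interleave by metis
  then show ?case by (intro exI[of _ "Mem i j"] exI[of _ \<sigma>]) simp
next
  case (dp_atom_eq t s)
  then obtain \<sigma> i j where "\<forall>\<rho>. t \<rho> = interleave \<rho> \<sigma> i" "\<forall>\<rho>. s \<rho> = interleave \<rho> \<sigma> j"
    using atomic_interleave by metis
  then show ?case by (intro exI[of _ "Eq i j"] exI[of _ \<sigma>]) simp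
next
  case (dp_not P)
  then obtain \<phi> \<sigma> where "\<forall>\<rho>. P \<rho> \<longleftrightarrow> sat E (interleave \<rho> \<sigma>) \<phi>" by blast
  then show ?case by (intro exI[of _ "Neg \<phi>"] exI[of _ \<sigma>]) auto
next
  case (dp_conj P Q)
  then obtain \<phi> \<sigma> \<psi> \<tau> where P: "\<forall>\<rho>. P \<rho> \<longleftrightarrow> sat E (interleave \<rho> \<sigma>) \<phi>"
    and Q: "\<forall>\<rho>. Q \<rho> \<longleftrightarrow> sat E (interleave \<rho> \<tau>) \<psi>" by blast
  \<comment> \<open>The two parameter lists are merged: slot 2i + 1 moves to 4i + 1 for the first
    conjunct and to 4i + 3 for the second, while the variable slots stay.\<close>
  let ?\<sigma> = "\<lambda>i. if even i then \<sigma> (i div 2) else \<tau> (i div 2)"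
  let ?f = "\<lambda>k::nat. if even k then k else 2 * k - 1"
  let ?g = "\<lambda>k::nat. if even k then k else 2 * k + 1"
  have f: "inj ?f"
  proof (rule injI)
    fix x y assume "?f x = ?f y"
    then show "x = y" by (simp split: if_splits; presburger)
  qed
  have g: "inj ?g"
  proof (rule injI)
    fix x y assume "?g x = ?g y"
    then show "x = y" by (simp split: if_splits; presburger)
  qed
  have 1: "interleave \<rho> ?\<sigma> \<circ> ?f = interleave \<rho> \<sigma>" for \<rho>
  proof (rule ext)
    fix k show "(interleave \<rho> ?\<sigma> \<circ> ?f) k = interleave \<rho> \<sigma> k"
    proof -
      have "(\<exists>i. k = 2 * i) \<or> (\<exists>i. k = Suc (2 * i))" by presburger
      then show ?thesis by (elim disjE exE) (simp_all add: interleave_def)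
    qed
  qed
  have 2: "interleave \<rho> ?\<sigma> \<circ> ?g = interleave \<rho> \<tau>" for \<rho>
  proof (rule ext)
    fix k show "(interleave \<rho> ?\<sigma> \<circ> ?g) k = interleave \<rho> \<tau> k"
    proof -
      have "(\<exists>i. k = 2 * i) \<or> (\<exists>i. k = Suc (2 * i))" by presburger
      then show ?thesis by (elim disjE exE) (simp_all add: interleave_def)
    qed
  qed
  show ?case
    by (intro exI[of _ "Conj (rename ?f \<phi>) (rename ?g \<psi>)"] exI[of _ ?\<sigma>])
      (simp only: sat.simps rename.simps sat_rename[OF f] sat_rename[OF g] 1 2, simp add: P Q)
next
  case (dp_ex P)
  then obtain \<phi> \<sigma> where P: "\<And>\<rho>. P (\<lambda>i. \<rho> (Suc i)) (\<rho> 0) \<longleftrightarrow> sat E (interleave \<rho> \<sigma>) \<phi>" by blast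
  \<comment> \<open>The bound variable moves from slot 0 to slot 1, which is freed by shifting the
    parameters one place; the other variables close the gap.\<close>
  let ?f = "\<lambda>k::nat. if k = 0 then 1 else if even k then k - 2 else k + 2"
  let ?\<sigma> = "\<lambda>i. \<sigma> (i - 1)"
  have f: "inj ?f"
  proof (rule injI)
    fix x y assume "?f x = ?f y"
    then show "x = y" by (simp split: if_splits; presburger)
  qed
  have 1: "(interleave \<rho> ?\<sigma>)(1 := x) \<circ> ?f = interleave (case_nat x \<rho>) \<sigma>" for x \<rho>
  proof (rule ext)
    fix k
    have "k = 0 \<or> (\<exists>i. k = 2 * Suc i) \<or> (\<exists>i. k = Suc (2 * i))" by presburger
    then show "((interleave \<rho> ?\<sigma>)(1 := x) \<circ> ?f) k = interleave (case_nat x \<rho>) \<sigma> k"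
      by (elim disjE exE) (simp_all add: interleave_def)
  qed
  have 2: "P \<rho> x \<longleftrightarrow> sat E (interleave (case_nat x \<rho>) \<sigma>) \<phi>" for \<rho> x
    using P[of "case_nat x \<rho>"] by simp
  show ?case
    by (intro exI[of _ "Ex 1 (rename ?f \<phi>)"] exI[of _ ?\<sigma>])
      (simp only: sat.simps rename.simps sat_rename[OF f] 1, simp add: 2)
qed

section \<open>Definable predicates and terms under composition\<close>

lemma atomic_var: "atomic (\<lambda>\<rho>. \<rho> n)" and atomic_const: "atomic (\<lambda>\<rho>. c)"
  by (auto simp: atomic_def)

lemma dp_True: "dpred (\<lambda>\<rho>. True)"
proof -
  have "dpred (\<lambda>\<rho>. \<rho> 0 = \<rho> 0)" by (intro dp_atom_eq atomic_var atomic_const)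
  then show ?thesis by simp
qed

lemma dp_const: "dpred (\<lambda>\<rho>. b)"
  using dp_True dp_not[OF dp_True] by (cases b) auto

lemma dp_disj: "dpred P \<Longrightarrow> dpred Q \<Longrightarrow> dpred (\<lambda>\<rho>. P \<rho> \<or> Q \<rho>)"
  using dp_not[OF dp_conj[OF dp_not[of P] dp_not[of Q]]] by simp

lemma dp_imp: "dpred P \<Longrightarrow> dpred Q \<Longrightarrow> dpred (\<lambda>\<rho>. P \<rho> \<longrightarrow> Q \<rho>)"
  unfolding imp_conv_disj by (rule dp_disj[OF dp_not])

lemma dp_iff: "dpred P \<Longrightarrow> dpred Q \<Longrightarrow> dpred (\<lambda>\<rho>. P \<rho> \<longleftrightarrow> Q \<rho>)"
  unfolding iff_conv_conj_imp by (rule dp_conj[OF dp_imp dp_imp])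

lemma dp_all:
  assumes "dpred (\<lambda>\<rho>. P (\<lambda>i. \<rho> (Suc i)) (\<rho> 0))" shows "dpred (\<lambda>\<rho>. \<forall>x. P \<rho> x)"
proof -
  have "dpred (\<lambda>\<rho>. \<not> (\<exists>x. \<not> P \<rho> x))"
    by (rule dp_not, rule dp_ex, rule dp_not, rule assms)
  then show ?thesis by simp
qed

text \<open>The language has no function symbols, so a function counts as a term when its graph is
  definable; index 0 holds the value.\<close>

definition dterm :: "((nat \<Rightarrow> 'v) \<Rightarrow> 'v) \<Rightarrow> bool" where
  "dterm t \<longleftrightarrow> dpred (\<lambda>\<rho>. \<rho> 0 = t (\<lambda>i. \<rho> (Suc i)))"

lemma atomic_case_nat:
  "atomic t \<Longrightarrow> (\<And>j. atomic (\<lambda>\<rho>. s \<rho> j)) \<Longrightarrow> atomic (\<lambda>\<rho>. case_nat (t \<rho>) (s \<rho>) i)"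
  by (cases i) auto

lemma dpred_weaken1:
  assumes "dpred (\<lambda>\<rho>. P (\<lambda>i. \<rho> (Suc i)) (\<rho> 0))"
  shows "dpred (\<lambda>\<rho>. P (\<lambda>i. \<rho> (Suc (Suc i))) (\<rho> 0))"
proof -
  have "dpred (\<lambda>\<rho>. P (\<lambda>i. case_nat (\<rho> 0) (\<lambda>j. \<rho> (Suc (Suc j))) (Suc i)) (case_nat (\<rho> 0) (\<lambda>j. \<rho> (Suc (Suc j))) 0))"
    by (rule dpred_subst[OF assms, of "\<lambda>\<rho>. case_nat (\<rho> 0) (\<lambda>j. \<rho> (Suc (Suc j)))"])
       (intro atomic_case_nat atomic_var atomic_const)+
  then show ?thesis by simp
qed

lemma dterm_weaken: "dterm t \<Longrightarrow> dterm (\<lambda>\<rho>. t (\<lambda>i. \<rho> (Suc i)))"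
  using dpred_weaken1[of "\<lambda>\<rho> x. x = t \<rho>"] unfolding dterm_def by blast

text \<open>Freezing the environment lets facts about predicates of one variable, such as
  \<open>mem_Sep\<close>, be applied below other variables.\<close>

lemma dpred_at:
  assumes "dpred (\<lambda>\<rho>. P (\<lambda>i. \<rho> (Suc i)) (\<rho> 0))" shows "dpred (\<lambda>\<rho>. P \<tau> (\<rho> 0))"
proof -
  have "dpred (\<lambda>\<rho>. P (\<lambda>i. case_nat (\<rho> 0) \<tau> (Suc i)) (case_nat (\<rho> 0) \<tau> 0))"
    by (rule dpred_subst[OF assms, of "\<lambda>\<rho>. case_nat (\<rho> 0) \<tau>"])
       (intro atomic_case_nat atomic_var atomic_const)+
  then show ?thesis by simp
qed

text \<open>\<open>P\<close> holds of \<open>t\<close> iff some \<open>x\<close> equal to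
  \<open>t\<close> satisfies \<open>P\<close>; this trades the term for a quantifier and its
  graph.\<close>

lemma dpred_inst:
  assumes P: "dpred (\<lambda>\<rho>. P (\<lambda>i. \<rho> (Suc i)) (\<rho> 0))" and t: "dterm t"
  shows "dpred (\<lambda>\<rho>. P \<rho> (t \<rho>))"
proof -
  have "dpred (\<lambda>\<rho>. \<exists>x. x = t \<rho> \<and> P \<rho> x)"
    by (intro dp_ex dp_conj P t[unfolded dterm_def])
  then show ?thesis by simp
qed

lemma dt_var: "dterm (\<lambda>\<rho>. \<rho> n)"
  unfolding dterm_def by (intro dp_atom_eq atomic_var atomic_const)

lemma dt_const: "dterm (\<lambda>\<rho>. c)"
  unfolding dterm_def by (intro dp_atom_eq atomic_var atomic_const)

lemma dpred_comp1: "dpred (\<lambda>\<rho>. P (\<rho> 0)) \<Longrightarrow> dterm t \<Longrightarrow> dpred (\<lambda>\<rho>. P (t \<rho>))"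
  using dpred_inst[of "\<lambda>\<rho>. P" t] by simp

text \<open>\<open>dpred_inst\<close> fills index 0 only, so the arguments are swapped and then
  filled one after the other.\<close>

lemma dpred_comp2:
  assumes R: "dpred (\<lambda>\<rho>. R (\<rho> 0) (\<rho> 1))" and t: "dterm t" and s: "dterm s"
  shows "dpred (\<lambda>\<rho>. R (t \<rho>) (s \<rho>))"
proof -
  have "dpred (\<lambda>\<rho>. R (\<rho> 1) (\<rho> 0))"
    using dpred_subst[OF R, of "\<lambda>\<rho>. case_nat (\<rho> 1) (\<lambda>i. \<rho> 0)"] 
    by (simp add: atomic_case_nat atomic_var atomic_const)
  then have "dpred (\<lambda>\<rho>. R (\<rho> 0) (s (\<lambda>i. \<rho> (Suc i))))"
    using dpred_inst[of "\<lambda>\<rho>. R (\<rho> 0)", OF _ dterm_weaken[OF s]] by simp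
  then show ?thesis
    using dpred_inst[of "\<lambda>\<rho> x. R x (s \<rho>)", OF _ t] by simp
qed

lemma dpred_comp3:
  assumes R: "dpred (\<lambda>\<rho>. R (\<rho> 0) (\<rho> 1) (\<rho> 2))" and t: "dterm t" and s: "dterm s" and u: "dterm u"
  shows "dpred (\<lambda>\<rho>. R (t \<rho>) (s \<rho>) (u \<rho>))"
proof -
  have "dpred (\<lambda>\<rho>. R (\<rho> 1) (\<rho> 2) (\<rho> 0))"
    using dpred_subst[OF R, of "\<lambda>\<rho>. case_nat (\<rho> 1) (case_nat (\<rho> 2) (\<lambda>i. \<rho> 0))"] 
    by (simp add: atomic_case_nat atomic_var atomic_const numeral_2_eq_2)
  then have "dpred (\<lambda>\<rho>. R (\<rho> 0) (\<rho> 1) (u (\<lambda>i. \<rho> (Suc (Suc i)))))"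
    using dpred_inst[of "\<lambda>\<rho>. R (\<rho> 0) (\<rho> 1)", OF _ dterm_weaken[OF dterm_weaken[OF u]]]
    by (simp add: numeral_2_eq_2)
  then have "dpred (\<lambda>\<rho>. R (\<rho> 1) (\<rho> 0) (u (\<lambda>i. \<rho> (Suc (Suc i)))))"
    using dpred_subst[of "\<lambda>\<rho>. R (\<rho> 0) (\<rho> 1) (u (\<lambda>i. \<rho> (Suc (Suc i))))" "\<lambda>\<rho>. case_nat (\<rho> 1) (case_nat (\<rho> 0) (\<lambda>i. \<rho> (Suc (Suc i))))"] 
    by (simp add: atomic_case_nat atomic_var atomic_const)
  then have "dpred (\<lambda>\<rho>. R (\<rho> 0) (s (\<lambda>i. \<rho> (Suc i))) (u (\<lambda>i. \<rho> (Suc i))))"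
    using dpred_inst[of "\<lambda>\<rho> x. R (\<rho> 0) x (u (\<lambda>i. \<rho> (Suc i)))", OF _ dterm_weaken[OF s]] by simp
  then show ?thesis
    using dpred_inst[of "\<lambda>\<rho> x. R x (s \<rho>) (u \<rho>)", OF _ t] by simp
qed

lemma dp_eq: "dterm t \<Longrightarrow> dterm s \<Longrightarrow> dpred (\<lambda>\<rho>. t \<rho> = s \<rho>)"
  by (rule dpred_comp2[of "(=)"]) (intro dp_atom_eq atomic_var)

lemma dp_mem: "dterm t \<Longrightarrow> dterm s \<Longrightarrow> dpred (\<lambda>\<rho>. t \<rho> \<epsilon> s \<rho>)"
  by (rule dpred_comp2[of "(\<epsilon>)"]) (intro dp_atom_mem atomic_var)

lemma dterm_comp1:
  assumes f: "dterm (\<lambda>\<rho>. f (\<rho> 0))" and t: "dterm t"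
  shows "dterm (\<lambda>\<rho>. f (t \<rho>))"
  unfolding dterm_def
proof (rule dpred_comp2[of "\<lambda>y x. y = f x"])
  show "dpred (\<lambda>\<rho>. \<rho> 0 = f (\<rho> 1))" using f by (simp add: dterm_def)
qed (intro dt_var dterm_weaken t)+

lemma dterm_comp2:
  assumes f: "dterm (\<lambda>\<rho>. f (\<rho> 0) (\<rho> 1))" and t: "dterm t" and s: "dterm s"
  shows "dterm (\<lambda>\<rho>. f (t \<rho>) (s \<rho>))"
  unfolding dterm_def
proof (rule dpred_comp3[of "\<lambda>y x z. y = f x z"])
  show "dpred (\<lambda>\<rho>. \<rho> 0 = f (\<rho> 1) (\<rho> 2))" using f by (simp add: dterm_def numeral_2_eq_2)
qed (intro dt_var dterm_weaken t s)+

lemmas logic_dfn = dp_const dp_not dp_conj dp_disj dp_imp dp_iff dp_ex dp_all dp_eq dp_mem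
  dt_const dt_var

section \<open>Set operations as definable terms\<close>

lemma extensionality_iff: "a = b \<longleftrightarrow> (\<forall>x. x \<epsilon> a \<longleftrightarrow> x \<epsilon> b)"
  using ZFC by (auto simp: ZFC_def extensionality_def)

lemma the_set: "\<exists>b. \<forall>x. x \<epsilon> b \<longleftrightarrow> P x \<Longrightarrow> x \<epsilon> (THE b. \<forall>x. x \<epsilon> b \<longleftrightarrow> P x) \<longleftrightarrow> P x"
proof -
  assume ex: "\<exists>b. \<forall>x. x \<epsilon> b \<longleftrightarrow> P x"
  have "\<exists>!b. \<forall>x. x \<epsilon> b \<longleftrightarrow> P x"
    by (rule ex_ex1I[OF ex]) (subst extensionality_iff, blast)
  from theI'[OF this] show ?thesis by blast
qed

definition Sep :: "'v \<Rightarrow> ('v \<Rightarrow> bool) \<Rightarrow> 'v" where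
  "Sep a P = (THE b. \<forall>x. x \<epsilon> b \<longleftrightarrow> x \<epsilon> a \<and> P x)"

lemma mem_Sep:
  assumes "dpred (\<lambda>\<rho>. P (\<rho> 0))" shows "x \<epsilon> Sep a P \<longleftrightarrow> x \<epsilon> a \<and> P x"
proof -
  obtain \<phi> \<sigma> where *: "\<And>\<rho>. P (\<rho> 0) \<longleftrightarrow> sat E (interleave \<rho> \<sigma>) \<phi>"
    using dpred_formula[OF assms] by blast
  \<comment> \<open>Slot 0 is a variable slot, so the update made by the schema sets exactly the
    variable of \<open>P\<close>; the other variable slots receive arbitrary values.\<close>
  have "P x \<longleftrightarrow> sat E ((interleave \<sigma> \<sigma>)(0 := x)) \<phi>" for x
  proof -
    have "(interleave \<sigma> \<sigma>)(0 := x) = interleave (\<sigma>(0 := x)) \<sigma>"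
      by (auto simp: fun_eq_iff interleave_def elim!: evenE)
    then show ?thesis using *[of "\<sigma>(0 := x)"] by simp
  qed
  then have "\<exists>b. \<forall>x. x \<epsilon> b \<longleftrightarrow> x \<epsilon> a \<and> P x"
    using ZFC unfolding ZFC_def separation_schema_def by simp
  then show ?thesis unfolding Sep_def by (rule the_set)
qed

text \<open>By Extensionality, being equal to this set is itself a first-order condition on members.
  The other basic operations are treated in the same way.\<close>

lemma dt_Sep:
  assumes P: "dpred (\<lambda>\<rho>. P (\<lambda>i. \<rho> (Suc i)) (\<rho> 0))" and t: "dterm t"
  shows "dterm (\<lambda>\<rho>. Sep (t \<rho>) (P \<rho>))"
proof -
  have *: "y = Sep (t \<rho>) (P \<rho>) \<longleftrightarrow> (\<forall>x. x \<epsilon> y \<longleftrightarrow> x \<epsilon> t \<rho> \<and> P \<rho> x)" for y \<rho>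
    by (simp add: extensionality_iff[of y] mem_Sep[OF dpred_at[OF P]])
  show ?thesis unfolding dterm_def *
    by (intro logic_dfn dterm_weaken t dpred_weaken1[OF P])
qed

definition Repl :: "'v \<Rightarrow> ('v \<Rightarrow> 'v) \<Rightarrow> 'v" where
  "Repl a f = (THE b. \<forall>y. y \<epsilon> b \<longleftrightarrow> (\<exists>x. x \<epsilon> a \<and> y = f x))"

lemma mem_Repl:
  assumes "dterm (\<lambda>\<rho>. f (\<rho> 0))" shows "y \<epsilon> Repl a f \<longleftrightarrow> (\<exists>x. x \<epsilon> a \<and> y = f x)"
proof -
  obtain \<phi> \<sigma> where *: "\<And>\<rho>. \<rho> 0 = f (\<rho> 1) \<longleftrightarrow> sat E (interleave \<rho> \<sigma>) \<phi>"
    using dpred_formula[OF assms[unfolded dterm_def]] by auto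
  \<comment> \<open>The graph of \<open>f\<close> has its value in slot 0 and its argument in slot
    2, whereas the schema puts the argument at 0 and the value at 1; every other slot moves up by
    one.\<close>
  let ?g = "\<lambda>k::nat. if k = 0 then 1 else if k = 2 then 0 else k + 1"
  let ?\<tau> = "\<lambda>k. interleave \<sigma> \<sigma> (k - 1)"
  have g: "inj ?g" by (auto simp: inj_def)
  have "y = f x \<longleftrightarrow> sat E (?\<tau>(0 := x, 1 := y)) (rename ?g \<phi>)" for x y
  proof -
    have "(?\<tau>(0 := x, 1 := y)) \<circ> ?g = interleave (\<sigma>(0 := y, 1 := x)) \<sigma>"
      by (auto simp: fun_eq_iff interleave_def elim!: evenE)
    then show ?thesis using *[of "\<sigma>(0 := y, 1 := x)"] by (simp add: sat_rename[OF g])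
  qed
  note f_sat = this[symmetric]
  have "replacement_schema E" using ZFC by (simp add: ZFC_def)
  then have "(\<forall>x. x \<epsilon> a \<longrightarrow> (\<exists>!y. sat E (?\<tau>(0 := x, 1 := y)) (rename ?g \<phi>))) \<longrightarrow>
      (\<exists>b. \<forall>y. y \<epsilon> b \<longleftrightarrow> (\<exists>x. x \<epsilon> a \<and> sat E (?\<tau>(0 := x, 1 := y)) (rename ?g \<phi>)))"
    unfolding replacement_schema_def by blast
  then have "\<exists>b. \<forall>y. y \<epsilon> b \<longleftrightarrow> (\<exists>x. x \<epsilon> a \<and> y = f x)"
    unfolding f_sat by simp
  then show ?thesis unfolding Repl_def by (rule the_set)
qed

lemma dterm_at:
  assumes "dterm (\<lambda>\<rho>. f (\<lambda>i. \<rho> (Suc i)) (\<rho> 0))" shows "dterm (\<lambda>\<rho>. f \<tau> (\<rho> 0))"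
proof -
  have "dpred (\<lambda>\<rho>. \<rho> 0 = f (\<lambda>i. \<rho> (Suc (Suc i))) (\<rho> 1))"
    using assms by (simp add: dterm_def)
  from dpred_subst[OF this, of "\<lambda>\<rho>. case_nat (\<rho> 0) (case_nat (\<rho> 1) \<tau>)"]
  show ?thesis by (simp add: dterm_def atomic_case_nat atomic_var atomic_const)
qed

lemma dt_Repl:
  assumes f: "dterm (\<lambda>\<rho>. f (\<lambda>i. \<rho> (Suc i)) (\<rho> 0))" and t: "dterm t"
  shows "dterm (\<lambda>\<rho>. Repl (t \<rho>) (f \<rho>))"
proof -
  have *: "y = Repl (t \<rho>) (f \<rho>) \<longleftrightarrow> (\<forall>z. z \<epsilon> y \<longleftrightarrow> (\<exists>x. x \<epsilon> t \<rho> \<and> z = f \<rho> x))" for y \<rho>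
    by (simp add: extensionality_iff[of y] mem_Repl[OF dterm_at[OF f]])
  have "dpred (\<lambda>\<rho>. \<rho> 0 = f (\<lambda>i. \<rho> (Suc (Suc i))) (\<rho> 1))"
    using f by (simp add: dterm_def)
  from dpred_subst[OF this, of "\<lambda>\<rho>. case_nat (\<rho> 1) (case_nat (\<rho> 0) (\<lambda>i. \<rho> (Suc (Suc (Suc i)))))"]
  have "dpred (\<lambda>\<rho>. \<rho> 1 = f (\<lambda>i. \<rho> (Suc (Suc (Suc i)))) (\<rho> 0))"
    by (simp add: atomic_case_nat atomic_var atomic_const)
  then show ?thesis unfolding dterm_def *
    by (intro dp_all dp_iff dp_conj dp_ex dp_mem dt_var dterm_weaken t) simp
qed

definition Upair :: "'v \<Rightarrow> 'v \<Rightarrow> 'v" where "Upair a b = (THE c. \<forall>x. x \<epsilon> c \<longleftrightarrow> x = a \<or> x = b)"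
definition BigUn :: "'v \<Rightarrow> 'v" where "BigUn a = (THE b. \<forall>x. x \<epsilon> b \<longleftrightarrow> (\<exists>y. y \<epsilon> a \<and> x \<epsilon> y))"
definition Power :: "'v \<Rightarrow> 'v" where "Power a = (THE b. \<forall>x. x \<epsilon> b \<longleftrightarrow> (\<forall>y. y \<epsilon> x \<longrightarrow> y \<epsilon> a))"

lemma mem_Upair [simp]: "x \<epsilon> Upair a b \<longleftrightarrow> x = a \<or> x = b"
  unfolding Upair_def by (rule the_set) (use ZFC in \<open>simp add: ZFC_def pairing_def\<close>)

lemma mem_BigUn [simp]: "x \<epsilon> BigUn a \<longleftrightarrow> (\<exists>y. y \<epsilon> a \<and> x \<epsilon> y)"
  unfolding BigUn_def by (rule the_set) (use ZFC in \<open>simp add: ZFC_def union_axiom_def\<close>)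

lemma mem_Power [simp]: "x \<epsilon> Power a \<longleftrightarrow> (\<forall>y. y \<epsilon> x \<longrightarrow> y \<epsilon> a)"
  unfolding Power_def by (rule the_set) (use ZFC in \<open>simp add: ZFC_def power_axiom_def\<close>)

lemma dt_Upair: "dterm t \<Longrightarrow> dterm s \<Longrightarrow> dterm (\<lambda>\<rho>. Upair (t \<rho>) (s \<rho>))"
proof (rule dterm_comp2[of Upair])
  have *: "y = Upair a b \<longleftrightarrow> (\<forall>x. x \<epsilon> y \<longleftrightarrow> x = a \<or> x = b)" for y a b
    by (simp add: extensionality_iff[of y])
  show "dterm (\<lambda>\<rho>. Upair (\<rho> 0) (\<rho> 1))" unfolding dterm_def * by (intro logic_dfn)
qed

lemma dt_BigUn: "dterm t \<Longrightarrow> dterm (\<lambda>\<rho>. BigUn (t \<rho>))"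
proof (rule dterm_comp1[of BigUn])
  have *: "y = BigUn a \<longleftrightarrow> (\<forall>x. x \<epsilon> y \<longleftrightarrow> (\<exists>z. z \<epsilon> a \<and> x \<epsilon> z))" for y a
    by (simp add: extensionality_iff[of y])
  show "dterm (\<lambda>\<rho>. BigUn (\<rho> 0))" unfolding dterm_def * by (intro logic_dfn)
qed

lemma dt_Power: "dterm t \<Longrightarrow> dterm (\<lambda>\<rho>. Power (t \<rho>))"
proof (rule dterm_comp1[of Power])
  have *: "y = Power a \<longleftrightarrow> (\<forall>x. x \<epsilon> y \<longleftrightarrow> (\<forall>z. z \<epsilon> x \<longrightarrow> z \<epsilon> a))" for y a
    by (simp add: extensionality_iff[of y])
  show "dterm (\<lambda>\<rho>. Power (\<rho> 0))" unfolding dterm_def * by (intro logic_dfn)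
qed

lemmas set_dfn = logic_dfn dt_Sep dt_Repl dt_Upair dt_BigUn dt_Power

definition Empty :: 'v where "Empty = (THE b. \<forall>x. x \<epsilon> b \<longleftrightarrow> False)"

definition pair :: "'v \<Rightarrow> 'v \<Rightarrow> 'v" where "pair a b = Upair (Upair a a) (Upair a b)"

lemma dt_pair: "dterm t \<Longrightarrow> dterm s \<Longrightarrow> dterm (\<lambda>\<rho>. pair (t \<rho>) (s \<rho>))"
  unfolding pair_def by (intro set_dfn)

lemma Upair_eq: "Upair a b = Upair c d \<longleftrightarrow> a = c \<and> b = d \<or> a = d \<and> b = c"
  by (simp add: extensionality_iff[of "Upair a b"]) metis

lemma pair_eq [simp]: "pair a b = pair c d \<longleftrightarrow> a = c \<and> b = d"
  unfolding pair_def by (auto simp: Upair_eq)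

definition Times :: "'v \<Rightarrow> 'v \<Rightarrow> 'v" where
  "Times a b = BigUn (Repl a (\<lambda>x. Repl b (\<lambda>y. pair x y)))"

lemma dt_Times: "dterm t \<Longrightarrow> dterm s \<Longrightarrow> dterm (\<lambda>\<rho>. Times (t \<rho>) (s \<rho>))"
  by (rule dterm_comp2[of Times]) (unfold Times_def, intro set_dfn dt_pair)

lemma mem_Times [simp]: "p \<epsilon> Times a b \<longleftrightarrow> (\<exists>x y. x \<epsilon> a \<and> y \<epsilon> b \<and> p = pair x y)"
proof -
  have "dterm (\<lambda>\<rho>. Repl b (\<lambda>y. pair (\<rho> 0) y))" "\<And>x. dterm (\<lambda>\<rho>. pair x (\<rho> 0))"
    by (intro set_dfn dt_pair)+
  then show ?thesis unfolding Times_def by (auto simp: mem_Repl)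
qed

text \<open>Application made total: where \<open>F\<close> has exactly one value at
  \<open>x\<close>, the outer union strips the singleton of that value. The inner double union
  bounds the second components of Kuratowski pairs.\<close>

definition app :: "'v \<Rightarrow> 'v \<Rightarrow> 'v" where
  "app F x = BigUn (Sep (BigUn (BigUn F)) (\<lambda>y. pair x y \<epsilon> F))"

lemma dt_app: "dterm t \<Longrightarrow> dterm s \<Longrightarrow> dterm (\<lambda>\<rho>. app (t \<rho>) (s \<rho>))"
  by (rule dterm_comp2[of app]) (unfold app_def, intro set_dfn dt_pair)

lemma app_eq:
  assumes "pair x y \<epsilon> F" "\<And>z. pair x z \<epsilon> F \<Longrightarrow> z = y" shows "app F x = y"
proof -
  have d: "dpred (\<lambda>\<rho>. pair x (\<rho> 0) \<epsilon> F)" by (intro set_dfn dt_pair)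
  have "y \<epsilon> BigUn (BigUn F)"
  proof -
    have "y \<epsilon> Upair x y" "Upair x y \<epsilon> pair x y" by (auto simp: pair_def)
    then show ?thesis using assms(1) by auto
  qed
  then have m: "z \<epsilon> Sep (BigUn (BigUn F)) (\<lambda>y. pair x y \<epsilon> F) \<longleftrightarrow> z = y" for z
    unfolding mem_Sep[OF d] using assms by blast
  then have "\<forall>z. z \<epsilon> app F x \<longleftrightarrow> z \<epsilon> y" by (simp add: app_def m)
  then show ?thesis by (rule iffD2[OF extensionality_iff])
qed

definition Lam :: "'v \<Rightarrow> ('v \<Rightarrow> 'v) \<Rightarrow> 'v" where "Lam a f = Repl a (\<lambda>x. pair x (f x))"

lemma dt_Lam:
  assumes "dterm (\<lambda>\<rho>. f (\<lambda>i. \<rho> (Suc i)) (\<rho> 0))" "dterm t"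
  shows "dterm (\<lambda>\<rho>. Lam (t \<rho>) (f \<rho>))"
  unfolding Lam_def by (intro dt_Repl dt_pair dt_var assms)

lemma pair_mem_Lam:
  assumes "dterm (\<lambda>\<rho>. f (\<rho> 0))" shows "pair x y \<epsilon> Lam a f \<longleftrightarrow> x \<epsilon> a \<and> y = f x"
  unfolding Lam_def by (subst mem_Repl) (intro dt_pair dt_var assms, auto)

lemma mem_Lam:
  assumes "dterm (\<lambda>\<rho>. f (\<rho> 0))" shows "p \<epsilon> Lam a f \<longleftrightarrow> (\<exists>x. x \<epsilon> a \<and> p = pair x (f x))"
  unfolding Lam_def by (subst mem_Repl) (intro dt_pair dt_var assms, auto)

lemma app_Lam: "dterm (\<lambda>\<rho>. f (\<rho> 0)) \<Longrightarrow> x \<epsilon> a \<Longrightarrow> app (Lam a f) x = f x"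
  by (rule app_eq) (auto simp: pair_mem_Lam)

lemmas fun_dfn = set_dfn dt_pair dt_Times dt_app dt_Lam

end

section \<open>Functions, cardinality and ordinals\<close>

sublocale zfc_model \<subseteq> V: membership_structure UNIV E .

context zfc_model begin

lemma set_eqI: "(\<And>x. x \<epsilon> a \<longleftrightarrow> x \<epsilon> b) \<Longrightarrow> a = b"
  by (subst extensionality_iff) blast

lemma V_subset_of: "V.subset_of a b \<longleftrightarrow> (\<forall>x. x \<epsilon> a \<longrightarrow> x \<epsilon> b)"
  by (simp add: V.subset_of_def)

lemma V_is_upair: "V.is_upair p a b \<longleftrightarrow> p = Upair a b"
  by (simp add: V.is_upair_def extensionality_iff[of p])

lemma V_is_pair: "V.is_pair p a b \<longleftrightarrow> p = pair a b"
  by (simp add: V.is_pair_def V_is_upair pair_def)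

lemma V_related: "V.related r x y \<longleftrightarrow> pair x y \<epsilon> r"
  by (simp add: V.related_def V_is_pair)

lemma V_function_on: "V.function_on F D \<longleftrightarrow>
    (\<forall>p. p \<epsilon> F \<longrightarrow> (\<exists>x y. D x \<and> p = pair x y)) \<and> (\<forall>x. D x \<longrightarrow> (\<exists>!y. pair x y \<epsilon> F))"
  by (simp add: V.function_on_def V_is_pair V_related)

lemma app_iff: "\<exists>!y. pair x y \<epsilon> F \<Longrightarrow> pair x y \<epsilon> F \<longleftrightarrow> y = app F x"
  using app_eq by metis

lemma function_on_Lam: "dterm (\<lambda>\<rho>. f (\<rho> 0)) \<Longrightarrow> V.function_on (Lam a f) (\<lambda>x. x \<epsilon> a)"
  unfolding V_function_on mem_Lam pair_mem_Lam by auto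

text \<open>The axiom only gives transversals of disjoint families. Tagging each witness with its
  index \<open>x\<close> makes the families of witnesses disjoint, and a transversal is then a
  choice function.\<close>

lemma choice:
  assumes R: "dpred (\<lambda>\<rho>. R (\<rho> 0) (\<rho> 1))" and ex: "\<And>x. x \<epsilon> a \<Longrightarrow> \<exists>y. y \<epsilon> b \<and> R x y"
  shows "\<exists>F. \<forall>x. x \<epsilon> a \<longrightarrow> app F x \<epsilon> b \<and> R x (app F x)"
proof -
  note dR = dpred_comp2[of R, OF R]
  define T where "T x = Sep (Times a b) (\<lambda>p. \<exists>y. p = pair x y \<and> R x y)" for x
  have T: "p \<epsilon> T x \<longleftrightarrow> (\<exists>y. x \<epsilon> a \<and> y \<epsilon> b \<and> p = pair x y \<and> R x y)" for p x
  proof -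
    have "dpred (\<lambda>\<rho>. \<exists>y. \<rho> 0 = pair x y \<and> R x y)" by (intro fun_dfn dR)
    then show ?thesis unfolding T_def by (auto simp: mem_Sep)
  qed
  have "dterm (\<lambda>\<rho>. T (\<rho> 0))" unfolding T_def by (intro fun_dfn dR)
  note mem_fam = mem_Repl[OF this]
  have "choice_axiom E" using ZFC unfolding ZFC_def by blast
  moreover have "\<exists>z. z \<epsilon> x" if x: "x \<epsilon> Repl a T" for x
  proof -
    obtain u where u: "u \<epsilon> a" "x = T u" using x unfolding mem_fam by blast
    obtain y where "y \<epsilon> b" "R u y" using ex u by blast
    then show ?thesis using T u by blast
  qed
  moreover have "\<not> (\<exists>z. z \<epsilon> x \<and> z \<epsilon> y)" if xy: "x \<epsilon> Repl a T" "y \<epsilon> Repl a T" "x \<noteq> y" for x y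
  proof -
    obtain u v where "x = T u" "y = T v" using xy unfolding mem_fam by blast
    then show ?thesis using T \<open>x \<noteq> y\<close> by auto
  qed
  ultimately obtain c where c: "\<And>x. x \<epsilon> Repl a T \<Longrightarrow> \<exists>!z. z \<epsilon> x \<and> z \<epsilon> c"
    unfolding choice_axiom_def by blast
  \<comment> \<open>The transversal may have further elements outside the family; they are removed
    so that values become unique.\<close>
  define F where "F = Sep c (\<lambda>p. \<exists>x. p \<epsilon> T x)"
  have F: "p \<epsilon> F \<longleftrightarrow> p \<epsilon> c \<and> (\<exists>x. p \<epsilon> T x)" for p
    unfolding F_def by (rule mem_Sep) (unfold T_def, intro fun_dfn dR)
  show ?thesis
  proof (intro exI[of _ F] allI impI)
    fix x assume x: "x \<epsilon> a"
    then have "T x \<epsilon> Repl a T" unfolding mem_fam by blast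
    from c[OF this] obtain p where p: "p \<epsilon> T x" "p \<epsilon> c" "\<And>q. q \<epsilon> T x \<Longrightarrow> q \<epsilon> c \<Longrightarrow> q = p" by blast
    then obtain y where y: "y \<epsilon> b" "p = pair x y" "R x y" using T by blast
    have "app F x = y"
    proof (rule app_eq)
      show "pair x y \<epsilon> F" using p y F by blast
      fix z assume "pair x z \<epsilon> F"
      then have "pair x z \<epsilon> c" "pair x z \<epsilon> T x" using F T by auto
      then show "z = y" using p(3)[of "pair x z"] unfolding y(2) by simp
    qed
    then show "app F x \<epsilon> b \<and> R x (app F x)" using y by simp
  qed
qed

lemma V_injection_app:
  assumes "V.injection F a b" "x \<epsilon> a"
  shows "app F x \<epsilon> b" "y \<epsilon> a \<Longrightarrow> app F x = app F y \<Longrightarrow> x = y"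
proof -
  have "\<exists>!y. pair x y \<epsilon> F" if "x \<epsilon> a" for x
    using assms(1) that unfolding V.injection_def V.function_from_to_def V_function_on by simp
  then have f: "pair x (app F x) \<epsilon> F" if "x \<epsilon> a" for x
    using that by (simp add: app_iff)
  show "app F x \<epsilon> b"
    using assms(1) f[OF assms(2)] unfolding V.injection_def V.function_from_to_def V_related by blast
  show "x = y" if "y \<epsilon> a" "app F x = app F y"
    using assms(1) f[OF assms(2)] f[OF that(1)] that(2) unfolding V.injection_def V_related by simp blast
qed

lemma injection_Lam:
  assumes "dterm (\<lambda>\<rho>. f (\<rho> 0))" "\<And>x. x \<epsilon> a \<Longrightarrow> f x \<epsilon> b"
    "\<And>x y. x \<epsilon> a \<Longrightarrow> y \<epsilon> a \<Longrightarrow> f x = f y \<Longrightarrow> x = y"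
  shows "V.injection (Lam a f) a b"
  unfolding V.injection_def V.function_from_to_def V_related pair_mem_Lam[OF assms(1)]
  using function_on_Lam[OF assms(1)] assms(2,3) by auto

text \<open>Any set \<open>F\<close> may serve as witness, because \<open>Lam a (app F)\<close>
  turns it into a genuine injection. In this form the relation is visibly definable.\<close>

lemma card_le_iff: "V.card_le a b \<longleftrightarrow> (\<exists>F. (\<forall>x. x \<epsilon> a \<longrightarrow> app F x \<epsilon> b) \<and>
    (\<forall>x y. x \<epsilon> a \<longrightarrow> y \<epsilon> a \<longrightarrow> app F x = app F y \<longrightarrow> x = y))" (is "_ \<longleftrightarrow> ?R")
proof
  assume "V.card_le a b"
  then obtain F where "V.injection F a b" unfolding V.card_le_def by blast
  from V_injection_app[OF this] show ?R by blast
next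
  assume ?R
  then obtain F where F: "\<And>x. x \<epsilon> a \<Longrightarrow> app F x \<epsilon> b"
    "\<And>x y. x \<epsilon> a \<Longrightarrow> y \<epsilon> a \<Longrightarrow> app F x = app F y \<Longrightarrow> x = y" by blast
  have "V.injection (Lam a (app F)) a b"
    by (rule injection_Lam) (intro fun_dfn, use F in blast, use F in blast)
  then show "V.card_le a b" unfolding V.card_le_def by blast
qed

lemma card_leI:
  assumes "dterm (\<lambda>\<rho>. f (\<rho> 0))" "\<And>x. x \<epsilon> a \<Longrightarrow> f x \<epsilon> b"
    "\<And>x y. x \<epsilon> a \<Longrightarrow> y \<epsilon> a \<Longrightarrow> f x = f y \<Longrightarrow> x = y"
  shows "V.card_le a b"
  using injection_Lam[OF assms] unfolding V.card_le_def by blast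

lemma dp_card_le: "dterm t \<Longrightarrow> dterm s \<Longrightarrow> dpred (\<lambda>\<rho>. V.card_le (t \<rho>) (s \<rho>))"
  by (rule dpred_comp2[of V.card_le]) (unfold card_le_iff, intro fun_dfn)

lemma dp_card_less: "dterm t \<Longrightarrow> dterm s \<Longrightarrow> dpred (\<lambda>\<rho>. V.card_less (t \<rho>) (s \<rho>))"
  unfolding V.card_less_def by (intro fun_dfn dp_card_le)

lemma card_le_subset: "(\<And>x. x \<epsilon> a \<Longrightarrow> x \<epsilon> b) \<Longrightarrow> V.card_le a b"
  by (rule card_leI[of "\<lambda>x. x"]) (intro fun_dfn)

lemma card_le_trans: "V.card_le a b \<Longrightarrow> V.card_le b c \<Longrightarrow> V.card_le a c"
proof -
  assume "V.card_le a b" "V.card_le b c"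
  then obtain F G where "V.injection F a b" "V.injection G b c" unfolding V.card_le_def by blast
  note F = V_injection_app[OF this(1)] and G = V_injection_app[OF this(2)]
  show ?thesis
    by (rule card_leI[of "\<lambda>x. app G (app F x)"]) (intro fun_dfn, use F G in blast, use F G in blast)
qed

lemma card_le_less_trans: "V.card_le a b \<Longrightarrow> V.card_less b c \<Longrightarrow> V.card_less a c"
  unfolding V.card_less_def using card_le_trans by blast

text \<open>A choice of preimages is injective.\<close>

lemma card_le_image:
  assumes "dterm (\<lambda>\<rho>. f (\<rho> 0))" "\<And>y. y \<epsilon> b \<Longrightarrow> \<exists>x. x \<epsilon> a \<and> f x = y"
  shows "V.card_le b a"
proof -
  have "dpred (\<lambda>\<rho>. f (\<rho> 1) = \<rho> 0)"
    by (intro fun_dfn dterm_comp1[of f, OF assms(1)])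
  from choice[of "\<lambda>y x. f x = y", OF this assms(2)]
  obtain G where G: "\<And>y. y \<epsilon> b \<Longrightarrow> app G y \<epsilon> a" "\<And>y. y \<epsilon> b \<Longrightarrow> f (app G y) = y" by blast
  show ?thesis
    by (rule card_leI[of "app G"]) (intro fun_dfn, use G(1) in blast, use G(2) in metis)
qed

section \<open>Foundation and ordinals\<close>

lemma minimal_element:
  assumes "dpred (\<lambda>\<rho>. P (\<rho> 0))" "x \<epsilon> a" "P x"
  shows "\<exists>x. x \<epsilon> a \<and> P x \<and> (\<forall>y. y \<epsilon> x \<longrightarrow> y \<epsilon> a \<longrightarrow> \<not> P y)"
proof -
  have "\<exists>x. x \<epsilon> Sep a P" using assms by (auto simp: mem_Sep)
  moreover have "foundation E" using ZFC unfolding ZFC_def by blast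
  ultimately have "\<exists>x. x \<epsilon> Sep a P \<and> \<not> (\<exists>y. y \<epsilon> x \<and> y \<epsilon> Sep a P)"
    unfolding foundation_def by blast
  then show ?thesis unfolding mem_Sep[OF assms(1)] by blast
qed

lemma mem_irrefl: "\<not> a \<epsilon> a"
  using minimal_element[OF dp_const[of True], of a "Upair a a"] by auto

lemma mem_asym: "a \<epsilon> b \<Longrightarrow> \<not> b \<epsilon> a"
  using minimal_element[OF dp_const[of True], of a "Upair a b"] by auto

lemma V_transitive: "V.transitive a \<longleftrightarrow> (\<forall>x y. x \<epsilon> a \<longrightarrow> y \<epsilon> x \<longrightarrow> y \<epsilon> a)"
  by (auto simp: V.transitive_def V_subset_of)

lemma V_ordinal: "V.ordinal a \<longleftrightarrow> V.transitive a \<and> (\<forall>x. x \<epsilon> a \<longrightarrow> V.transitive x)"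
  by (simp add: V.ordinal_def)

lemma dp_ordinal: "dterm t \<Longrightarrow> dpred (\<lambda>\<rho>. V.ordinal (t \<rho>))"
  by (rule dpred_comp1[of V.ordinal]) (unfold V_ordinal V_transitive, intro fun_dfn)

lemma ordinal_mem: "V.ordinal a \<Longrightarrow> x \<epsilon> a \<Longrightarrow> V.ordinal x"
  unfolding V_ordinal V_transitive by blast

lemma ordinal_trans: "V.ordinal a \<Longrightarrow> x \<epsilon> a \<Longrightarrow> y \<epsilon> x \<Longrightarrow> y \<epsilon> a"
  unfolding V_ordinal V_transitive by blast

text \<open>Foundation speaks about sets of the model only. The counterexamples below
  \<open>k\<close> form such a set because \<open>P\<close> is definable, and a minimal one
  contradicts the induction step.\<close>

lemma ordinal_induct:
  assumes P: "dpred (\<lambda>\<rho>. P (\<rho> 0))" and k: "V.ordinal k" and a: "a \<epsilon> k"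
    and step: "\<And>a. a \<epsilon> k \<Longrightarrow> (\<And>b. b \<epsilon> a \<Longrightarrow> P b) \<Longrightarrow> P a"
  shows "P a"
proof (rule ccontr)
  assume "\<not> P a"
  from minimal_element[OF dp_not[OF P] a this] obtain x
    where "x \<epsilon> k" "\<not> P x" "\<forall>y. y \<epsilon> x \<longrightarrow> y \<epsilon> k \<longrightarrow> P y" by blast
  then show False using step ordinal_trans[OF k] by blast
qed

lemma ordinal_linear:
  assumes k: "V.ordinal k" and "a \<epsilon> k" "b \<epsilon> k"
  shows "a \<epsilon> b \<or> a = b \<or> b \<epsilon> a"
proof (rule ccontr)
  assume "\<not> ?thesis"
  \<comment> \<open>First a minimal \<open>a\<close> that is incomparable with something is taken,
    then a minimal \<open>b\<close> incomparable with this \<open>a\<close>. Members of either are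
    comparable with the other, which forces \<open>a\<close> and \<open>b\<close> to have the same
    members.\<close>
  with assms have "\<exists>b. b \<epsilon> k \<and> \<not> (a \<epsilon> b \<or> a = b \<or> b \<epsilon> a)" by blast
  from minimal_element[of "\<lambda>a. \<exists>b. b \<epsilon> k \<and> \<not> (a \<epsilon> b \<or> a = b \<or> b \<epsilon> a)", OF _ \<open>a \<epsilon> k\<close> this]
  obtain a where a: "a \<epsilon> k" and ex: "\<exists>b. b \<epsilon> k \<and> \<not> (a \<epsilon> b \<or> a = b \<or> b \<epsilon> a)"
    and a_min: "\<And>x b. x \<epsilon> a \<Longrightarrow> x \<epsilon> k \<Longrightarrow> b \<epsilon> k \<Longrightarrow> x \<epsilon> b \<or> x = b \<or> b \<epsilon> x"
    by (force intro!: fun_dfn)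
  from ex obtain b where "b \<epsilon> k" "\<not> (a \<epsilon> b \<or> a = b \<or> b \<epsilon> a)" by blast
  from minimal_element[of "\<lambda>b. \<not> (a \<epsilon> b \<or> a = b \<or> b \<epsilon> a)", OF _ this]
  obtain b where b: "b \<epsilon> k" and n: "\<not> (a \<epsilon> b \<or> a = b \<or> b \<epsilon> a)"
    and b_min: "\<And>y. y \<epsilon> b \<Longrightarrow> y \<epsilon> k \<Longrightarrow> a \<epsilon> y \<or> a = y \<or> y \<epsilon> a"
    by (force intro!: fun_dfn)
  have tr: "x \<epsilon> y \<Longrightarrow> y \<epsilon> k \<Longrightarrow> x \<epsilon> k" "x \<epsilon> y \<Longrightarrow> y \<epsilon> a \<Longrightarrow> x \<epsilon> a" "x \<epsilon> y \<Longrightarrow> y \<epsilon> b \<Longrightarrow> x \<epsilon> b" for x y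
    using ordinal_trans[OF k] ordinal_trans[OF ordinal_mem[OF k a]]
      ordinal_trans[OF ordinal_mem[OF k b]] by blast+
  have "a = b"
    by (rule set_eqI) (use a_min b_min n tr a b in blast)
  then show False using n by blast
qed

text \<open>If \<open>c\<close> is not all of \<open>k\<close>, it equals the least element of
  \<open>k\<close> outside it: that element has its members in \<open>c\<close>, and linearity with
  transitivity puts every member of \<open>c\<close> below it.\<close>

lemma transitive_subset_ordinal:
  assumes k: "V.ordinal k" and c: "V.transitive c" "\<And>x. x \<epsilon> c \<Longrightarrow> x \<epsilon> k"
  shows "c = k \<or> c \<epsilon> k"
proof (rule disjCI)
  assume "\<not> c \<epsilon> k"
  show "c = k"
  proof (rule ccontr)
    assume "c \<noteq> k"
    then obtain x where "x \<epsilon> k" "\<not> x \<epsilon> c" using c(2) set_eqI by metis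
    from minimal_element[of "\<lambda>x. \<not> x \<epsilon> c", OF _ this]
    obtain x where x: "x \<epsilon> k" "\<not> x \<epsilon> c" and m: "\<And>y. y \<epsilon> x \<Longrightarrow> y \<epsilon> k \<Longrightarrow> y \<epsilon> c"
      by (force intro!: fun_dfn)
    have "c = x"
    proof (rule set_eqI)
      fix z show "z \<epsilon> c \<longleftrightarrow> z \<epsilon> x"
        using m ordinal_trans[OF k x(1)] ordinal_linear[OF k x(1), of z] c x(2)
        unfolding V_transitive by blast
    qed
    then show False using x \<open>\<not> c \<epsilon> k\<close> by blast
  qed
qed

definition Succ :: "'v \<Rightarrow> 'v" where "Succ a = BigUn (Upair a (Upair a a))"

lemma mem_Succ [simp]: "x \<epsilon> Succ a \<longleftrightarrow> x \<epsilon> a \<or> x = a"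
  by (auto simp: Succ_def)

lemma dt_Succ: "dterm t \<Longrightarrow> dterm (\<lambda>\<rho>. Succ (t \<rho>))"
  unfolding Succ_def by (intro fun_dfn)

lemma ordinal_Succ: "V.ordinal a \<Longrightarrow> V.ordinal (Succ a)"
  unfolding V_ordinal V_transitive mem_Succ by metis

definition Meet :: "'v \<Rightarrow> 'v \<Rightarrow> 'v" where "Meet a b = Sep a (\<lambda>x. x \<epsilon> b)"

lemma mem_Meet [simp]: "x \<epsilon> Meet a b \<longleftrightarrow> x \<epsilon> a \<and> x \<epsilon> b"
  unfolding Meet_def by (rule mem_Sep) (intro fun_dfn)

lemma dt_Meet: "dterm t \<Longrightarrow> dterm s \<Longrightarrow> dterm (\<lambda>\<rho>. Meet (t \<rho>) (s \<rho>))"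
  by (rule dterm_comp2[of Meet]) (unfold Meet_def, intro fun_dfn)

lemmas dfn = fun_dfn dt_Succ dt_Meet dp_card_le dp_card_less dp_ordinal

end

section \<open>Normal measures as quantifiers\<close>

context zfc_model begin

definition Pk :: "'v \<Rightarrow> 'v \<Rightarrow> 'v" where "Pk k X = Sep (Power X) (\<lambda>A. V.card_less A k)"

lemma mem_Pk: "A \<epsilon> Pk k X \<longleftrightarrow> (\<forall>x. x \<epsilon> A \<longrightarrow> x \<epsilon> X) \<and> V.card_less A k"
proof -
  have "dpred (\<lambda>\<rho>. V.card_less (\<rho> 0) k)" by (intro dfn)
  then show ?thesis by (simp add: Pk_def mem_Sep)
qed

lemma dt_Pk: "dterm t \<Longrightarrow> dterm s \<Longrightarrow> dterm (\<lambda>\<rho>. Pk (t \<rho>) (s \<rho>))"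
  by (rule dterm_comp2[of Pk]) (unfold Pk_def, intro dfn)

lemma V_is_Pk: "V.is_Pk p k X \<longleftrightarrow> p = Pk k X"
  by (simp add: V.is_Pk_def extensionality_iff[of p] mem_Pk V_subset_of)

lemma is_Collect_unique: "V.is_Collect b a Q \<Longrightarrow> (\<And>x. x \<epsilon> c \<longleftrightarrow> x \<epsilon> a \<and> Q x) \<Longrightarrow> b = c"
  by (rule set_eqI) (simp add: V.is_Collect_def)

end

text \<open>
  A normal fine ultrafilter \<open>U\<close> is handled through the quantifier \<open>Q\<close> ``for \<open>U\<close>-almost all
  \<open>A\<close> in \<open>\<P>\<^sub>k(X)\<close>'' on definable predicates.
\<close>

locale normal_quantifier = zfc_model E for E :: "'v \<Rightarrow> 'v \<Rightarrow> bool"  (infix "\<epsilon>" 50) +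
  fixes k X :: 'v and Q :: "('v \<Rightarrow> bool) \<Rightarrow> bool"
  assumes dp_Q: "dpred (\<lambda>\<rho>. P (\<lambda>i. \<rho> (Suc i)) (\<rho> 0)) \<Longrightarrow> dpred (\<lambda>\<rho>. Q (P \<rho>))"
    and Q_mono: "Q B \<Longrightarrow> dpred (\<lambda>\<rho>. B (\<rho> 0)) \<Longrightarrow> dpred (\<lambda>\<rho>. C (\<rho> 0)) \<Longrightarrow>
        (\<And>A. A \<epsilon> Pk k X \<Longrightarrow> B A \<Longrightarrow> C A) \<Longrightarrow> Q C"
    and Q_ex: "Q B \<Longrightarrow> dpred (\<lambda>\<rho>. B (\<rho> 0)) \<Longrightarrow> \<exists>A. A \<epsilon> Pk k X \<and> B A"
    and Q_conj: "Q B \<Longrightarrow> Q C \<Longrightarrow> dpred (\<lambda>\<rho>. B (\<rho> 0)) \<Longrightarrow> dpred (\<lambda>\<rho>. C (\<rho> 0)) \<Longrightarrow>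
        Q (\<lambda>A. B A \<and> C A)"
    and Q_neg: "\<not> Q B \<Longrightarrow> dpred (\<lambda>\<rho>. B (\<rho> 0)) \<Longrightarrow> Q (\<lambda>A. \<not> B A)"
    and Q_all: "V.card_less I k \<Longrightarrow> dpred (\<lambda>\<rho>. R (\<rho> 0) (\<rho> 1)) \<Longrightarrow>
        (\<And>i. i \<epsilon> I \<Longrightarrow> Q (R i)) \<Longrightarrow> Q (\<lambda>A. \<forall>i. i \<epsilon> I \<longrightarrow> R i A)"
    and Q_fine: "x \<epsilon> X \<Longrightarrow> Q (\<lambda>A. x \<epsilon> A)"
    and Q_normal: "dterm (\<lambda>\<rho>. f (\<rho> 0)) \<Longrightarrow> Q (\<lambda>A. f A \<epsilon> A) \<Longrightarrow> \<exists>c. Q (\<lambda>A. f A = c)"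

definition (in zfc_model) normal_measure :: "'v \<Rightarrow> 'v \<Rightarrow> 'v \<Rightarrow> bool" where
  "normal_measure k X U \<longleftrightarrow> V.ultrafilter_on U (Pk k X) \<and> V.complete_filter U (Pk k X) k \<and>
    V.fine_filter U (Pk k X) X \<and> V.normal_filter U"

lemma (in zfc_model) supercompact_for_iff: "V.supercompact_for k X \<longleftrightarrow> (\<exists>U. normal_measure k X U)"
  unfolding V.supercompact_for_def V_is_Pk normal_measure_def by blast

text \<open>Definability guarantees that the set of all \<open>A\<close> with \<open>P A\<close>
  exists and can be tested against \<open>U\<close>. The sets promised by the ultrafilter clauses
  are identified with such sets by Extensionality.\<close>

lemma (in zfc_model) normal_measure_quantifier:
  assumes "normal_measure k X U"
  shows "normal_quantifier E k X (\<lambda>P. Sep (Pk k X) P \<epsilon> U)"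
proof -
  define p where "p = Pk k X"
  have U: "V.ultrafilter_on U p" and comp: "V.complete_filter U p k"
    and fine: "V.fine_filter U p X" and norm: "V.normal_filter U"
    using assms unfolding normal_measure_def p_def by blast+
  note U' = U[unfolded V.ultrafilter_on_def V_subset_of ball_UNIV bex_UNIV]
  have up: "C \<epsilon> U" if "B \<epsilon> U" "\<And>x. x \<epsilon> B \<Longrightarrow> x \<epsilon> C" "\<And>x. x \<epsilon> C \<Longrightarrow> x \<epsilon> p" for B C
    using U'[THEN conjunct2, THEN conjunct2, THEN conjunct2, THEN conjunct1] that by blast
  have ne: "\<exists>x. x \<epsilon> B" if "B \<epsilon> U" for B
    using U'[THEN conjunct2, THEN conjunct2, THEN conjunct1] that by blast
  have inter: "\<exists>D. D \<epsilon> U \<and> V.is_Collect D B (\<lambda>x. x \<epsilon> C)" if "B \<epsilon> U" "C \<epsilon> U" for B C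
    using U'[THEN conjunct2, THEN conjunct2, THEN conjunct2, THEN conjunct2, THEN conjunct1] that by blast
  have ultra: "\<exists>D. D \<epsilon> U \<and> V.is_Collect D p (\<lambda>x. \<not> x \<epsilon> B)" if "\<forall>x. x \<epsilon> B \<longrightarrow> x \<epsilon> p" "\<not> B \<epsilon> U" for B
    using U'[THEN conjunct2, THEN conjunct2, THEN conjunct2, THEN conjunct2, THEN conjunct2] that by blast
  show ?thesis
    unfolding p_def[symmetric]
    apply unfold_locales
    subgoal by (intro dp_mem dt_Sep dt_const; assumption)
    subgoal premises pr for B C
      by (rule up[OF pr(1)]; unfold mem_Sep[OF pr(2)] mem_Sep[OF pr(3)]; use pr(4) p_def in simp)
    subgoal premises pr for B
    proof -
      have "\<exists>x. x \<epsilon> Sep p B" by (rule ne[OF pr(1)])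
      then show ?thesis unfolding mem_Sep[OF pr(2)] p_def .
    qed
    subgoal premises pr for B C
    proof -
      obtain D where D: "D \<epsilon> U" "V.is_Collect D (Sep p B) (\<lambda>x. x \<epsilon> Sep p C)"
        using inter[OF pr(1,2)] by blast
      have "D = Sep p (\<lambda>A. B A \<and> C A)"
        by (rule is_Collect_unique[OF D(2)])
          (simp add: mem_Sep[OF pr(3)] mem_Sep[OF pr(4)] mem_Sep[OF dp_conj[OF pr(3,4)]] conj_ac)
      then show ?thesis using D by simp
    qed
    subgoal premises pr for B
    proof -
      have "\<forall>x. x \<epsilon> Sep p B \<longrightarrow> x \<epsilon> p" by (simp add: mem_Sep[OF pr(2)])
      then obtain D where D: "D \<epsilon> U" "V.is_Collect D p (\<lambda>x. \<not> x \<epsilon> Sep p B)"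
        using ultra[OF _ pr(1)] by blast
      have "D = Sep p (\<lambda>A. \<not> B A)"
        by (rule is_Collect_unique[OF D(2)])
          (simp add: mem_Sep[OF pr(2)] mem_Sep[OF dp_not[OF pr(2)]], blast)
      then show ?thesis using D by simp
    qed
    subgoal premises pr for I R
    proof -
      note dR = dpred_comp2[of R, OF pr(2)]
      define T where "T i = Sep p (R i)" for i
      have dT: "dterm (\<lambda>\<rho>. T (\<rho> 0))" unfolding T_def by (intro dfn dR)
      have dRi: "dpred (\<lambda>\<rho>. R i (\<rho> 0))" for i by (intro dR dfn)
      have dA: "dpred (\<lambda>\<rho>. \<forall>i. i \<epsilon> I \<longrightarrow> R i (\<rho> 0))" by (intro dR dfn)
      have mT: "y \<epsilon> Repl I T \<longleftrightarrow> (\<exists>i. i \<epsilon> I \<and> y = T i)" for y by (rule mem_Repl[OF dT])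
      \<comment> \<open>Completeness counts the sets of a family, not its indices; the range of the
        family is no larger than \<open>I\<close>.\<close>
      have "V.card_le (Repl I T) I"
        by (rule card_le_image[OF dT]) (unfold mT, blast)
      then have "V.card_less (Repl I T) k" using pr(1) by (rule card_le_less_trans)
      moreover have "V.subset_of (Repl I T) U"
        unfolding V_subset_of mT using pr(3) by (auto simp: T_def)
      ultimately obtain J where J: "J \<epsilon> U" "V.is_Collect J p (\<lambda>A. \<forall>B\<in>UNIV. B \<epsilon> Repl I T \<longrightarrow> A \<epsilon> B)"
        using comp unfolding V.complete_filter_def by blast
      have "J = Sep p (\<lambda>A. \<forall>i. i \<epsilon> I \<longrightarrow> R i A)"
      proof (rule is_Collect_unique[OF J(2)])
        fix x
        have "x \<epsilon> T i \<longleftrightarrow> x \<epsilon> p \<and> R i x" for i unfolding T_def by (rule mem_Sep[OF dRi])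
        then show "x \<epsilon> Sep p (\<lambda>A. \<forall>i. i \<epsilon> I \<longrightarrow> R i A) \<longleftrightarrow> x \<epsilon> p \<and> (\<forall>B\<in>UNIV. B \<epsilon> Repl I T \<longrightarrow> x \<epsilon> B)"
          unfolding mem_Sep[OF dA] mT by auto
      qed
      then show ?thesis using J by simp
    qed
    subgoal premises pr for x
    proof -
      obtain B where B: "B \<epsilon> U" "V.is_Collect B p (\<lambda>A. x \<epsilon> A)"
        using fine pr unfolding V.fine_filter_def by blast
      have d: "dpred (\<lambda>\<rho>. x \<epsilon> \<rho> 0)" by (intro dfn)
      have "B = Sep p (\<lambda>A. x \<epsilon> A)"
        by (rule is_Collect_unique[OF B(2)]) (rule mem_Sep[OF d])
      then show ?thesis using B by simp
    qed
    subgoal premises pr for f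
    proof -
      note f = pr(1)
      note df = dterm_comp1[of f, OF f]
      define D where "D = Sep p (\<lambda>A. f A \<epsilon> A)"
      have d: "dpred (\<lambda>\<rho>. f (\<rho> 0) \<epsilon> \<rho> 0)" by (intro dp_mem df dt_var)
      have dc: "dpred (\<lambda>\<rho>. f (\<rho> 0) = c)" for c by (intro dp_eq df dt_var dt_const)
      have D: "A \<epsilon> D \<longleftrightarrow> A \<epsilon> p \<and> f A \<epsilon> A" for A unfolding D_def by (rule mem_Sep[OF d])
      have "\<forall>A y. pair A y \<epsilon> Lam D f \<longrightarrow> y \<epsilon> A" by (simp add: pair_mem_Lam[OF f] D)
      then have "\<exists>B. B \<epsilon> U \<and> (\<forall>A. A \<epsilon> B \<longrightarrow> A \<epsilon> D) \<and> (\<exists>c. \<forall>A. A \<epsilon> B \<longrightarrow> pair A c \<epsilon> Lam D f)"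
        using norm[unfolded V.normal_filter_def V_subset_of V_related ball_UNIV bex_UNIV, rule_format, of D "Lam D f"]
          function_on_Lam[OF f, of D] pr(2)[folded D_def] by blast
      then obtain B c where B: "B \<epsilon> U" "\<And>A. A \<epsilon> B \<Longrightarrow> A \<epsilon> D" "\<And>A. A \<epsilon> B \<Longrightarrow> pair A c \<epsilon> Lam D f"
        by blast
      have "Sep p (\<lambda>A. f A = c) \<epsilon> U"
        by (rule up[OF B(1)]) (use B(2,3) in \<open>auto simp: mem_Sep[OF dc] pair_mem_Lam[OF f] D\<close>)
      then show ?thesis by blast
    qed
    done
qed

section \<open>From quantifiers back to ultrafilters; diagonal intersections\<close>

context normal_quantifier begin

lemma Q_True: "Q (\<lambda>A. True)"
  using Q_neg[OF _ dp_const[of False]] Q_mono[OF _ dp_const[of False] dp_const[of True]] by fastforce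

lemma Q_all_mem: "(\<And>A. A \<epsilon> Pk k X \<Longrightarrow> C A) \<Longrightarrow> dpred (\<lambda>\<rho>. C (\<rho> 0)) \<Longrightarrow> Q C"
  by (rule Q_mono[OF Q_True dp_const])

text \<open>Converse to \<open>normal_measure_quantifier\<close>: \<open>dp_Q\<close> lets
  Separation form the ultrafilter. The limit of measures is constructed as a quantifier first and
  becomes a set here.\<close>

lemma supercompact_for: "V.supercompact_for k X"
proof -
  define p where "p = Pk k X"
  define U where "U = Sep (Power p) (\<lambda>B. Q (\<lambda>A. A \<epsilon> B))"
  have U: "B \<epsilon> U \<longleftrightarrow> (\<forall>A. A \<epsilon> B \<longrightarrow> A \<epsilon> p) \<and> Q (\<lambda>A. A \<epsilon> B)" for B
    unfolding U_def by (subst mem_Sep) (intro dp_Q dfn, simp)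
  have dm: "dpred (\<lambda>\<rho>. \<rho> 0 \<epsilon> B)" for B by (intro dfn)
  have SepU: "Sep a P \<epsilon> U" if "dpred (\<lambda>\<rho>. P (\<rho> 0))" "Q P" "Q (\<lambda>A. A \<epsilon> a)" "\<And>A. A \<epsilon> a \<Longrightarrow> A \<epsilon> p" for a P
    unfolding U
  proof
    show "\<forall>A. A \<epsilon> Sep a P \<longrightarrow> A \<epsilon> p" using that by (simp add: mem_Sep)
    show "Q (\<lambda>A. A \<epsilon> Sep a P)"
      by (rule Q_mono[OF Q_conj[OF that(2,3,1) dm] dp_conj[OF that(1) dm] dm]) (simp add: mem_Sep that(1))
  qed
  have Qp: "Q (\<lambda>A. A \<epsilon> p)" by (rule Q_all_mem[OF _ dm]) (simp add: p_def)
  have coll: "V.is_Collect (Sep a P) a P" if "dpred (\<lambda>\<rho>. P (\<rho> 0))" for a P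
    using that by (simp add: V.is_Collect_def mem_Sep)
  have "V.ultrafilter_on U p"
    unfolding V.ultrafilter_on_def V_subset_of
  proof (intro conjI ballI impI)
    show "\<forall>A. A \<epsilon> B \<longrightarrow> A \<epsilon> p" if "B \<epsilon> U" for B using that U by blast
    show "p \<epsilon> U" using U Qp by blast
    show "\<exists>x\<in>UNIV. x \<epsilon> B" if "B \<epsilon> U" for B using that U Q_ex[OF _ dm] by blast
    show "C \<epsilon> U" if "B \<epsilon> U \<and> (\<forall>x. x \<epsilon> B \<longrightarrow> x \<epsilon> C) \<and> (\<forall>x. x \<epsilon> C \<longrightarrow> x \<epsilon> p)" for B C
      using that Q_mono[OF _ dm dm] unfolding U by blast
    show "\<exists>D\<in>UNIV. D \<epsilon> U \<and> V.is_Collect D B (\<lambda>x. x \<epsilon> C)" if "B \<epsilon> U \<and> C \<epsilon> U" for B C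
      using that U SepU[OF dm, of C B] coll[OF dm] by blast
    show "B \<epsilon> U \<or> (\<exists>D\<in>UNIV. D \<epsilon> U \<and> V.is_Collect D p (\<lambda>x. \<not> x \<epsilon> B))" if "\<forall>x. x \<epsilon> B \<longrightarrow> x \<epsilon> p" for B
      using that U SepU[OF dp_not[OF dm] Q_neg[OF _ dm] Qp] coll[OF dp_not[OF dm]] by blast
  qed
  moreover have "V.complete_filter U p k"
    unfolding V.complete_filter_def V_subset_of
  proof (intro ballI impI)
    fix S assume S: "(\<forall>x. x \<epsilon> S \<longrightarrow> x \<epsilon> U) \<and> V.card_less S k"
    have d: "dpred (\<lambda>\<rho>. \<forall>B\<in>UNIV. B \<epsilon> S \<longrightarrow> \<rho> 0 \<epsilon> B)" unfolding ball_UNIV by (intro dfn)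
    have "Q (\<lambda>A. \<forall>B. B \<epsilon> S \<longrightarrow> A \<epsilon> B)"
      by (rule Q_all) (use S U in blast, intro dfn, use S U in blast)
    then have "Q (\<lambda>A. \<forall>B\<in>UNIV. B \<epsilon> S \<longrightarrow> A \<epsilon> B)" by simp
    from SepU[OF d this Qp] coll[OF d]
    show "\<exists>I\<in>UNIV. I \<epsilon> U \<and> V.is_Collect I p (\<lambda>A. \<forall>B\<in>UNIV. B \<epsilon> S \<longrightarrow> A \<epsilon> B)" by blast
  qed
  moreover have "V.fine_filter U p X"
    unfolding V.fine_filter_def
  proof (intro ballI impI)
    fix x assume "x \<epsilon> X"
    have d: "dpred (\<lambda>\<rho>. x \<epsilon> \<rho> 0)" by (intro dfn)
    from SepU[OF d Q_fine[OF \<open>x \<epsilon> X\<close>] Qp] coll[OF d]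
    show "\<exists>B\<in>UNIV. B \<epsilon> U \<and> V.is_Collect B p (\<lambda>A. x \<epsilon> A)" by blast
  qed
  moreover have "V.normal_filter U"
    unfolding V.normal_filter_def
  proof (intro ballI impI)
    fix D f assume "D \<epsilon> U \<and> V.function_on f (\<lambda>A. A \<epsilon> D) \<and> (\<forall>A\<in>UNIV. \<forall>y\<in>UNIV. V.related f A y \<longrightarrow> y \<epsilon> A)"
    then have D: "D \<epsilon> U" and f: "\<And>A. A \<epsilon> D \<Longrightarrow> \<exists>!y. pair A y \<epsilon> f" and fA: "\<And>A y. pair A y \<epsilon> f \<Longrightarrow> y \<epsilon> A"
      unfolding V_function_on V_related by auto
    have fD: "pair A (app f A) \<epsilon> f" if "A \<epsilon> D" for A
      using app_iff[OF f[OF that]] by blast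
    have dfA: "dpred (\<lambda>\<rho>. app f (\<rho> 0) \<epsilon> \<rho> 0)" and dfc: "\<And>c. dpred (\<lambda>\<rho>. app f (\<rho> 0) = c)"
      by (intro dfn)+
    have QD: "Q (\<lambda>A. A \<epsilon> D)" using D U by blast
    have "Q (\<lambda>A. app f A \<epsilon> A)"
      by (rule Q_mono[OF QD dm dfA]) (use fD fA in blast)
    then obtain c where c: "Q (\<lambda>A. app f A = c)"
      using Q_normal[of "app f"] dt_app[OF dt_const dt_var] by blast
    have "Sep D (\<lambda>A. app f A = c) \<epsilon> U"
      by (rule SepU[OF dfc c QD]) (use D U in blast)
    moreover have "V.subset_of (Sep D (\<lambda>A. app f A = c)) D"
      by (simp add: V_subset_of mem_Sep dfc)
    moreover have "\<forall>A\<in>UNIV. A \<epsilon> Sep D (\<lambda>A. app f A = c) \<longrightarrow> V.related f A c"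
      using fD by (auto simp: V_related mem_Sep dfc)
    ultimately show "\<exists>B\<in>UNIV. B \<epsilon> U \<and> V.subset_of B D \<and> (\<exists>c\<in>UNIV. \<forall>A\<in>UNIV. A \<epsilon> B \<longrightarrow> V.related f A c)"
      by blast
  qed
  ultimately show ?thesis
    unfolding V.supercompact_for_def V_is_Pk p_def by blast
qed

text \<open>Otherwise choosing in \<open>A\<close> some \<open>x\<close> that violates
  \<open>R x A\<close> is a regressive function. By normality it has a constant value
  \<open>c\<close> almost everywhere, against \<open>Q (R c)\<close>.\<close>

lemma Q_diag:
  assumes R: "dpred (\<lambda>\<rho>. R (\<rho> 0) (\<rho> 1))" and QR: "\<And>x. x \<epsilon> X \<Longrightarrow> Q (R x)"
  shows "Q (\<lambda>A. \<forall>x. x \<epsilon> A \<longrightarrow> R x A)"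
proof (rule ccontr)
  note dR = dpred_comp2[of R, OF R]
  define N where "N A \<longleftrightarrow> \<not> (\<forall>x. x \<epsilon> A \<longrightarrow> R x A)" for A
  have dN0: "dpred (\<lambda>\<rho>. N (\<rho> 0))" unfolding N_def by (intro dfn dR)
  note dN = dpred_comp1[of N, OF dN0]
  assume "\<not> ?thesis"
  then have N: "Q N" unfolding N_def by (rule Q_neg) (intro dfn dR)
  have "dpred (\<lambda>\<rho>. \<rho> 1 \<epsilon> \<rho> 0 \<and> \<not> R (\<rho> 1) (\<rho> 0))" by (intro dfn dR)
  moreover have "\<exists>x. x \<epsilon> X \<and> x \<epsilon> A \<and> \<not> R x A" if "A \<epsilon> Sep (Pk k X) N" for A
    using that unfolding mem_Sep[OF dN0] mem_Pk N_def by blast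
  ultimately have "\<exists>F. \<forall>A. A \<epsilon> Sep (Pk k X) N \<longrightarrow> app F A \<epsilon> X \<and> app F A \<epsilon> A \<and> \<not> R (app F A) A"
    by (rule choice)
  then obtain F where F: "\<And>A. A \<epsilon> Pk k X \<Longrightarrow> N A \<Longrightarrow> app F A \<epsilon> A \<and> \<not> R (app F A) A"
    unfolding mem_Sep[OF dN0] by blast
  have dA: "dpred (\<lambda>\<rho>. app F (\<rho> 0) \<epsilon> \<rho> 0)" by (intro dfn)
  have "Q (\<lambda>A. app F A \<epsilon> A)"
    by (rule Q_mono[OF N dN0 dA]) (use F in blast)
  then obtain c where c: "Q (\<lambda>A. app F A = c)"
    using Q_normal[of "app F"] dt_app[OF dt_const dt_var] by blast
  have dc: "dpred (\<lambda>\<rho>. app F (\<rho> 0) = c)" and dRc: "dpred (\<lambda>\<rho>. R c (\<rho> 0))" by (intro dfn dR)+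
  note Nc = Q_conj[OF N c dN0 dc] and dNc = dp_conj[OF dN0 dc]
  from Q_ex[OF Nc dNc] obtain A where "A \<epsilon> Pk k X" "N A" "app F A = c" by blast
  then have "c \<epsilon> X" using F mem_Pk by blast
  from Q_ex[OF Q_conj[OF Nc QR[OF this] dNc dRc] dp_conj[OF dNc dRc]] 
  show False using F by blast
qed

end

section \<open>The cumulative hierarchy\<close>

context zfc_model begin

lemma dp_ex1:
  assumes "dpred (\<lambda>\<rho>. P (\<lambda>i. \<rho> (Suc i)) (\<rho> 0))" shows "dpred (\<lambda>\<rho>. \<exists>!x. P \<rho> x)"
proof -
  have "dpred (\<lambda>\<rho>. P (\<lambda>i. \<rho> (Suc (Suc i))) (\<rho> 0))"
    by (rule dpred_weaken1[OF assms])
  then show ?thesis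
    unfolding Ex1_def by (intro dp_ex dp_conj assms dp_all dp_imp dp_eq dt_var)
qed

text \<open>The default value keeps the graph first-order definable also where no unique object
  exists.\<close>

definition Desc :: "('v \<Rightarrow> bool) \<Rightarrow> 'v" where
  "Desc P = (if \<exists>!v. P v then THE v. P v else Empty)"

lemma Desc_eq: "P v \<Longrightarrow> (\<And>w. P w \<Longrightarrow> w = v) \<Longrightarrow> Desc P = v"
  unfolding Desc_def by (metis the_equality)

lemma dt_Desc:
  assumes "dpred (\<lambda>\<rho>. P (\<lambda>i. \<rho> (Suc i)) (\<rho> 0))" shows "dterm (\<lambda>\<rho>. Desc (P \<rho>))"
proof -
  have *: "y = Desc (P \<rho>) \<longleftrightarrow> (\<exists>!v. P \<rho> v) \<and> P \<rho> y \<or> \<not> (\<exists>!v. P \<rho> v) \<and> y = Empty" for y \<rho>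
  proof (cases "\<exists>!v. P \<rho> v")
    case True
    then have "P \<rho> (THE v. P \<rho> v)" by (rule theI')
    then show ?thesis using True by (auto simp: Desc_def)
  qed (auto simp: Desc_def)
  have 1: "dpred (\<lambda>\<rho>. P (\<lambda>i. \<rho> (Suc (Suc i))) (\<rho> 0))"
    by (rule dpred_weaken1[OF assms])
  show ?thesis
    unfolding dterm_def * by (intro dp_disj dp_conj dp_not dp_ex1 1 assms dp_eq dt_var dt_const)
qed

definition level_function :: "'v \<Rightarrow> 'v \<Rightarrow> bool" where
  "level_function f a \<longleftrightarrow> V.function_on f (\<lambda>b. b \<epsilon> Succ a) \<and>
    (\<forall>b u. pair b u \<epsilon> f \<longrightarrow> (\<forall>x. x \<epsilon> u \<longleftrightarrow> (\<exists>c w. c \<epsilon> b \<and> pair c w \<epsilon> f \<and> (\<forall>z. z \<epsilon> x \<longrightarrow> z \<epsilon> w))))"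

lemma dp_level_function: "dterm t \<Longrightarrow> dterm s \<Longrightarrow> dpred (\<lambda>\<rho>. level_function (t \<rho>) (s \<rho>))"
  by (rule dpred_comp2[of level_function]) (unfold level_function_def V_function_on, intro dp_ex1 dfn)

lemma level_function_pair:
  assumes "level_function f a" "b \<epsilon> Succ a" shows "pair b u \<epsilon> f \<longleftrightarrow> u = app f b"
  using assms app_iff[of b f u] unfolding level_function_def V_function_on by blast

lemma level_function_rec:
  assumes f: "level_function f a" and a: "V.ordinal a" and b: "b \<epsilon> Succ a"
  shows "x \<epsilon> app f b \<longleftrightarrow> (\<exists>c. c \<epsilon> b \<and> (\<forall>z. z \<epsilon> x \<longrightarrow> z \<epsilon> app f c))"
proof -
  have c: "c \<epsilon> Succ a" if "c \<epsilon> b" for c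
    using ordinal_trans[OF ordinal_Succ[OF a] b that] .
  have "pair b (app f b) \<epsilon> f" using level_function_pair[OF f b] by blast
  with f have "x \<epsilon> app f b \<longleftrightarrow> (\<exists>c w. c \<epsilon> b \<and> pair c w \<epsilon> f \<and> (\<forall>z. z \<epsilon> x \<longrightarrow> z \<epsilon> w))"
    unfolding level_function_def by blast
  also have "\<dots> \<longleftrightarrow> (\<exists>c. c \<epsilon> b \<and> (\<forall>z. z \<epsilon> x \<longrightarrow> z \<epsilon> app f c))"
    using level_function_pair[OF f c] by metis
  finally show ?thesis .
qed

lemma level_function_unique:
  assumes f: "level_function f a" "V.ordinal a" "b \<epsilon> Succ a" and g: "level_function g a'" "V.ordinal a'" "b \<epsilon> Succ a'"
  shows "app f b = app g b"
proof -
  have "b \<epsilon> Succ a' \<longrightarrow> app f b = app g b"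
  proof (rule ordinal_induct[OF _ ordinal_Succ[OF f(2)] f(3)])
    show "dpred (\<lambda>\<rho>. \<rho> 0 \<epsilon> Succ a' \<longrightarrow> app f (\<rho> 0) = app g (\<rho> 0))" by (intro dfn)
    fix b assume b: "b \<epsilon> Succ a" and IH: "\<And>c. c \<epsilon> b \<Longrightarrow> c \<epsilon> Succ a' \<longrightarrow> app f c = app g c"
    show "b \<epsilon> Succ a' \<longrightarrow> app f b = app g b"
    proof
      assume b': "b \<epsilon> Succ a'"
      have "app f c = app g c" if "c \<epsilon> b" for c
        using IH[OF that] ordinal_trans[OF ordinal_Succ[OF g(2)] b' that] by blast
      then show "app f b = app g b"
        by (intro set_eqI) (simp only: level_function_rec[OF f(1,2) b] level_function_rec[OF g(1,2) b'] cong: conj_cong)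
    qed
  qed
  then show ?thesis using g(3) by blast
qed

definition Vset :: "'v \<Rightarrow> 'v" where
  "Vset a = Desc (\<lambda>v. \<exists>f. level_function f a \<and> v = app f a)"

lemma dt_Vset: "dterm t \<Longrightarrow> dterm (\<lambda>\<rho>. Vset (t \<rho>))"
  by (rule dterm_comp1[of Vset]) (unfold Vset_def, intro dt_Desc dfn dp_level_function)

lemma Vset_app:
  assumes a: "V.ordinal a" and g: "level_function g a" and b: "b \<epsilon> Succ a" and f: "level_function f b"
  shows "Vset b = app g b"
proof -
  have ob: "V.ordinal b" using ordinal_mem[OF ordinal_Succ[OF a] b] .
  have "app f' b = app g b" if "level_function f' b" for f'
    using level_function_unique[OF that ob _ g a b] by simp
  then show ?thesis unfolding Vset_def using f by (intro Desc_eq) metis+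
qed

text \<open>Induction on the length: once the shorter sequences exist, their last terms are
  collected by Replacement.\<close>

lemma level_function_ex: 
  assumes a: "V.ordinal a" shows "\<exists>f. level_function f a"
proof (rule ordinal_induct[OF _ ordinal_Succ[OF a]])
  show "dpred (\<lambda>\<rho>. \<exists>f. level_function f (\<rho> 0))" by (intro dfn dp_level_function)
  show "a \<epsilon> Succ a" by simp
  fix b assume b: "b \<epsilon> Succ a" and IH: "\<And>c. c \<epsilon> b \<Longrightarrow> \<exists>f. level_function f c"
  have ob: "V.ordinal b" using ordinal_mem[OF ordinal_Succ[OF a] b] .
  \<comment> \<open>\<open>h c\<close> refers only to levels below \<open>c\<close>, so it is
    already correct at \<open>b\<close>, where \<open>Vset b\<close> may still be the default
    value.\<close>
  define h where "h c = BigUn (Repl c (\<lambda>d. Power (Vset d)))" for c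
  have dh: "dterm (\<lambda>\<rho>. h (\<rho> 0))" unfolding h_def by (intro dfn dt_Vset)
  have "dterm (\<lambda>\<rho>. Power (Vset (\<rho> 0)))" by (intro dfn dt_Vset)
  then have h: "x \<epsilon> h c \<longleftrightarrow> (\<exists>d. d \<epsilon> c \<and> (\<forall>z. z \<epsilon> x \<longrightarrow> z \<epsilon> Vset d))" for x c
    unfolding h_def mem_BigUn by (simp add: mem_Repl) (metis mem_Power)
  have hV: "h c = Vset c" if c: "c \<epsilon> b" for c
  proof -
    obtain f where f: "level_function f c" using IH[OF c] by blast
    have oc: "V.ordinal c" using ordinal_mem[OF ob c] .
    have V: "Vset d = app f d" if "d \<epsilon> Succ c" for d
    proof -
      have "d \<epsilon> b" using that ordinal_trans[OF ob c] c by auto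
      then show ?thesis using IH Vset_app[OF oc f that] by blast
    qed
    show ?thesis
    proof (rule set_eqI)
      fix x
      have cc: "c \<epsilon> Succ c" by simp
      have "x \<epsilon> Vset c \<longleftrightarrow> (\<exists>d. d \<epsilon> c \<and> (\<forall>z. z \<epsilon> x \<longrightarrow> z \<epsilon> app f d))"
        using level_function_rec[OF f oc cc] V[OF cc] by simp
      also have "\<dots> \<longleftrightarrow> x \<epsilon> h c" unfolding h using V by (simp cong: conj_cong)
      finally show "x \<epsilon> h c \<longleftrightarrow> x \<epsilon> Vset c" by blast
    qed
  qed
  have "level_function (Lam (Succ b) h) b"
    unfolding level_function_def
  proof (intro conjI allI impI)
    show "V.function_on (Lam (Succ b) h) (\<lambda>c. c \<epsilon> Succ b)" by (rule function_on_Lam[OF dh])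
    fix c u x assume "pair c u \<epsilon> Lam (Succ b) h"
    then have c: "c \<epsilon> Succ b" "u = h c" using pair_mem_Lam[OF dh] by blast+
    have "d \<epsilon> b" if "d \<epsilon> c" for d using c(1) that ordinal_trans[OF ob] by auto
    then show "x \<epsilon> u \<longleftrightarrow> (\<exists>d w. d \<epsilon> c \<and> pair d w \<epsilon> Lam (Succ b) h \<and> (\<forall>z. z \<epsilon> x \<longrightarrow> z \<epsilon> w))"
      unfolding c(2) h pair_mem_Lam[OF dh] mem_Succ using hV by metis
  qed
  then show "\<exists>f. level_function f b" by blast
qed

lemma mem_Vset:
  assumes a: "V.ordinal a" shows "x \<epsilon> Vset a \<longleftrightarrow> (\<exists>b. b \<epsilon> a \<and> (\<forall>z. z \<epsilon> x \<longrightarrow> z \<epsilon> Vset b))"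
proof -
  obtain f where f: "level_function f a" using level_function_ex[OF a] by blast
  have V: "Vset b = app f b" if b: "b \<epsilon> Succ a" for b
  proof -
    have "V.ordinal b" using ordinal_mem[OF ordinal_Succ[OF a] b] .
    then show ?thesis using level_function_ex Vset_app[OF a f b] by blast
  qed
  have aa: "a \<epsilon> Succ a" by simp
  show ?thesis unfolding V[OF aa] level_function_rec[OF f a aa] using V by (simp cong: conj_cong)
qed

lemma V_is_level: "V.is_level v a \<longleftrightarrow> V.ordinal a \<and> (\<exists>f. level_function f a \<and> pair a v \<epsilon> f)"
  unfolding V.is_level_def level_function_def V_related V_subset_of by simp

lemma V_level_eq:
  assumes a: "V.ordinal a" shows "V_level E a = Vset a"
  unfolding V_level_def
proof (rule the_equality)
  have aa: "a \<epsilon> Succ a" by simp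
  have *: "pair a v \<epsilon> f \<longleftrightarrow> v = Vset a" if f: "level_function f a" for f v
    using level_function_pair[OF f aa] Vset_app[OF a f aa f] by simp
  show "V.is_level (Vset a) a" using * a level_function_ex[OF a] unfolding V_is_level by blast
  show "v = Vset a" if "V.is_level v a" for v using * that unfolding V_is_level by blast
qed

lemma succ_eq: "succ E a = Succ a"
proof -
  have "V.is_succ s a \<longleftrightarrow> s = Succ a" for s
    by (simp add: V.is_succ_def extensionality_iff[of s])
  then show ?thesis unfolding succ_def by simp
qed

section \<open>Closure properties of the levels and the ordinals in them\<close>

lemma Vset_mono:
  assumes b: "V.ordinal b" and "a \<epsilon> b" "x \<epsilon> Vset a" shows "x \<epsilon> Vset b"
  using assms(3) ordinal_trans[OF b assms(2)]
  unfolding mem_Vset[OF b] mem_Vset[OF ordinal_mem[OF b assms(2)]] by blast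

lemma Vset_transitive:
  assumes a: "V.ordinal a" and "x \<epsilon> Vset a" "y \<epsilon> x" shows "y \<epsilon> Vset a"
proof -
  obtain b where b: "b \<epsilon> a" "y \<epsilon> Vset b" using assms(2,3) unfolding mem_Vset[OF a] by blast
  show ?thesis by (rule Vset_mono[OF a b])
qed

lemma Vset_subset:
  assumes a: "V.ordinal a" and "x \<epsilon> Vset a" "\<And>z. z \<epsilon> y \<Longrightarrow> z \<epsilon> x" shows "y \<epsilon> Vset a"
  using assms(2,3) unfolding mem_Vset[OF a] by blast

lemma mem_Vset_Succ:
  assumes a: "V.ordinal a" shows "x \<epsilon> Vset (Succ a) \<longleftrightarrow> (\<forall>z. z \<epsilon> x \<longrightarrow> z \<epsilon> Vset a)"
  unfolding mem_Vset[OF ordinal_Succ[OF a]] using Vset_mono[OF a] unfolding mem_Succ by blast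

text \<open>By induction, every ordinal \<open>a\<close> below \<open>k\<close> is a subset of
  \<open>Vset a\<close>.\<close>

lemma ordinal_mem_Vset:
  assumes k: "V.ordinal k" and a: "a \<epsilon> k" shows "a \<epsilon> Vset k"
proof -
  have "\<forall>z. z \<epsilon> a \<longrightarrow> z \<epsilon> Vset a"
  proof (rule ordinal_induct[OF _ k a])
    show "dpred (\<lambda>\<rho>. \<forall>z. z \<epsilon> \<rho> 0 \<longrightarrow> z \<epsilon> Vset (\<rho> 0))" by (intro dfn dt_Vset)
    fix a assume a: "a \<epsilon> k" and IH: "\<And>b. b \<epsilon> a \<Longrightarrow> \<forall>z. z \<epsilon> b \<longrightarrow> z \<epsilon> Vset b"
    show "\<forall>z. z \<epsilon> a \<longrightarrow> z \<epsilon> Vset a" using IH unfolding mem_Vset[OF ordinal_mem[OF k a]] by blast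
  qed
  then show ?thesis using a unfolding mem_Vset[OF k] by blast
qed

text \<open>An ordinal that is a subset of \<open>Vset c\<close> is by induction a subset of
  \<open>c\<close>, hence equal to \<open>c\<close> or a member of it.\<close>

lemma ordinal_of_mem_Vset:
  assumes k: "V.ordinal k" and a: "V.ordinal a" "a \<epsilon> Vset k" shows "a \<epsilon> k"
proof -
  have "\<forall>a. V.ordinal a \<longrightarrow> a \<epsilon> Vset k \<longrightarrow> a \<epsilon> k"
  proof (rule ordinal_induct[OF _ ordinal_Succ[OF k]])
    show "dpred (\<lambda>\<rho>. \<forall>a. V.ordinal a \<longrightarrow> a \<epsilon> Vset (\<rho> 0) \<longrightarrow> a \<epsilon> \<rho> 0)" by (intro dfn dt_Vset)
    show "k \<epsilon> Succ k" by simp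
    fix b assume b: "b \<epsilon> Succ k" and IH: "\<And>c. c \<epsilon> b \<Longrightarrow> \<forall>a. V.ordinal a \<longrightarrow> a \<epsilon> Vset c \<longrightarrow> a \<epsilon> c"
    have ob: "V.ordinal b" using ordinal_mem[OF ordinal_Succ[OF k] b] .
    show "\<forall>a. V.ordinal a \<longrightarrow> a \<epsilon> Vset b \<longrightarrow> a \<epsilon> b"
    proof (intro allI impI)
      fix a assume a: "V.ordinal a" "a \<epsilon> Vset b"
      then obtain c where c: "c \<epsilon> b" "\<And>z. z \<epsilon> a \<Longrightarrow> z \<epsilon> Vset c" unfolding mem_Vset[OF ob] by blast
      have "z \<epsilon> c" if "z \<epsilon> a" for z using IH[OF c(1)] c(2) that ordinal_mem[OF a(1)] by blast
      then have "a = c \<or> a \<epsilon> c"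
        using a(1) by (intro transitive_subset_ordinal ordinal_mem[OF ob c(1)]) (auto simp: V_ordinal)
      then show "a \<epsilon> b" using c(1) ordinal_trans[OF ob c(1)] by blast
    qed
  qed
  then show ?thesis using a by blast
qed

end

section \<open>Absoluteness between \<open>V\<^sub>\<kappa>\<close> and the model\<close>

text \<open>Closure under \<open>Succ\<close> keeps pairs and products inside
  \<open>V\<^sub>\<kappa>\<close>; together with closure under subsets this drives the absoluteness
  proofs.\<close>

locale limit_level = zfc_model E for E :: "'v \<Rightarrow> 'v \<Rightarrow> bool"  (infix "\<epsilon>" 50) +
  fixes \<kappa> :: 'v
  assumes ordinal_\<kappa>: "V.ordinal \<kappa>" and Succ_\<kappa>: "a \<epsilon> \<kappa> \<Longrightarrow> Succ a \<epsilon> \<kappa>"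

sublocale limit_level \<subseteq> K: membership_structure "members E (Vset \<kappa>)" E .

context limit_level begin

abbreviation M :: "'v set" where "M \<equiv> members E (Vset \<kappa>)"

lemma M_iff: "x \<in> M \<longleftrightarrow> x \<epsilon> Vset \<kappa>"
  by (simp add: members_def)

lemma M_trans: "x \<in> M \<Longrightarrow> y \<epsilon> x \<Longrightarrow> y \<in> M"
  unfolding M_iff by (rule Vset_transitive[OF ordinal_\<kappa>])

lemma M_subset: "x \<in> M \<Longrightarrow> (\<And>z. z \<epsilon> y \<Longrightarrow> z \<epsilon> x) \<Longrightarrow> y \<in> M"
  unfolding M_iff by (rule Vset_subset[OF ordinal_\<kappa>])

lemma Vset_in_M:
  assumes "a \<epsilon> \<kappa>" shows "Vset a \<in> M"
  unfolding M_iff mem_Vset[OF ordinal_\<kappa>] using assms by blast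

lemma M_bound: "x \<in> M \<Longrightarrow> \<exists>a. a \<epsilon> \<kappa> \<and> (\<forall>z. z \<epsilon> x \<longrightarrow> z \<epsilon> Vset a)"
  unfolding M_iff mem_Vset[OF ordinal_\<kappa>] .

lemma M_bound2:
  assumes "x \<in> M" "y \<in> M"
  shows "\<exists>a. a \<epsilon> \<kappa> \<and> (\<forall>z. z \<epsilon> x \<longrightarrow> z \<epsilon> Vset a) \<and> (\<forall>z. z \<epsilon> y \<longrightarrow> z \<epsilon> Vset a)"
proof -
  obtain a b where a: "a \<epsilon> \<kappa>" "\<And>z. z \<epsilon> x \<Longrightarrow> z \<epsilon> Vset a" and b: "b \<epsilon> \<kappa>" "\<And>z. z \<epsilon> y \<Longrightarrow> z \<epsilon> Vset b"
    using M_bound assms by meson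
  consider "a \<epsilon> b" | "a = b" | "b \<epsilon> a" using ordinal_linear[OF ordinal_\<kappa> a(1) b(1)] by blast
  then show ?thesis
  proof cases
    case 1
    then show ?thesis using Vset_mono[OF ordinal_mem[OF ordinal_\<kappa> b(1)] 1] a b by blast
  next
    case 2
    then show ?thesis using a b by blast
  next
    case 3
    then show ?thesis using Vset_mono[OF ordinal_mem[OF ordinal_\<kappa> a(1)] 3] a b by blast
  qed
qed

lemma Upair_mem_Vset_Succ:
  "V.ordinal a \<Longrightarrow> x \<epsilon> Vset a \<Longrightarrow> y \<epsilon> Vset a \<Longrightarrow> Upair x y \<epsilon> Vset (Succ a)"
  by (auto simp: mem_Vset_Succ)

lemma pair_mem_Vset_Succ:
  "V.ordinal a \<Longrightarrow> x \<epsilon> Vset a \<Longrightarrow> y \<epsilon> Vset a \<Longrightarrow> pair x y \<epsilon> Vset (Succ (Succ a))"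
  unfolding pair_def by (intro Upair_mem_Vset_Succ ordinal_Succ)

lemma Times_M:
  assumes "a \<in> M" "b \<in> M" shows "Times a b \<in> M"
proof -
  obtain c where c: "c \<epsilon> \<kappa>" "\<And>z. z \<epsilon> a \<Longrightarrow> z \<epsilon> Vset c" "\<And>z. z \<epsilon> b \<Longrightarrow> z \<epsilon> Vset c"
    using M_bound2[OF assms] by blast
  have "p \<epsilon> Vset (Succ (Succ c))" if "p \<epsilon> Times a b" for p
    using that c pair_mem_Vset_Succ[OF ordinal_mem[OF ordinal_\<kappa> c(1)]] unfolding mem_Times by blast
  then show ?thesis by (rule M_subset[OF Vset_in_M[OF Succ_\<kappa>[OF Succ_\<kappa>[OF c(1)]]]])
qed

lemma relation_M:
  assumes "a \<in> M" "b \<in> M" "\<And>p. p \<epsilon> f \<Longrightarrow> \<exists>x y. x \<epsilon> a \<and> y \<epsilon> b \<and> p = pair x y" shows "f \<in> M"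
  by (rule M_subset[OF Times_M[OF assms(1,2)]]) (unfold mem_Times, rule assms(3))

lemma Upair_M:
  assumes "x \<in> M" "y \<in> M" shows "Upair x y \<in> M"
proof -
  obtain a where a: "a \<epsilon> \<kappa>" "\<And>z. z \<epsilon> x \<Longrightarrow> z \<epsilon> Vset a" "\<And>z. z \<epsilon> y \<Longrightarrow> z \<epsilon> Vset a"
    using M_bound2[OF assms] by blast
  note o = ordinal_mem[OF ordinal_\<kappa> a(1)]
  have "z \<epsilon> Vset (Succ a)" if "z \<epsilon> Upair x y" for z
    using that a(2,3) unfolding mem_Upair mem_Vset_Succ[OF o] by blast
  then show ?thesis by (rule M_subset[OF Vset_in_M[OF Succ_\<kappa>[OF a(1)]]])
qed

lemma pair_M_iff: "pair x y \<in> M \<longleftrightarrow> x \<in> M \<and> y \<in> M"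
proof
  assume "pair x y \<in> M"
  then have "Upair x y \<in> M" by (rule M_trans) (simp add: pair_def)
  then show "x \<in> M \<and> y \<in> M" using M_trans by (simp; metis mem_Upair)
qed (simp add: pair_def Upair_M)

lemma \<kappa>_subset_M: "a \<epsilon> \<kappa> \<Longrightarrow> a \<in> M"
  unfolding M_iff by (rule ordinal_mem_Vset[OF ordinal_\<kappa>])

section \<open>Comparison of each notion in \<open>V\<^sub>\<kappa>\<close> with the ambient
  one\<close>

lemma K_subset_of: "a \<in> M \<Longrightarrow> K.subset_of a b \<longleftrightarrow> V.subset_of a b"
  unfolding K.subset_of_def V_subset_of using M_trans by blast

lemma K_is_upair: "p \<in> M \<Longrightarrow> a \<in> M \<Longrightarrow> b \<in> M \<Longrightarrow> K.is_upair p a b \<longleftrightarrow> p = Upair a b"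
  unfolding K.is_upair_def extensionality_iff[of p] mem_Upair using M_trans by metis

lemma K_is_pair:
  assumes "p \<in> M" "a \<in> M" "b \<in> M" shows "K.is_pair p a b \<longleftrightarrow> p = pair a b"
proof
  assume "K.is_pair p a b"
  then show "p = pair a b" using assms unfolding K.is_pair_def by (auto simp: K_is_upair pair_def)
next
  assume "p = pair a b"
  then show "K.is_pair p a b" using assms unfolding K.is_pair_def
    by (intro bexI[of _ "Upair a a"] bexI[of _ "Upair a b"]) (auto simp: K_is_upair pair_def Upair_M)
qed

lemma K_related: "x \<in> M \<Longrightarrow> y \<in> M \<Longrightarrow> K.related r x y \<longleftrightarrow> pair x y \<epsilon> r"
  unfolding K.related_def using K_is_pair pair_M_iff by auto

lemma K_function_on:
  assumes f: "\<And>p. p \<epsilon> f \<Longrightarrow> p \<in> M" and D: "\<And>x. D x \<Longrightarrow> x \<in> M"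
  shows "K.function_on f D \<longleftrightarrow> V.function_on f D"
proof -
  have 1: "(\<exists>x\<in>M. \<exists>y\<in>M. D x \<and> K.is_pair p x y) \<longleftrightarrow> (\<exists>x y. D x \<and> p = pair x y)" if "p \<epsilon> f" for p
    using f[OF that] K_is_pair pair_M_iff by metis
  have 2: "(y \<in> M \<and> K.related f x y) \<longleftrightarrow> pair x y \<epsilon> f" if "D x" for x y
    using D[OF that] f K_related pair_M_iff by metis
  have 3: "(\<exists>!y. y \<in> M \<and> K.related f x y) \<longleftrightarrow> (\<exists>!y. pair x y \<epsilon> f)" if "D x" for x
    by (simp only: 2[OF that])
  have "(\<forall>p\<in>M. p \<epsilon> f \<longrightarrow> (\<exists>x\<in>M. \<exists>y\<in>M. D x \<and> K.is_pair p x y)) \<longleftrightarrow>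
      (\<forall>p. p \<epsilon> f \<longrightarrow> (\<exists>x y. D x \<and> p = pair x y))"
    using 1 f by meson
  moreover have "(\<forall>x\<in>M. D x \<longrightarrow> (\<exists>!y. y \<in> M \<and> K.related f x y)) \<longleftrightarrow>
      (\<forall>x. D x \<longrightarrow> (\<exists>!y. pair x y \<epsilon> f))"
  proof (intro iffI allI ballI impI)
    fix x assume *: "\<forall>x\<in>M. D x \<longrightarrow> (\<exists>!y. y \<in> M \<and> K.related f x y)" and x: "D x"
    show "\<exists>!y. pair x y \<epsilon> f"
      by (rule iffD1[OF 3[OF x] mp[OF bspec[OF * D[OF x]] x]])
  next
    fix x assume *: "\<forall>x. D x \<longrightarrow> (\<exists>!y. pair x y \<epsilon> f)" and x: "D x"
    show "\<exists>!y. y \<in> M \<and> K.related f x y"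
      by (rule iffD2[OF 3[OF x] mp[OF spec[OF *] x]])
  qed
  ultimately show ?thesis unfolding K.function_on_def V_function_on by (rule arg_cong2)
qed

lemma K_function_from_to:
  assumes "f \<in> M" "a \<in> M"
  shows "K.function_from_to f a b \<longleftrightarrow> V.function_from_to f a b"
proof -
  have "K.function_on f (\<lambda>x. x \<epsilon> a) \<longleftrightarrow> V.function_on f (\<lambda>x. x \<epsilon> a)"
    using assms M_trans by (intro K_function_on) blast+
  moreover have "(\<forall>x\<in>M. \<forall>y\<in>M. K.related f x y \<longrightarrow> y \<epsilon> b) \<longleftrightarrow> (\<forall>x y. pair x y \<epsilon> f \<longrightarrow> y \<epsilon> b)"
    using assms K_related pair_M_iff M_trans by metis
  ultimately show ?thesis unfolding K.function_from_to_def V.function_from_to_def V_related by simp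
qed

lemma K_injection:
  assumes "f \<in> M" "a \<in> M" shows "K.injection f a b \<longleftrightarrow> V.injection f a b"
proof -
  have "(\<forall>x\<in>M. \<forall>x'\<in>M. \<forall>y\<in>M. K.related f x y \<and> K.related f x' y \<longrightarrow> x = x') \<longleftrightarrow>
      (\<forall>x x' y. pair x y \<epsilon> f \<and> pair x' y \<epsilon> f \<longrightarrow> x = x')" (is "?L \<longleftrightarrow> ?R")
  proof
    have *: "x \<in> M \<and> y \<in> M \<and> K.related f x y" if "pair x y \<epsilon> f" for x y
      using that M_trans[OF assms(1) that] by (simp add: pair_M_iff K_related)
    show ?R if ?L
    proof (intro allI impI, elim conjE)
      fix x x' y assume "pair x y \<epsilon> f" "pair x' y \<epsilon> f"
      from *[OF this(1)] *[OF this(2)] that show "x = x'" by blast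
    qed
    show ?L if ?R using that by (auto simp: K_related)
  qed
  then show ?thesis unfolding K.injection_def V.injection_def V_related
    using K_function_from_to[OF assms] by simp
qed

lemma function_M:
  assumes "V.function_from_to f a b" "a \<in> M" "b \<in> M" shows "f \<in> M"
  using assms(1) unfolding V.function_from_to_def V_function_on V_related
  by (intro relation_M[OF assms(2,3)]) blast

text \<open>An injection between elements of \<open>V\<^sub>\<kappa>\<close> is a subset of their
  product and so lies in \<open>V\<^sub>\<kappa>\<close>: the ambient model has no additional
  witnesses.\<close>

lemma K_card_le:
  assumes "a \<in> M" "b \<in> M" shows "K.card_le a b \<longleftrightarrow> V.card_le a b"
proof -
  have "f \<in> M" if "V.injection f a b" for f
    using that function_M assms unfolding V.injection_def by blast
  then show ?thesis unfolding K.card_le_def V.card_le_def using K_injection assms by blast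
qed

lemma K_card_less: "a \<in> M \<Longrightarrow> b \<in> M \<Longrightarrow> K.card_less a b \<longleftrightarrow> V.card_less a b"
  unfolding K.card_less_def V.card_less_def by (simp add: K_card_le)

lemma K_transitive: "a \<in> M \<Longrightarrow> K.transitive a \<longleftrightarrow> V.transitive a"
  unfolding K.transitive_def V.transitive_def using K_subset_of M_trans by blast

lemma K_ordinal: "a \<in> M \<Longrightarrow> K.ordinal a \<longleftrightarrow> V.ordinal a"
  unfolding K.ordinal_def V.ordinal_def using K_transitive M_trans by blast

lemma ordinal_M_iff: "a \<in> M \<and> K.ordinal a \<longleftrightarrow> a \<epsilon> \<kappa>"
  using K_ordinal \<kappa>_subset_M ordinal_mem[OF ordinal_\<kappa>] ordinal_of_mem_Vset[OF ordinal_\<kappa>]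
  unfolding M_iff by blast

lemma K_limit_ordinal: "a \<in> M \<Longrightarrow> K.limit_ordinal a \<longleftrightarrow> V.limit_ordinal a"
  unfolding K.limit_ordinal_def V.limit_ordinal_def using K_ordinal M_trans by blast

lemma K_is_omega: "a \<in> M \<Longrightarrow> K.is_omega a \<longleftrightarrow> V.is_omega a"
  unfolding K.is_omega_def V.is_omega_def using K_limit_ordinal M_trans by blast

lemma K_cardinal: "a \<in> M \<Longrightarrow> K.cardinal a \<longleftrightarrow> V.cardinal a"
  unfolding K.cardinal_def V.cardinal_def using K_ordinal K_card_less M_trans by blast

lemma K_uncountable: "a \<in> M \<Longrightarrow> K.uncountable a \<Longrightarrow> V.uncountable a"
  unfolding K.uncountable_def V.uncountable_def using K_is_omega K_card_less by blast

lemma K_is_Pk: "p \<in> M \<Longrightarrow> k \<in> M \<Longrightarrow> X \<in> M \<Longrightarrow> K.is_Pk p k X \<longleftrightarrow> p = Pk k X"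
proof -
  assume *: "p \<in> M" "k \<in> M" "X \<in> M"
  have "K.subset_of A X \<and> K.card_less A k \<longleftrightarrow> A \<epsilon> Pk k X" if "A \<in> M" for A
    using that * by (simp add: K_subset_of K_card_less mem_Pk V_subset_of)
  moreover have "A \<in> M" if "A \<epsilon> Pk k X" for A
    using that M_subset[OF *(3)] unfolding mem_Pk by blast
  ultimately show ?thesis
    unfolding K.is_Pk_def extensionality_iff[of p] using M_trans[OF *(1)] by blast
qed

lemma K_is_Collect:
  assumes "b \<in> M" "a \<in> M" "\<And>x. x \<in> M \<Longrightarrow> Q x \<longleftrightarrow> Q' x"
  shows "K.is_Collect b a Q \<longleftrightarrow> V.is_Collect b a Q'"
  using assms M_trans unfolding K.is_Collect_def V.is_Collect_def by blast

lemma K_is_Collect_same: "K.is_Collect b a Q \<Longrightarrow> b \<in> M \<Longrightarrow> a \<in> M \<Longrightarrow> V.is_Collect b a Q"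
  using K_is_Collect[of b a Q Q] by simp

lemma K_ultrafilter_on:
  assumes p: "p \<in> M" and U: "U \<in> M" and K: "K.ultrafilter_on U p" shows "V.ultrafilter_on U p"
proof -
  have UM: "B \<in> M" if "B \<epsilon> U" for B using M_trans[OF U that] .
  have pM: "B \<in> M" if "V.subset_of B p" for B using M_subset[OF p] that unfolding V_subset_of by blast
  note K' = K[unfolded K.ultrafilter_on_def]
  have "\<forall>B. B \<epsilon> U \<longrightarrow> V.subset_of B p"
    using K'[THEN conjunct1] UM K_subset_of by blast
  moreover have "p \<epsilon> U"
    using K'[THEN conjunct2, THEN conjunct1] .
  moreover have "\<forall>B. B \<epsilon> U \<longrightarrow> (\<exists>x. x \<epsilon> B)"
    using K'[THEN conjunct2, THEN conjunct2, THEN conjunct1] UM by blast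
  moreover have "\<forall>B C. B \<epsilon> U \<and> V.subset_of B C \<and> V.subset_of C p \<longrightarrow> C \<epsilon> U"
    using K'[THEN conjunct2, THEN conjunct2, THEN conjunct2, THEN conjunct1] UM pM K_subset_of by blast
  moreover have "\<exists>D. D \<epsilon> U \<and> V.is_Collect D B (\<lambda>x. x \<epsilon> C)" if BC: "B \<epsilon> U" "C \<epsilon> U" for B C
  proof -
    obtain D where "D \<in> M" "D \<epsilon> U" "K.is_Collect D B (\<lambda>x. x \<epsilon> C)"
      using K'[THEN conjunct2, THEN conjunct2, THEN conjunct2, THEN conjunct2, THEN conjunct1] UM BC by blast
    then show ?thesis using K_is_Collect_same[OF _ _ UM[OF BC(1)]] by blast
  qed
  moreover have "B \<epsilon> U \<or> (\<exists>D. D \<epsilon> U \<and> V.is_Collect D p (\<lambda>x. \<not> x \<epsilon> B))" if Bp: "V.subset_of B p" for B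
  proof (cases "B \<epsilon> U")
    case False
    then obtain D where "D \<in> M" "D \<epsilon> U" "K.is_Collect D p (\<lambda>x. \<not> x \<epsilon> B)"
      using K'[THEN conjunct2, THEN conjunct2, THEN conjunct2, THEN conjunct2, THEN conjunct2]
        pM[OF Bp] Bp K_subset_of by blast
    then show ?thesis
      using K_is_Collect_same[OF _ _ p] by blast
  qed blast
  ultimately show ?thesis
    unfolding V.ultrafilter_on_def ball_UNIV bex_UNIV by blast
qed

text \<open>The same measure works outside, because the ambient clauses test it only on subsets of
  \<open>p\<close>, subsets of \<open>U\<close> and regressive functions, and all of these already
  lie in \<open>V\<^sub>\<kappa>\<close>.\<close>

lemma K_supercompact_for:
  assumes k: "k \<in> M" and X: "X \<in> M" and K: "K.supercompact_for k X" shows "V.supercompact_for k X"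
proof -
  obtain p U where p: "p \<in> M" "K.is_Pk p k X" and U: "U \<in> M" and ultra: "K.ultrafilter_on U p"
    and comp: "K.complete_filter U p k" and fine: "K.fine_filter U p X" and norm: "K.normal_filter U"
    using K unfolding K.supercompact_for_def by blast
  have pP: "p = Pk k X" using K_is_Pk p k X by blast
  have UM: "B \<in> M" if "B \<epsilon> U" for B using M_trans[OF U that] .
  have V_ultra: "V.ultrafilter_on U p" by (rule K_ultrafilter_on[OF p(1) U ultra])
  moreover have "V.complete_filter U p k"
    unfolding V.complete_filter_def ball_UNIV bex_UNIV
  proof (intro allI impI)
    fix S assume S: "V.subset_of S U \<and> V.card_less S k"
    then have SM: "S \<in> M" using M_subset[OF U] unfolding V_subset_of by blast
    then obtain I where I: "I \<in> M" "I \<epsilon> U" "K.is_Collect I p (\<lambda>A. \<forall>B\<in>M. B \<epsilon> S \<longrightarrow> A \<epsilon> B)"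
      using comp S K_subset_of K_card_less k unfolding K.complete_filter_def by blast
    have "V.is_Collect I p (\<lambda>A. \<forall>B. B \<epsilon> S \<longrightarrow> A \<epsilon> B)"
      by (rule K_is_Collect[OF I(1) p(1), THEN iffD1, OF _ I(3)]) (use M_trans[OF SM] in blast)
    then show "\<exists>I. I \<epsilon> U \<and> V.is_Collect I p (\<lambda>A. \<forall>B. B \<epsilon> S \<longrightarrow> A \<epsilon> B)" using I(2) by blast
  qed
  moreover have "V.fine_filter U p X"
    unfolding V.fine_filter_def ball_UNIV bex_UNIV
  proof (intro allI impI)
    fix x assume x: "x \<epsilon> X"
    then obtain B where "B \<in> M" "B \<epsilon> U" "K.is_Collect B p (\<lambda>A. x \<epsilon> A)"
      using fine M_trans[OF X] unfolding K.fine_filter_def by blast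
    then show "\<exists>B. B \<epsilon> U \<and> V.is_Collect B p (\<lambda>A. x \<epsilon> A)"
      using K_is_Collect_same[OF _ _ p(1)] by blast
  qed
  moreover have "V.normal_filter U"
    unfolding V.normal_filter_def ball_UNIV bex_UNIV V_subset_of V_related
  proof (intro allI impI, elim conjE)
    fix D f assume D: "D \<epsilon> U" and f: "V.function_on f (\<lambda>A. A \<epsilon> D)" and fA: "\<forall>A y. pair A y \<epsilon> f \<longrightarrow> y \<epsilon> A"
    have DM: "D \<in> M" using UM D .
    have "V.subset_of D p" using V_ultra D unfolding V.ultrafilter_on_def ball_UNIV by blast
    then have AX: "y \<epsilon> X" if "A \<epsilon> D" "y \<epsilon> A" for A y
      using that unfolding V_subset_of pP mem_Pk by blast
    \<comment> \<open>Being regressive, \<open>f\<close> takes its values in members of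
      \<open>D\<close>, hence in \<open>X\<close>, which makes it a subset of
      \<open>Times D X\<close>.\<close>
    have fM: "f \<in> M"
      by (rule relation_M[OF DM X]) (use f fA AX in \<open>unfold V_function_on, blast\<close>)
    have "K.function_on f (\<lambda>A. A \<epsilon> D)"
      by (rule K_function_on[THEN iffD2, OF _ _ f]) (use M_trans[OF fM] M_trans[OF DM] in blast)+
    moreover have "\<forall>A\<in>M. \<forall>y\<in>M. K.related f A y \<longrightarrow> y \<epsilon> A" using fA K_related by blast
    ultimately obtain B c where B: "B \<in> M" "B \<epsilon> U" "K.subset_of B D" "c \<in> M" "\<forall>A\<in>M. A \<epsilon> B \<longrightarrow> K.related f A c"
      using norm D DM fM unfolding K.normal_filter_def by blast
    have "\<forall>A. A \<epsilon> B \<longrightarrow> A \<epsilon> D" using B(3) K_subset_of[OF B(1)] V_subset_of by blast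
    moreover have "\<forall>A. A \<epsilon> B \<longrightarrow> pair A c \<epsilon> f" using B(4,5) K_related M_trans[OF B(1)] by blast
    ultimately show "\<exists>B. B \<epsilon> U \<and> (\<forall>x. x \<epsilon> B \<longrightarrow> x \<epsilon> D) \<and> (\<exists>c. \<forall>A. A \<epsilon> B \<longrightarrow> pair A c \<epsilon> f)"
      using B(2) by blast
  qed
  ultimately show ?thesis unfolding V.supercompact_for_def V_is_Pk pP by blast
qed

end

section \<open>Consequences of normality and completeness\<close>

context normal_quantifier begin

lemma Q_conj_ex:
  assumes "Q B" "Q C" "dpred (\<lambda>\<rho>. B (\<rho> 0))" "dpred (\<lambda>\<rho>. C (\<rho> 0))"
  shows "\<exists>A. A \<epsilon> Pk k X \<and> B A \<and> C A"
  using Q_ex[OF Q_conj[OF assms] dp_conj[OF assms(3,4)]] .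

lemma Q_if: "(b \<Longrightarrow> Q C) \<Longrightarrow> dpred (\<lambda>\<rho>. C (\<rho> 0)) \<Longrightarrow> Q (\<lambda>A. b \<longrightarrow> C A)"
  by (cases b) (simp_all add: Q_True)

text \<open>Almost every \<open>A\<close> is closed under witnesses: for fixed \<open>F\<close> and
  \<open>F'\<close> fineness puts a witness into \<open>A\<close>, and two diagonal intersections
  free them. With \<open>B\<close> expressing that a relation fails at \<open>x\<close>, the absence
  of failures in \<open>A\<close> excludes failures in \<open>X\<close>.\<close>

lemma Q_reflect:
  assumes B: "dpred (\<lambda>\<rho>. B (\<rho> 0) (\<rho> 1) (\<rho> 2))"
  shows "Q (\<lambda>A. \<forall>F. F \<epsilon> A \<longrightarrow> (\<forall>F'. F' \<epsilon> A \<longrightarrow> (\<exists>x. x \<epsilon> X \<and> B F F' x) \<longrightarrow> (\<exists>x. x \<epsilon> A \<and> B F F' x)))"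
proof -
  note dB = dpred_comp3[of B, OF B]
  show ?thesis
  proof (rule Q_diag)
    show "dpred (\<lambda>\<rho>. \<forall>F'. F' \<epsilon> \<rho> 1 \<longrightarrow> (\<exists>x. x \<epsilon> X \<and> B (\<rho> 0) F' x) \<longrightarrow> (\<exists>x. x \<epsilon> \<rho> 1 \<and> B (\<rho> 0) F' x))"
      by (intro dB dfn)
    fix F assume "F \<epsilon> X"
    show "Q (\<lambda>A. \<forall>F'. F' \<epsilon> A \<longrightarrow> (\<exists>x. x \<epsilon> X \<and> B F F' x) \<longrightarrow> (\<exists>x. x \<epsilon> A \<and> B F F' x))"
    proof (rule Q_diag)
      show "dpred (\<lambda>\<rho>. (\<exists>x. x \<epsilon> X \<and> B F (\<rho> 0) x) \<longrightarrow> (\<exists>x. x \<epsilon> \<rho> 1 \<and> B F (\<rho> 0) x))"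
        by (intro dB dfn)
      fix F' assume "F' \<epsilon> X"
      have d: "dpred (\<lambda>\<rho>. \<exists>x. x \<epsilon> \<rho> 0 \<and> B F F' x)" by (intro dB dfn)
      show "Q (\<lambda>A. (\<exists>x. x \<epsilon> X \<and> B F F' x) \<longrightarrow> (\<exists>x. x \<epsilon> A \<and> B F F' x))"
      proof (rule Q_if[OF _ d], elim exE conjE)
        fix x assume x: "x \<epsilon> X" "B F F' x"
        show "Q (\<lambda>A. \<exists>x. x \<epsilon> A \<and> B F F' x)"
          by (rule Q_mono[OF Q_fine[OF x(1)] _ d]) (intro dfn, use x(2) in blast)
      qed
    qed
  qed
qed

end

locale cardinal_quantifier = normal_quantifier E k X Q for E :: "'v \<Rightarrow> 'v \<Rightarrow> bool"  (infix "\<epsilon>" 50) and k X Q +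
  assumes cardinal_k: "V.cardinal k" and k_subset_X: "a \<epsilon> k \<Longrightarrow> a \<epsilon> X"
begin

lemma ordinal_k: "V.ordinal k"
  using cardinal_k unfolding V.cardinal_def by blast

lemma card_less_k: "a \<epsilon> k \<Longrightarrow> V.card_less a k"
  using cardinal_k unfolding V.cardinal_def by blast

lemma k_not_subset: "A \<epsilon> Pk k X \<Longrightarrow> \<exists>a. a \<epsilon> k \<and> \<not> a \<epsilon> A"
  unfolding mem_Pk V.card_less_def using card_le_subset by blast

lemma Q_subset:
  assumes "a \<epsilon> k" shows "Q (\<lambda>A. \<forall>i. i \<epsilon> a \<longrightarrow> i \<epsilon> A)"
proof (rule Q_all[OF card_less_k[OF assms]])
  show "dpred (\<lambda>\<rho>. \<rho> 0 \<epsilon> \<rho> 1)" by (intro dfn)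
  show "Q (\<lambda>A. i \<epsilon> A)" if "i \<epsilon> a" for i
    by (rule Q_fine[OF k_subset_X[OF ordinal_trans[OF ordinal_k assms that]]])
qed

text \<open>If \<open>k\<close> were \<open>Succ a\<close>, some \<open>A\<close> would contain
  \<open>a\<close> and all members of \<open>a\<close>, thus all of \<open>k\<close>, although
  \<open>A\<close> is smaller than \<open>k\<close>.\<close>

lemma Succ_k:
  assumes a: "a \<epsilon> k" shows "Succ a \<epsilon> k"
proof (rule ccontr)
  assume n: "\<not> Succ a \<epsilon> k"
  have "Succ a = k \<or> Succ a \<epsilon> k"
    using ordinal_Succ[OF ordinal_mem[OF ordinal_k a]] a ordinal_trans[OF ordinal_k a]
    by (intro transitive_subset_ordinal[OF ordinal_k]) (auto simp: V_ordinal)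
  then have k: "k = Succ a" using n by blast
  have "\<exists>A. A \<epsilon> Pk k X \<and> (\<forall>i. i \<epsilon> a \<longrightarrow> i \<epsilon> A) \<and> a \<epsilon> A"
    by (rule Q_conj_ex[OF Q_subset[OF a] Q_fine[OF k_subset_X[OF a]]]) (intro dfn)+
  then obtain A where A: "A \<epsilon> Pk k X" "\<forall>i. i \<epsilon> a \<longrightarrow> i \<epsilon> A" "a \<epsilon> A" by blast
  from k_not_subset[OF A(1)] obtain b where b: "b \<epsilon> k" "\<not> b \<epsilon> A" by blast
  from b(1) have "b \<epsilon> a \<or> b = a" unfolding k by simp
  then show False using A b(2) by blast
qed

text \<open>If \<open>S\<close> were unbounded, completeness would give a single \<open>A\<close>
  including every \<open>Succ x\<close> with \<open>x\<close> in \<open>S\<close>, thus all of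
  \<open>k\<close>, although \<open>A\<close> is smaller than \<open>k\<close>.\<close>

lemma regular:
  assumes S: "V.card_less S k" "\<And>x. x \<epsilon> S \<Longrightarrow> x \<epsilon> k"
  shows "\<exists>s. s \<epsilon> k \<and> (\<forall>x. x \<epsilon> S \<longrightarrow> x \<epsilon> s)"
proof (rule ccontr)
  assume n: "\<not> ?thesis"
  have "Q (\<lambda>A. \<forall>x. x \<epsilon> S \<longrightarrow> (\<forall>i. i \<epsilon> Succ x \<longrightarrow> i \<epsilon> A))"
    by (rule Q_all[OF S(1)]) (intro dfn, rule Q_subset[OF Succ_k[OF S(2)]])
  moreover have "dpred (\<lambda>\<rho>. \<forall>x. x \<epsilon> S \<longrightarrow> (\<forall>i. i \<epsilon> Succ x \<longrightarrow> i \<epsilon> \<rho> 0))" by (intro dfn)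
  ultimately have "\<exists>A. A \<epsilon> Pk k X \<and> (\<forall>x. x \<epsilon> S \<longrightarrow> (\<forall>i. i \<epsilon> Succ x \<longrightarrow> i \<epsilon> A))" by (rule Q_ex)
  then obtain A where A: "A \<epsilon> Pk k X" "\<And>x i. x \<epsilon> S \<Longrightarrow> i \<epsilon> Succ x \<Longrightarrow> i \<epsilon> A" by blast
  from k_not_subset[OF A(1)] obtain s where s: "s \<epsilon> k" "\<not> s \<epsilon> A" by blast
  then obtain x where x: "x \<epsilon> S" "\<not> x \<epsilon> s" using n by blast
  have "s \<epsilon> Succ x" using ordinal_linear[OF ordinal_k s(1) S(2)[OF x(1)]] x(2) unfolding mem_Succ by blast
  then show False using A(2)[OF x(1)] s(2) by blast
qed

text \<open>Induction on rank takes the place of a cardinality bound for \<open>Vset a\<close>. The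
  constant value is found by majority: it consists of the \<open>y\<close> that belong to almost
  every value. If the values differed from it, a choice of elements in the symmetric difference
  would be constant by induction, and that constant contradicts the majority.\<close>

lemma Q_constant_app:
  assumes "a \<epsilon> k" shows "\<forall>F. Q (\<lambda>A. app F A \<epsilon> Vset a) \<longrightarrow> (\<exists>c. Q (\<lambda>A. app F A = c))"
proof (rule ordinal_induct[OF _ ordinal_k assms])
  show "dpred (\<lambda>\<rho>. \<forall>F. Q (\<lambda>A. app F A \<epsilon> Vset (\<rho> 0)) \<longrightarrow> (\<exists>c. Q (\<lambda>A. app F A = c)))"
    by (intro dp_Q dt_Vset dfn)
  fix a assume a: "a \<epsilon> k" and IH: "\<And>b. b \<epsilon> a \<Longrightarrow> \<forall>F. Q (\<lambda>A. app F A \<epsilon> Vset b) \<longrightarrow> (\<exists>c. Q (\<lambda>A. app F A = c))"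
  note oa = ordinal_mem[OF ordinal_k a]
  show "\<forall>F. Q (\<lambda>A. app F A \<epsilon> Vset a) \<longrightarrow> (\<exists>c. Q (\<lambda>A. app F A = c))"
  proof (intro allI impI)
    fix F assume F: "Q (\<lambda>A. app F A \<epsilon> Vset a)"
    define S where "S b A \<longleftrightarrow> (\<forall>z. z \<epsilon> app F A \<longrightarrow> z \<epsilon> Vset b)" for b A
    have dS: "dpred (\<lambda>\<rho>. S (t \<rho>) (s \<rho>))" if "dterm t" "dterm s" for t s
      by (rule dpred_comp2[of S, OF _ that]) (unfold S_def, intro dt_Vset dfn)
    have dS0: "dpred (\<lambda>\<rho>. S b (\<rho> 0))" for b by (intro dS dfn)
    \<comment> \<open>Each value in \<open>Vset a\<close> is a subset of some \<open>Vset b\<close>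
      with \<open>b\<close> below \<open>a\<close>; there are fewer than \<open>k\<close> such
      \<open>b\<close>, so completeness selects one for almost all \<open>A\<close>.\<close>
    have "\<exists>b. b \<epsilon> a \<and> Q (S b)"
    proof (rule ccontr)
      assume n: "\<not> (\<exists>b. b \<epsilon> a \<and> Q (S b))"
      have Qn: "Q (\<lambda>A. \<forall>b. b \<epsilon> a \<longrightarrow> \<not> S b A)"
        by (rule Q_all[OF card_less_k[OF a]]) (intro dS dfn, rule Q_neg[OF _ dS0], use n in blast)
      have "\<exists>A. A \<epsilon> Pk k X \<and> app F A \<epsilon> Vset a \<and> (\<forall>b. b \<epsilon> a \<longrightarrow> \<not> S b A)"
        by (rule Q_conj_ex[OF F Qn]) (intro dS dt_Vset dfn)+
      then show False unfolding mem_Vset[OF oa] S_def by blast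
    qed
    then obtain b where b: "b \<epsilon> a" and QS: "Q (S b)" by blast
    define c where "c = Sep (Vset b) (\<lambda>y. Q (\<lambda>A. y \<epsilon> app F A))"
    have c: "y \<epsilon> c \<longleftrightarrow> y \<epsilon> Vset b \<and> Q (\<lambda>A. y \<epsilon> app F A)" for y
      unfolding c_def by (rule mem_Sep) (intro dp_Q dfn)
    have dc: "dpred (\<lambda>\<rho>. app F (\<rho> 0) = c)" by (intro dfn)
    have "Q (\<lambda>A. app F A = c)"
    proof (rule ccontr)
      assume "\<not> Q (\<lambda>A. app F A = c)"
      from Q_neg[OF this dc] have ne: "Q (\<lambda>A. app F A \<noteq> c)" .
      define N where "N A \<longleftrightarrow> S b A \<and> app F A \<noteq> c" for A
      have dN: "dpred (\<lambda>\<rho>. N (\<rho> 0))" unfolding N_def by (intro dS dfn)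
      have QN: "Q N" unfolding N_def by (rule Q_conj[OF QS ne dS0]) (intro dfn)
      have "\<exists>y. y \<epsilon> Vset b \<and> (y \<epsilon> app F A \<longleftrightarrow> \<not> y \<epsilon> c)" if "A \<epsilon> Sep (Pk k X) N" for A
      proof -
        have A: "S b A" "app F A \<noteq> c" using that unfolding mem_Sep[OF dN] N_def by blast+
        then obtain y where "y \<epsilon> app F A \<longleftrightarrow> \<not> y \<epsilon> c" unfolding extensionality_iff[of "app F A"] by blast
        then show ?thesis using A(1) c unfolding S_def by blast
      qed
      moreover have "dpred (\<lambda>\<rho>. \<rho> 1 \<epsilon> app F (\<rho> 0) \<longleftrightarrow> \<not> \<rho> 1 \<epsilon> c)" by (intro dfn)
      ultimately obtain H where H: "\<And>A. A \<epsilon> Sep (Pk k X) N \<Longrightarrow>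
          app H A \<epsilon> Vset b \<and> (app H A \<epsilon> app F A \<longleftrightarrow> \<not> app H A \<epsilon> c)"
        using choice[of "\<lambda>A y. y \<epsilon> app F A \<longleftrightarrow> \<not> y \<epsilon> c" "Sep (Pk k X) N" "Vset b"] by blast
      then have H: "app H A \<epsilon> Vset b" "app H A \<epsilon> app F A \<longleftrightarrow> \<not> app H A \<epsilon> c" if "A \<epsilon> Pk k X" "N A" for A
        using that unfolding mem_Sep[OF dN] by blast+
      have "Q (\<lambda>A. app H A \<epsilon> Vset b)"
        by (rule Q_mono[OF QN dN]) (intro dt_Vset dfn, rule H(1))
      then obtain y where y: "Q (\<lambda>A. app H A = y)" using IH[OF b] by blast
      have dy: "dpred (\<lambda>\<rho>. app H (\<rho> 0) = y)" and dyF: "dpred (\<lambda>\<rho>. y \<epsilon> app F (\<rho> 0))" by (intro dfn)+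
      note QNy = Q_conj[OF QN y dN dy] and dNy = dp_conj[OF dN dy]
      from Q_ex[OF QNy dNy] have yb: "y \<epsilon> Vset b" using H(1) by blast
      show False
      proof (cases "y \<epsilon> c")
        case True
        then have "Q (\<lambda>A. y \<epsilon> app F A)" using c by blast
        from Q_conj_ex[OF QNy this dNy dyF] obtain A where "A \<epsilon> Pk k X" "N A" "app H A = y" "y \<epsilon> app F A" by blast
        then show False using H(2) True by blast
      next
        case False
        then have "\<not> Q (\<lambda>A. y \<epsilon> app F A)" using c yb by blast
        from Q_conj_ex[OF QNy Q_neg[OF this dyF] dNy dp_not[OF dyF]]
        obtain A where "A \<epsilon> Pk k X" "N A" "app H A = y" "\<not> y \<epsilon> app F A" by blast
        then show False using H(2) False by blast
      qed
    qed
    then show "\<exists>c. Q (\<lambda>A. app F A = c)" by blast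
  qed
qed

lemma Q_constant:
  assumes a: "a \<epsilon> k" and f: "dterm (\<lambda>\<rho>. f (\<rho> 0))" and Q: "Q (\<lambda>A. f A \<epsilon> Vset a)"
  shows "\<exists>c. Q (\<lambda>A. f A = c)"
proof -
  note df = dterm_comp1[of f, OF f]
  define F where "F = Lam (Pk k X) f"
  have F: "app F A = f A" if "A \<epsilon> Pk k X" for A unfolding F_def by (rule app_Lam[OF f that])
  have "Q (\<lambda>A. app F A \<epsilon> Vset a)"
    by (rule Q_mono[OF Q]) (intro df dt_Vset dfn, intro df dt_Vset dfn, simp add: F)
  then obtain c where c: "Q (\<lambda>A. app F A = c)" using Q_constant_app[OF a] by blast
  have "Q (\<lambda>A. f A = c)"
    by (rule Q_mono[OF c]) (intro df dfn, intro df dfn, simp add: F)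
  then show ?thesis by blast
qed

end

section \<open>Homomorphisms of graphs in \<open>V\<^sub>\<kappa>\<close>\<close>

context zfc_model begin

definition fst_of :: "'v \<Rightarrow> 'v" where "fst_of p = Desc (\<lambda>x. \<exists>y. p = pair x y)"
definition snd_of :: "'v \<Rightarrow> 'v" where "snd_of p = Desc (\<lambda>y. \<exists>x. p = pair x y)"

lemma fst_of_pair [simp]: "fst_of (pair x y) = x" and snd_of_pair [simp]: "snd_of (pair x y) = y"
  unfolding fst_of_def snd_of_def by (rule Desc_eq; force)+

lemma dt_fst_of: "dterm t \<Longrightarrow> dterm (\<lambda>\<rho>. fst_of (t \<rho>))"
  by (rule dterm_comp1[of fst_of]) (unfold fst_of_def, intro dt_Desc dfn)

lemma dt_snd_of: "dterm t \<Longrightarrow> dterm (\<lambda>\<rho>. snd_of (t \<rho>))"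
  by (rule dterm_comp1[of snd_of]) (unfold snd_of_def, intro dt_Desc dfn)

definition digraph :: "'v \<Rightarrow> bool" where
  "digraph g \<longleftrightarrow> g = pair (fst_of g) (snd_of g) \<and>
    (\<forall>p. p \<epsilon> snd_of g \<longrightarrow> (\<exists>x y. x \<epsilon> fst_of g \<and> y \<epsilon> fst_of g \<and> p = pair x y))"

text \<open>\<open>h\<close> may be any set, read through the total \<open>app\<close>; this avoids
  carrying the function conditions of \<open>graph_hom\<close> through the main argument.\<close>

definition hom :: "'v \<Rightarrow> 'v \<Rightarrow> 'v \<Rightarrow> bool" where
  "hom h g g' \<longleftrightarrow> (\<forall>x. x \<epsilon> fst_of g \<longrightarrow> app h x \<epsilon> fst_of g') \<and>
    (\<forall>x y. pair x y \<epsilon> snd_of g \<longrightarrow> pair (app h x) (app h y) \<epsilon> snd_of g')"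

lemma dp_hom: "dterm t \<Longrightarrow> dterm s \<Longrightarrow> dterm u \<Longrightarrow> dpred (\<lambda>\<rho>. hom (t \<rho>) (s \<rho>) (u \<rho>))"
  by (rule dpred_comp3[of hom]) (unfold hom_def, intro dt_fst_of dt_snd_of dfn)

end

context limit_level begin

lemma K_is_graph:
  assumes "g \<in> M" "v \<in> M" "e \<in> M" shows "K.is_graph g v e \<longleftrightarrow> g = pair v e \<and> digraph g"
proof -
  have "(\<exists>x\<in>M. \<exists>y\<in>M. x \<epsilon> v \<and> y \<epsilon> v \<and> K.is_pair p x y) \<longleftrightarrow> (\<exists>x y. x \<epsilon> v \<and> y \<epsilon> v \<and> p = pair x y)"
    if "p \<epsilon> e" for p
    using K_is_pair[OF M_trans[OF assms(3) that]] M_trans[OF assms(2)] by blast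
  then have "(\<forall>p\<in>M. p \<epsilon> e \<longrightarrow> (\<exists>x\<in>M. \<exists>y\<in>M. x \<epsilon> v \<and> y \<epsilon> v \<and> K.is_pair p x y)) \<longleftrightarrow>
      (\<forall>p. p \<epsilon> e \<longrightarrow> (\<exists>x y. x \<epsilon> v \<and> y \<epsilon> v \<and> p = pair x y))"
    using M_trans[OF assms(3)] by blast
  then show ?thesis
    unfolding K.is_graph_def digraph_def K_is_pair[OF assms] by auto
qed

lemma digraph_M:
  assumes "digraph g" "g \<in> M" shows "fst_of g \<in> M \<and> snd_of g \<in> M"
proof -
  have "pair (fst_of g) (snd_of g) = g" using assms(1) unfolding digraph_def by (rule conjE) (rule sym)
  then show ?thesis using assms(2) pair_M_iff[of "fst_of g" "snd_of g"] by simp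
qed

lemma K_graph:
  assumes "g \<in> M" shows "K.graph g \<longleftrightarrow> digraph g"
proof
  assume "K.graph g"
  then show "digraph g" unfolding K.graph_def using K_is_graph[OF assms] by blast
next
  assume g: "digraph g"
  then have "g = pair (fst_of g) (snd_of g)" unfolding digraph_def by (rule conjunct1)
  with g digraph_M[OF g assms] show "K.graph g"
    unfolding K.graph_def using K_is_graph[OF assms] by blast
qed

lemma hom_of_K_graph_hom:
  assumes g: "g \<in> M" "g' \<in> M" and h: "h \<in> M" and "K.graph_hom h g g'" shows "hom h g g'"
proof -
  obtain v e v' e' where M: "v \<in> M" "e \<in> M" "v' \<in> M" "e' \<in> M" and "K.is_graph g v e" "K.is_graph g' v' e'"
    and f: "K.function_from_to h v v'"
    and hom: "\<And>x y x' y'. x \<in> M \<Longrightarrow> y \<in> M \<Longrightarrow> x' \<in> M \<Longrightarrow> y' \<in> M \<Longrightarrow>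
      K.related e x y \<and> K.related h x x' \<and> K.related h y y' \<Longrightarrow> K.related e' x' y'"
    using assms(4) unfolding K.graph_hom_def by blast
  then have eq: "g = pair v e" "g' = pair v' e'" and "digraph g" using K_is_graph g by blast+
  have "V.function_from_to h v v'" using f K_function_from_to[OF h M(1)] by blast
  then have ex: "\<exists>!y. pair x y \<epsilon> h" "\<And>y. pair x y \<epsilon> h \<Longrightarrow> y \<epsilon> v'" if "x \<epsilon> v" for x
    using that unfolding V.function_from_to_def V_function_on V_related by simp_all
  have h_app: "pair x (app h x) \<epsilon> h" if "x \<epsilon> v" for x using app_iff[OF ex(1)[OF that]] by blast
  have v': "app h x \<epsilon> v'" if "x \<epsilon> v" for x using ex(2)[OF that h_app[OF that]] .
  have "pair (app h x) (app h y) \<epsilon> e'" if xy: "pair x y \<epsilon> e" for x y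
  proof -
    have "x \<epsilon> v" "y \<epsilon> v" using \<open>digraph g\<close> xy unfolding digraph_def eq by auto
    note xy_v = this
    note in_M = M_trans[OF M(1) xy_v(1)] M_trans[OF M(1) xy_v(2)]
      M_trans[OF M(3) v'[OF xy_v(1)]] M_trans[OF M(3) v'[OF xy_v(2)]]
    have "K.related e' (app h x) (app h y)"
      by (rule hom[OF in_M]) (use K_related in_M xy h_app xy_v in blast)
    then show ?thesis using K_related in_M by blast
  qed
  then show ?thesis unfolding hom_def eq fst_of_pair snd_of_pair using v' by blast
qed

text \<open>Restricted to the vertices, \<open>h\<close> becomes a subset of
  \<open>Times v v'\<close> and hence an element of \<open>V\<^sub>\<kappa>\<close>.\<close>

lemma K_graph_hom_of_hom:
  assumes g: "g \<in> M" "g' \<in> M" and G: "digraph g" "digraph g'" and h: "hom h g g'"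
  shows "\<exists>h\<in>M. K.graph_hom h g g'"
proof -
  obtain v e v' e' where eq: "g = pair v e" "g' = pair v' e'" using G unfolding digraph_def by blast
  have M: "v \<in> M" "e \<in> M" "v' \<in> M" "e' \<in> M" using g unfolding eq pair_M_iff by blast+
  note h' = h[unfolded hom_def eq fst_of_pair snd_of_pair]
  define f where "f = Lam v (app h)"
  have dh: "dterm (\<lambda>\<rho>. app h (\<rho> 0))" by (intro dfn)
  have f: "V.function_from_to f v v'"
    unfolding V.function_from_to_def V_related f_def pair_mem_Lam[OF dh]
    using function_on_Lam[OF dh] h' by blast
  have fM: "f \<in> M" by (rule function_M[OF f M(1,3)])
  have "K.graph_hom f g g'"
    unfolding K.graph_hom_def
  proof (intro bexI conjI ballI impI)
    show "K.is_graph g v e" "K.is_graph g' v' e'" using K_is_graph g M eq G by blast+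
    show "K.function_from_to f v v'" using K_function_from_to[OF fM M(1)] f by blast
    fix x y x' y' assume "x \<in> M" "y \<in> M" "x' \<in> M" "y' \<in> M"
      and r: "K.related e x y \<and> K.related f x x' \<and> K.related f y y'"
    note rel = K_related[OF \<open>x' \<in> M\<close> \<open>y' \<in> M\<close>] K_related[OF \<open>x \<in> M\<close> \<open>y \<in> M\<close>]
      K_related[OF \<open>x \<in> M\<close> \<open>x' \<in> M\<close>] K_related[OF \<open>y \<in> M\<close> \<open>y' \<in> M\<close>]
    have "pair x y \<epsilon> e" "x' = app h x" "y' = app h y"
      using r unfolding rel f_def pair_mem_Lam[OF dh] by blast+
    then show "K.related e' x' y'" unfolding rel using h' by blast
  qed (rule M)+
  then show ?thesis using fM by blast
qed

end

section \<open>Homomorphisms from a graph to its successor in the sequence\<close>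

locale universe_quantifier = limit_level E \<kappa> + cardinal_quantifier E \<kappa> "Power (Vset \<kappa>)" Q
  for E :: "'v \<Rightarrow> 'v \<Rightarrow> bool"  (infix "\<epsilon>" 50) and \<kappa> Q
begin

text \<open>Makes \<open>Meet A \<kappa>\<close> an ordinal. By completeness each \<open>x\<close>
  below \<kappa> is a subset of almost every \<open>A\<close>, and these conditions are intersected
  diagonally.\<close>

lemma Q_transitive: "Q (\<lambda>A. \<forall>x. x \<epsilon> A \<longrightarrow> x \<epsilon> \<kappa> \<longrightarrow> (\<forall>y. y \<epsilon> x \<longrightarrow> y \<epsilon> A))"
proof (rule Q_diag)
  show "dpred (\<lambda>\<rho>. \<rho> 0 \<epsilon> \<kappa> \<longrightarrow> (\<forall>y. y \<epsilon> \<rho> 0 \<longrightarrow> y \<epsilon> \<rho> 1))" by (intro dfn)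
  show "Q (\<lambda>A. x \<epsilon> \<kappa> \<longrightarrow> (\<forall>y. y \<epsilon> x \<longrightarrow> y \<epsilon> A))" for x
    by (rule Q_if[OF Q_subset]) (assumption, intro dfn)
qed

lemma in_X_iff: "F \<epsilon> Power (Vset \<kappa>) \<longleftrightarrow> (\<forall>p. p \<epsilon> F \<longrightarrow> p \<in> M)"
  by (simp add: M_iff)

text \<open>
  This replaces the closure of the ultrapower under sequences: if a function on \<open>A \<inter> \<kappa>\<close> is
  chosen for almost every \<open>A\<close>, then each of its values is almost everywhere constant, and the
  resulting function on \<open>\<kappa>\<close> is an element of almost every \<open>A\<close>.
\<close>

lemma Q_full:
  assumes v: "dterm (\<lambda>\<rho>. v (\<rho> 0))" and vM: "\<And>\<xi>. \<xi> \<epsilon> \<kappa> \<Longrightarrow> v \<xi> \<in> M"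
  shows "Q (\<lambda>A. \<forall>F. F \<epsilon> Power (Vset \<kappa>) \<longrightarrow> (\<forall>\<xi>. \<xi> \<epsilon> A \<longrightarrow> \<xi> \<epsilon> \<kappa> \<longrightarrow> app F \<xi> \<epsilon> v \<xi>) \<longrightarrow>
      (\<exists>F'. F' \<epsilon> A \<and> (\<forall>\<xi>. \<xi> \<epsilon> A \<longrightarrow> \<xi> \<epsilon> \<kappa> \<longrightarrow> app F' \<xi> = app F \<xi>)))" (is "Q ?C")
proof (rule ccontr)
  note dv = dterm_comp1[of v, OF v]
  let ?p = "Pk \<kappa> (Power (Vset \<kappa>))"
  define R where "R A F \<longleftrightarrow> (\<forall>\<xi>. \<xi> \<epsilon> A \<longrightarrow> \<xi> \<epsilon> \<kappa> \<longrightarrow> app F \<xi> \<epsilon> v \<xi>) \<and>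
    \<not> (\<exists>F'. F' \<epsilon> A \<and> (\<forall>\<xi>. \<xi> \<epsilon> A \<longrightarrow> \<xi> \<epsilon> \<kappa> \<longrightarrow> app F' \<xi> = app F \<xi>))" for A F
  have dR0: "dpred (\<lambda>\<rho>. R (\<rho> 0) (\<rho> 1))" unfolding R_def by (intro dv dfn)
  note dR = dpred_comp2[of R, OF dR0]
  define N where "N A \<longleftrightarrow> (\<exists>F. F \<epsilon> Power (Vset \<kappa>) \<and> R A F)" for A
  have dN: "dpred (\<lambda>\<rho>. N (\<rho> 0))" unfolding N_def by (intro dR dfn)
  assume "\<not> Q ?C"
  then have "Q (\<lambda>A. \<not> ?C A)" by (rule Q_neg) (intro dv dfn)
  then have QN: "Q N" unfolding N_def R_def by simp
  \<comment> \<open>\<open>\<Phi>\<close> selects for every bad \<open>A\<close> a function without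
    an extension in \<open>A\<close>; the function \<open>F\<close> obtained as the limit of these
    selections refutes it.\<close>
  have "\<exists>\<Phi>. \<forall>A. A \<epsilon> Sep ?p N \<longrightarrow> app \<Phi> A \<epsilon> Power (Vset \<kappa>) \<and> R A (app \<Phi> A)"
    by (rule choice[OF dR0]) (unfold mem_Sep[OF dN] N_def, blast)
  then obtain \<Phi> where \<Phi>: "\<And>A. A \<epsilon> ?p \<Longrightarrow> N A \<Longrightarrow> R A (app \<Phi> A)"
    unfolding mem_Sep[OF dN] by blast
  have ex: "\<exists>y. y \<epsilon> v \<xi> \<and> Q (\<lambda>A. app (app \<Phi> A) \<xi> = y)" if \<xi>: "\<xi> \<epsilon> \<kappa>" for \<xi>
  proof -
    have d1: "dpred (\<lambda>\<rho>. \<xi> \<epsilon> \<rho> 0)" and d2: "dpred (\<lambda>\<rho>. app (app \<Phi> (\<rho> 0)) \<xi> \<epsilon> v \<xi>)" by (intro dfn)+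
    have Q1: "Q (\<lambda>A. app (app \<Phi> A) \<xi> \<epsilon> v \<xi>)"
      by (rule Q_mono[OF Q_conj[OF QN Q_fine[OF k_subset_X[OF \<xi>]] dN d1] dp_conj[OF dN d1] d2])
        (use \<Phi> \<xi> in \<open>unfold R_def, blast\<close>)
    \<comment> \<open>The set \<open>v \<xi>\<close> lies in \<open>V\<^sub>\<kappa>\<close>, so the
      selected values stay within one level below \<kappa>, as \<open>Q_constant\<close>
      demands.\<close>
    obtain a where a: "a \<epsilon> \<kappa>" "\<And>z. z \<epsilon> v \<xi> \<Longrightarrow> z \<epsilon> Vset a" using M_bound[OF vM[OF \<xi>]] by blast
    have "Q (\<lambda>A. app (app \<Phi> A) \<xi> \<epsilon> Vset a)"
      by (rule Q_mono[OF Q1 d2]) (intro dfn, rule a(2))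
    from Q_constant[OF a(1) _ this] dt_app[OF dt_app[OF dt_const dt_var] dt_const]
    obtain y where y: "Q (\<lambda>A. app (app \<Phi> A) \<xi> = y)" by blast
    have "\<exists>A. A \<epsilon> ?p \<and> app (app \<Phi> A) \<xi> \<epsilon> v \<xi> \<and> app (app \<Phi> A) \<xi> = y"
      by (rule Q_conj_ex[OF Q1 y d2]) (intro dfn)
    then show ?thesis using y by blast
  qed
  define F where "F = Sep (Times \<kappa> (Vset \<kappa>)) (\<lambda>p. \<exists>\<xi> y. p = pair \<xi> y \<and> Q (\<lambda>A. app (app \<Phi> A) \<xi> = y))"
  have dF: "dpred (\<lambda>\<rho>. \<exists>\<xi> y. \<rho> 0 = pair \<xi> y \<and> Q (\<lambda>A. app (app \<Phi> A) \<xi> = y))"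
    by (intro dp_Q dfn)
  have F: "pair \<xi> y \<epsilon> F \<longleftrightarrow> \<xi> \<epsilon> \<kappa> \<and> y \<in> M \<and> Q (\<lambda>A. app (app \<Phi> A) \<xi> = y)" for \<xi> y
    unfolding F_def mem_Sep[OF dF] mem_Times M_iff by auto
  have FX: "F \<epsilon> Power (Vset \<kappa>)"
    unfolding in_X_iff F_def mem_Sep[OF dF] mem_Times using pair_M_iff \<kappa>_subset_M M_iff by blast
  have QF: "Q (\<lambda>A. app (app \<Phi> A) \<xi> = app F \<xi>)" if \<xi>: "\<xi> \<epsilon> \<kappa>" for \<xi>
  proof -
    obtain y where y: "y \<epsilon> v \<xi>" "Q (\<lambda>A. app (app \<Phi> A) \<xi> = y)" using ex[OF \<xi>] by blast
    have "app F \<xi> = y"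
    proof (rule app_eq)
      show "pair \<xi> y \<epsilon> F" using F \<xi> y M_trans[OF vM[OF \<xi>]] by blast
      fix z assume "pair \<xi> z \<epsilon> F"
      then have z: "Q (\<lambda>A. app (app \<Phi> A) \<xi> = z)" using F by blast
      have "\<exists>A. A \<epsilon> ?p \<and> app (app \<Phi> A) \<xi> = y \<and> app (app \<Phi> A) \<xi> = z"
        by (rule Q_conj_ex[OF y(2) z]) (intro dfn)+
      then show "z = y" by blast
    qed
    then show ?thesis using y(2) by simp
  qed
  have QD: "Q (\<lambda>A. \<forall>\<xi>. \<xi> \<epsilon> A \<longrightarrow> \<xi> \<epsilon> \<kappa> \<longrightarrow> app (app \<Phi> A) \<xi> = app F \<xi>)"
    by (rule Q_diag) (intro dfn, rule Q_if, erule QF, intro dfn)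
  have dD: "dpred (\<lambda>\<rho>. \<forall>\<xi>. \<xi> \<epsilon> \<rho> 0 \<longrightarrow> \<xi> \<epsilon> \<kappa> \<longrightarrow> app (app \<Phi> (\<rho> 0)) \<xi> = app F \<xi>)"
    and dFA: "dpred (\<lambda>\<rho>. F \<epsilon> \<rho> 0)" by (intro dfn)+
  \<comment> \<open>By fineness \<open>F\<close> belongs to \<open>A\<close>, and it is exactly the
    extension that \<open>R\<close> denies.\<close>
  from Q_conj_ex[OF Q_conj[OF QN QD dN dD] Q_fine[OF FX] dp_conj[OF dN dD] dFA]
  obtain A where A: "A \<epsilon> ?p" "N A" "\<forall>\<xi>. \<xi> \<epsilon> A \<longrightarrow> \<xi> \<epsilon> \<kappa> \<longrightarrow> app (app \<Phi> A) \<xi> = app F \<xi>" "F \<epsilon> A" by blast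
  from \<Phi>[OF A(1,2)] have "\<not> (\<exists>F'. F' \<epsilon> A \<and> (\<forall>\<xi>. \<xi> \<epsilon> A \<longrightarrow> \<xi> \<epsilon> \<kappa> \<longrightarrow> app F' \<xi> = app (app \<Phi> A) \<xi>))"
    unfolding R_def by blast
  with A(3,4) show False by metis
qed

lemma hom_to_successor:
  assumes g: "\<And>\<xi>. \<xi> \<epsilon> \<kappa> \<Longrightarrow> app G \<xi> \<in> M" "\<And>\<xi>. \<xi> \<epsilon> \<kappa> \<Longrightarrow> digraph (app G \<xi>)"
    and homs: "\<And>c \<xi>. c \<epsilon> \<kappa> \<Longrightarrow> \<xi> \<epsilon> c \<Longrightarrow> \<exists>h. h \<in> M \<and> hom h (app G c) (app G \<xi>)"
  shows "\<exists>c h. c \<epsilon> \<kappa> \<and> hom h (app G c) (app G (Succ c))"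
proof -
  let ?X = "Power (Vset \<kappa>)"
  define v where "v \<xi> = fst_of (app G \<xi>)" for \<xi>
  define e where "e \<xi> = snd_of (app G \<xi>)" for \<xi>
  have v0: "dterm (\<lambda>\<rho>. v (\<rho> 0))" and e0: "dterm (\<lambda>\<rho>. e (\<rho> 0))"
    unfolding v_def e_def by (intro dt_fst_of dt_snd_of dfn)+
  note dve = dterm_comp1[of v, OF v0] dterm_comp1[of e, OF e0]
  have vM: "v \<xi> \<in> M" if "\<xi> \<epsilon> \<kappa>" for \<xi> using digraph_M g that unfolding v_def by blast
  have e_v: "x \<epsilon> v \<xi> \<and> y \<epsilon> v \<xi>" if "\<xi> \<epsilon> \<kappa>" "pair x y \<epsilon> e \<xi>" for x y \<xi>
    using g(2)[OF that(1)] that(2) unfolding digraph_def v_def e_def by auto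
  \<comment> \<open>Both relations express a failure at \<xi>: a value that is no vertex, and a pair
    of values that is no edge. The first ignores \<open>F'\<close> in order to fit
    \<open>Q_reflect\<close>.\<close>
  let ?B1 = "\<lambda>F F' \<xi>. \<xi> \<epsilon> \<kappa> \<and> \<not> app F \<xi> \<epsilon> v \<xi>"
  let ?B2 = "\<lambda>F F' \<xi>. \<xi> \<epsilon> \<kappa> \<and> \<not> pair (app F \<xi>) (app F' \<xi>) \<epsilon> e \<xi>"
  let ?C = "\<lambda>B A. \<forall>F. F \<epsilon> A \<longrightarrow> (\<forall>F'. F' \<epsilon> A \<longrightarrow> (\<exists>x. x \<epsilon> ?X \<and> B F F' x) \<longrightarrow> (\<exists>x. x \<epsilon> A \<and> B F F' x))"
  let ?T = "\<lambda>A. \<forall>x. x \<epsilon> A \<longrightarrow> x \<epsilon> \<kappa> \<longrightarrow> (\<forall>y. y \<epsilon> x \<longrightarrow> y \<epsilon> A)"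
  let ?D = "\<lambda>A. \<forall>F. F \<epsilon> ?X \<longrightarrow> (\<forall>\<xi>. \<xi> \<epsilon> A \<longrightarrow> \<xi> \<epsilon> \<kappa> \<longrightarrow> app F \<xi> \<epsilon> v \<xi>) \<longrightarrow>
      (\<exists>F'. F' \<epsilon> A \<and> (\<forall>\<xi>. \<xi> \<epsilon> A \<longrightarrow> \<xi> \<epsilon> \<kappa> \<longrightarrow> app F' \<xi> = app F \<xi>))"
  have Q1: "Q (?C ?B1)" by (rule Q_reflect) (intro dve dfn)
  have Q2: "Q (?C ?B2)" by (rule Q_reflect) (intro dve dfn)
  have QD: "Q ?D" by (rule Q_full[OF v0 vM])
  have d1: "dpred (\<lambda>\<rho>. ?C ?B1 (\<rho> 0))" by (intro dve dfn)
  have d2: "dpred (\<lambda>\<rho>. ?C ?B2 (\<rho> 0))" by (intro dve dfn)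
  have dD: "dpred (\<lambda>\<rho>. ?D (\<rho> 0))" by (intro dve dfn)
  have dT: "dpred (\<lambda>\<rho>. ?T (\<rho> 0))" by (intro dfn)
  have "\<exists>A. A \<epsilon> Pk \<kappa> ?X \<and> (?C ?B1 A \<and> ?C ?B2 A) \<and> (?D A \<and> ?T A)"
    by (rule Q_conj_ex[OF Q_conj[OF Q1 Q2 d1 d2] Q_conj[OF QD Q_transitive dD dT] dp_conj[OF d1 d2] dp_conj[OF dD dT]])
  then obtain A where A: "A \<epsilon> Pk \<kappa> ?X" and C1: "?C ?B1 A" and C2: "?C ?B2 A" and D: "?D A" and T: "?T A"
    by blast
  define c where "c = Meet A \<kappa>"
  have c: "\<xi> \<epsilon> c \<longleftrightarrow> \<xi> \<epsilon> A \<and> \<xi> \<epsilon> \<kappa>" for \<xi> unfolding c_def by simp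
  \<comment> \<open>\<open>c\<close> is an initial segment of \<kappa> by \<open>T\<close>, and a
    proper one because \<open>A\<close> has fewer than \<kappa> elements.\<close>
  have "c = \<kappa> \<or> c \<epsilon> \<kappa>"
    by (rule transitive_subset_ordinal[OF ordinal_\<kappa>])
      (unfold V_transitive c, use T ordinal_trans[OF ordinal_\<kappa>] in blast, blast)
  moreover have "c \<noteq> \<kappa>" using k_not_subset[OF A] c by metis
  ultimately have c\<kappa>: "c \<epsilon> \<kappa>" by blast
  define d where "d = Succ c"
  have d\<kappa>: "d \<epsilon> \<kappa>" unfolding d_def by (rule Succ_\<kappa>[OF c\<kappa>])
  have dX: "d \<epsilon> ?X" by (rule k_subset_X[OF d\<kappa>])
  \<comment> \<open>A failure at \<open>d\<close> would be reflected to a failure in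
    \<open>A\<close> at an ordinal below \<kappa>, that is, at a member of \<open>c\<close>.\<close>
  have good1: "app F d \<epsilon> v d" if F: "F \<epsilon> A" and *: "\<And>\<xi>. \<xi> \<epsilon> c \<Longrightarrow> app F \<xi> \<epsilon> v \<xi>" for F
  proof (rule ccontr)
    assume "\<not> ?thesis"
    then obtain x where "x \<epsilon> A" "?B1 F F x" using C1 F dX d\<kappa> by blast
    then show False using * c by blast
  qed
  have good2: "pair (app F d) (app F' d) \<epsilon> e d"
    if F: "F \<epsilon> A" "F' \<epsilon> A" and *: "\<And>\<xi>. \<xi> \<epsilon> c \<Longrightarrow> pair (app F \<xi>) (app F' \<xi>) \<epsilon> e \<xi>" for F F'
  proof (rule ccontr)
    assume "\<not> ?thesis"
    then obtain x where "x \<epsilon> A" "?B2 F F' x" using C2 F dX d\<kappa> by blast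
    then show False using * c by blast
  qed
  have "\<exists>H. \<forall>\<xi>. \<xi> \<epsilon> c \<longrightarrow> app H \<xi> \<epsilon> Vset \<kappa> \<and> hom (app H \<xi>) (app G c) (app G \<xi>)"
    by (rule choice[of "\<lambda>\<xi> h. hom h (app G c) (app G \<xi>)"])
      (intro dp_hom dfn, use homs[OF c\<kappa>] M_iff in blast)
  then obtain H where H: "\<And>\<xi>. \<xi> \<epsilon> c \<Longrightarrow> hom (app H \<xi>) (app G c) (app G \<xi>)" by blast
  have Hv: "app (app H \<xi>) x \<epsilon> v \<xi>" if "\<xi> \<epsilon> c" "x \<epsilon> v c" for \<xi> x
    using H[OF that(1)] that(2) unfolding hom_def v_def by blast
  have He: "pair (app (app H \<xi>) x) (app (app H \<xi>) y) \<epsilon> e \<xi>" if "\<xi> \<epsilon> c" "pair x y \<epsilon> e c" for \<xi> x y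
    using H[OF that(1)] that(2) unfolding hom_def e_def by blast
  \<comment> \<open>The images of a fixed vertex \<open>x\<close> form a vertex-valued function on
    \<open>c\<close>; it is an element of \<open>?X\<close>, so \<open>D\<close> finds an extension
    inside \<open>A\<close>.\<close>
  have ex: "\<exists>F'. F' \<epsilon> A \<and> (\<forall>\<xi>. \<xi> \<epsilon> c \<longrightarrow> app F' \<xi> = app (app H \<xi>) x)" if x: "x \<epsilon> v c" for x
  proof -
    have dl: "dterm (\<lambda>\<rho>. app (app H (\<rho> 0)) x)" by (intro dfn)
    define F where "F = Lam c (\<lambda>\<xi>. app (app H \<xi>) x)"
    have F: "app F \<xi> = app (app H \<xi>) x" if "\<xi> \<epsilon> c" for \<xi> unfolding F_def by (rule app_Lam[OF dl that])
    have "p \<in> M" if p: "p \<epsilon> F" for p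
    proof -
      obtain \<xi> where \<xi>: "\<xi> \<epsilon> c" "p = pair \<xi> (app (app H \<xi>) x)"
        using p unfolding F_def mem_Lam[OF dl] by blast
      then have "\<xi> \<epsilon> \<kappa>" using c by blast
      then show ?thesis unfolding \<xi>(2) pair_M_iff using \<kappa>_subset_M M_trans[OF vM Hv[OF \<xi>(1) x]] by blast
    qed
    then have FX: "F \<epsilon> ?X" unfolding in_X_iff by blast
    have "app F \<xi> \<epsilon> v \<xi>" if "\<xi> \<epsilon> c" for \<xi> unfolding F[OF that] by (rule Hv[OF that x])
    then obtain F' where "F' \<epsilon> A" "\<And>\<xi>. \<xi> \<epsilon> A \<Longrightarrow> \<xi> \<epsilon> \<kappa> \<Longrightarrow> app F' \<xi> = app F \<xi>"
      using D FX unfolding c by blast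
    then show ?thesis using F c by auto
  qed
  have "\<exists>T. \<forall>x. x \<epsilon> v c \<longrightarrow> app T x \<epsilon> A \<and> (\<forall>\<xi>. \<xi> \<epsilon> c \<longrightarrow> app (app T x) \<xi> = app (app H \<xi>) x)"
    by (rule choice[of "\<lambda>x F'. \<forall>\<xi>. \<xi> \<epsilon> c \<longrightarrow> app F' \<xi> = app (app H \<xi>) x"]) (intro dfn, rule ex)
  then obtain T where T: "\<And>x. x \<epsilon> v c \<Longrightarrow> app T x \<epsilon> A"
    "\<And>x \<xi>. x \<epsilon> v c \<Longrightarrow> \<xi> \<epsilon> c \<Longrightarrow> app (app T x) \<xi> = app (app H \<xi>) x" by blast
  define h where "h = Lam (v c) (\<lambda>x. app (app T x) d)"
  have h: "app h x = app (app T x) d" if "x \<epsilon> v c" for x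
    unfolding h_def by (rule app_Lam[OF _ that]) (intro dfn)
  have "hom h (app G c) (app G d)"
    unfolding hom_def v_def[symmetric] e_def[symmetric]
  proof (intro conjI allI impI)
    fix x assume x: "x \<epsilon> v c"
    show "app h x \<epsilon> v d" unfolding h[OF x]
      by (rule good1[OF T(1)[OF x]]) (simp add: T(2)[OF x] Hv x)
  next
    fix x y assume xy: "pair x y \<epsilon> e c"
    then have x: "x \<epsilon> v c" and y: "y \<epsilon> v c" using e_v[OF c\<kappa>] by blast+
    show "pair (app h x) (app h y) \<epsilon> e d" unfolding h[OF x] h[OF y]
      by (rule good2[OF T(1)[OF x] T(1)[OF y]]) (simp add: T(2)[OF x] T(2)[OF y] He xy)
  qed
  then show ?thesis using c\<kappa> unfolding d_def by blast
qed

text \<open>The descending homomorphisms yield an ascending one from some \<open>c\<close> to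
  \<open>Succ c\<close>, which the last clause forbids.\<close>

lemma SWVP_K: "K.SWVP (members E (Power (Vset \<kappa>)))"
  unfolding K.SWVP_def
proof (rule notI, elim bexE conjE)
  fix G assume "G \<in> members E (Power (Vset \<kappa>))" and "K.function_on G K.ordinal"
    and gr: "\<forall>a\<in>M. \<forall>g\<in>M. K.related G a g \<longrightarrow> K.graph g"
    and down: "\<forall>a\<in>M. \<forall>a'\<in>M. \<forall>g\<in>M. \<forall>g'\<in>M. K.related G a g \<and> K.related G a' g' \<and> (a \<epsilon> a' \<or> a = a') \<longrightarrow>
      (\<exists>h\<in>M. K.graph_hom h g' g)"
    and up: "\<forall>a\<in>M. \<forall>a'\<in>M. \<forall>g\<in>M. \<forall>g'\<in>M. K.related G a g \<and> K.related G a' g' \<and> a \<epsilon> a' \<longrightarrow>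
      \<not> (\<exists>h\<in>M. K.graph_hom h g g')"
  have GM: "p \<in> M" if "p \<epsilon> G" for p
    using \<open>G \<in> _\<close> that by (simp add: members_def)
  have ex: "\<exists>!y. y \<in> M \<and> K.related G \<xi> y" if "\<xi> \<epsilon> \<kappa>" for \<xi>
    using \<open>K.function_on G K.ordinal\<close> ordinal_M_iff that unfolding K.function_on_def by blast
  have "\<exists>!y. pair \<xi> y \<epsilon> G" if \<xi>: "\<xi> \<epsilon> \<kappa>" for \<xi>
  proof -
    have "y \<in> M \<and> K.related G \<xi> y \<longleftrightarrow> pair \<xi> y \<epsilon> G" for y
      using GM K_related[OF \<kappa>_subset_M[OF \<xi>]] pair_M_iff by blast
    then show ?thesis using ex[OF \<xi>] by simp
  qed
  from app_iff[OF this] have G: "pair \<xi> (app G \<xi>) \<epsilon> G" if "\<xi> \<epsilon> \<kappa>" for \<xi> using that by blast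
  then have gM: "app G \<xi> \<in> M" if "\<xi> \<epsilon> \<kappa>" for \<xi> using GM pair_M_iff that by blast
  have rel: "K.related G \<xi> (app G \<xi>)" if "\<xi> \<epsilon> \<kappa>" for \<xi>
    using K_related[OF \<kappa>_subset_M[OF that] gM[OF that]] G[OF that] by blast
  have gd: "digraph (app G \<xi>)" if "\<xi> \<epsilon> \<kappa>" for \<xi>
    using gr \<kappa>_subset_M[OF that] gM[OF that] rel[OF that] K_graph by blast
  have "\<exists>h. h \<in> M \<and> hom h (app G c) (app G \<xi>)" if c: "c \<epsilon> \<kappa>" and \<xi>: "\<xi> \<epsilon> c" for c \<xi>
  proof -
    have \<xi>\<kappa>: "\<xi> \<epsilon> \<kappa>" by (rule ordinal_trans[OF ordinal_\<kappa> c \<xi>])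
    have "\<exists>h\<in>M. K.graph_hom h (app G c) (app G \<xi>)"
      using down \<kappa>_subset_M[OF c] \<kappa>_subset_M[OF \<xi>\<kappa>] gM[OF c] gM[OF \<xi>\<kappa>] rel[OF c] rel[OF \<xi>\<kappa>] \<xi> by blast
    then show ?thesis using hom_of_K_graph_hom[OF gM[OF c] gM[OF \<xi>\<kappa>]] by blast
  qed
  from hom_to_successor[OF gM gd this] obtain c h where c: "c \<epsilon> \<kappa>" and h: "hom h (app G c) (app G (Succ c))" by blast
  have s: "Succ c \<epsilon> \<kappa>" by (rule Succ_\<kappa>[OF c])
  have "\<exists>h\<in>M. K.graph_hom h (app G c) (app G (Succ c))"
    by (rule K_graph_hom_of_hom[OF gM[OF c] gM[OF s] gd[OF c] gd[OF s] h])
  moreover have "c \<epsilon> Succ c" by simp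
  ultimately show False
    using up \<kappa>_subset_M[OF c] \<kappa>_subset_M[OF s] gM[OF c] gM[OF s] rel[OF c] rel[OF s] by blast
qed

end

section \<open>Supercompact cardinals of \<open>V\<^sub>\<kappa>\<close>\<close>

context zfc_model begin

lemma supercompact_limit_level:
  assumes "V.supercompact \<kappa>"
  shows "limit_level E \<kappa>" "\<And>X. (\<And>a. a \<epsilon> \<kappa> \<Longrightarrow> a \<epsilon> X) \<Longrightarrow> \<exists>Q. cardinal_quantifier E \<kappa> X Q"
proof -
  have card: "V.cardinal \<kappa>" using assms unfolding V.supercompact_def by blast
  show ex: "\<exists>Q. cardinal_quantifier E \<kappa> X Q" if X: "\<And>a. a \<epsilon> \<kappa> \<Longrightarrow> a \<epsilon> X" for X
  proof -
    obtain U where "normal_measure \<kappa> X U"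
      using assms supercompact_for_iff unfolding V.supercompact_def by blast
    from normal_measure_quantifier[OF this] have "cardinal_quantifier E \<kappa> X (\<lambda>P. Sep (Pk \<kappa> X) P \<epsilon> U)"
      by (intro cardinal_quantifier.intro cardinal_quantifier_axioms.intro card X)
    then show ?thesis by blast
  qed
  \<comment> \<open>A measure for \<open>X = \<kappa>\<close> is enough to show that \<kappa> is
    closed under successors.\<close>
  obtain Q where "cardinal_quantifier E \<kappa> \<kappa> Q" using ex[of \<kappa>] by blast
  then interpret cardinal_quantifier E \<kappa> \<kappa> Q .
  show "limit_level E \<kappa>" by unfold_locales (rule ordinal_k, rule Succ_k)
qed

text \<open>Allows measures on many sets to be selected at once, since \<open>choice\<close> takes
  definable relations.\<close>

lemma dp_normal_measure: "dterm t \<Longrightarrow> dterm s \<Longrightarrow> dpred (\<lambda>\<rho>. normal_measure k (t \<rho>) (s \<rho>))"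
  by (rule dpred_comp2[of "normal_measure k"])
    (unfold normal_measure_def V.ultrafilter_on_def V.complete_filter_def V.fine_filter_def
      V.normal_filter_def V.is_Collect_def V_subset_of V_related V_function_on ball_UNIV bex_UNIV,
      intro dp_ex1 dt_Pk dfn)

end

text \<open>
  Each \<open>A\<close> in \<open>\<P>\<^sub>\<kappa>(X)\<close> is in bijection via \<open>g A\<close> with a set \<open>S A\<close> carrying a \<open>\<mu>\<close>-measure \<open>U A\<close>.
  The \<open>Q\<close>-limit of the pulled back measures is a measure on \<open>\<P>\<^sub>\<mu>(X)\<close>.
\<close>

locale measure_limit = normal_quantifier E \<kappa> X Q for E :: "'v \<Rightarrow> 'v \<Rightarrow> bool"  (infix "\<epsilon>" 50) and \<kappa> X Q +
  fixes \<mu> and S g U :: "'v \<Rightarrow> 'v"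
  assumes dS: "dterm t \<Longrightarrow> dterm (\<lambda>\<rho>. S (t \<rho>))"
    and dg: "dterm t \<Longrightarrow> dterm (\<lambda>\<rho>. g (t \<rho>))"
    and dU: "dterm t \<Longrightarrow> dterm (\<lambda>\<rho>. U (t \<rho>))"
    and card_\<mu>: "V.card_less I \<mu> \<Longrightarrow> V.card_less I \<kappa>"
    and g_mem: "A \<epsilon> Pk \<kappa> X \<Longrightarrow> x \<epsilon> A \<Longrightarrow> app (g A) x \<epsilon> S A"
    and g_inj: "A \<epsilon> Pk \<kappa> X \<Longrightarrow> x \<epsilon> A \<Longrightarrow> y \<epsilon> A \<Longrightarrow> app (g A) x = app (g A) y \<Longrightarrow> x = y"
    and g_surj: "A \<epsilon> Pk \<kappa> X \<Longrightarrow> z \<epsilon> S A \<Longrightarrow> \<exists>x. x \<epsilon> A \<and> app (g A) x = z"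
    and measure: "A \<epsilon> Pk \<kappa> X \<Longrightarrow> normal_measure \<mu> (S A) (U A)"
begin

definition pullback :: "'v \<Rightarrow> 'v \<Rightarrow> 'v" where "pullback A s = Sep A (\<lambda>x. app (g A) x \<epsilon> s)"

definition fiber :: "'v \<Rightarrow> ('v \<Rightarrow> bool) \<Rightarrow> bool" where "fiber A P \<longleftrightarrow> Sep (Pk \<mu> (S A)) P \<epsilon> U A"

text \<open>An iterated quantifier, as in a Fubini product. The inner measures live on different
  sets, and pulling back along \<open>g A\<close> brings them all to subsets of
  \<open>X\<close>.\<close>

definition limit :: "('v \<Rightarrow> bool) \<Rightarrow> bool" where "limit P \<longleftrightarrow> Q (\<lambda>A. fiber A (\<lambda>s. P (pullback A s)))"

lemma mem_pullback: "x \<epsilon> pullback A s \<longleftrightarrow> x \<epsilon> A \<and> app (g A) x \<epsilon> s"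
  unfolding pullback_def by (rule mem_Sep) (intro dfn)

lemma dt_pullback: "dterm t \<Longrightarrow> dterm s \<Longrightarrow> dterm (\<lambda>\<rho>. pullback (t \<rho>) (s \<rho>))"
  by (rule dterm_comp2[of pullback]) (unfold pullback_def, intro dg dfn)

lemma pullback_Pk:
  assumes A: "A \<epsilon> Pk \<kappa> X" and s: "s \<epsilon> Pk \<mu> (S A)" shows "pullback A s \<epsilon> Pk \<mu> X"
proof -
  have "V.card_le (pullback A s) s"
    by (rule card_leI[of "app (g A)"]) (intro dfn, unfold mem_pullback, use g_inj[OF A] in blast, use g_inj[OF A] in blast)
  then have "V.card_less (pullback A s) \<mu>"
    using s card_le_less_trans unfolding mem_Pk by blast
  then show ?thesis using A unfolding mem_Pk mem_pullback by blast
qed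

lemma fiber_quantifier: "A \<epsilon> Pk \<kappa> X \<Longrightarrow> normal_quantifier E \<mu> (S A) (fiber A)"
  unfolding fiber_def by (rule normal_measure_quantifier[OF measure])

lemma dp_fiber:
  assumes "dpred (\<lambda>\<rho>. P (\<lambda>i. \<rho> (Suc i)) (\<rho> 0))" and t: "dterm t"
  shows "dpred (\<lambda>\<rho>. fiber (t \<rho>) (P \<rho>))"
  unfolding fiber_def by (intro dp_mem dt_Sep assms(1) dt_Pk dS dU t dt_const)

lemma dp_limit:
  assumes "dpred (\<lambda>\<rho>. P (\<lambda>i. \<rho> (Suc i)) (\<rho> 0))" shows "dpred (\<lambda>\<rho>. limit (P \<rho>))"
proof -
  have "dpred (\<lambda>\<rho>. P (\<lambda>i. \<rho> (Suc (Suc (Suc i)))) (\<rho> 0))"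
    using dpred_subst[OF assms, of "\<lambda>\<rho>. case_nat (\<rho> 0) (\<lambda>i. \<rho> (Suc (Suc (Suc i))))"]
    by (simp add: atomic_case_nat atomic_var)
  then have "dpred (\<lambda>\<rho>. P (\<lambda>i. \<rho> (Suc (Suc i))) (pullback (\<rho> 1) (\<rho> 0)))"
    using dpred_inst[of "\<lambda>\<rho>. P (\<lambda>i. \<rho> (Suc (Suc i)))" "\<lambda>\<rho>. pullback (\<rho> 1) (\<rho> 0)"] dt_pullback[OF dt_var dt_var]
    by simp
  then show ?thesis unfolding limit_def
    by (intro dp_Q dp_fiber[of "\<lambda>\<rho> s. P (\<lambda>i. \<rho> (Suc i)) (pullback (\<rho> 0) s)"] dt_var) simp
qed

lemma dp_fiber_pullback:
  assumes "dpred (\<lambda>\<rho>. P (\<rho> 0))" and t: "dterm t"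
  shows "dpred (\<lambda>\<rho>. fiber (t \<rho>) (\<lambda>s. P (pullback (t \<rho>) s)))"
proof -
  have "dpred (\<lambda>\<rho>. fiber (\<rho> 0) (\<lambda>s. P (pullback (\<rho> 0) s)))"
    by (intro dp_fiber dpred_comp1[of P, OF assms(1)] dt_pullback dt_var)
  then show ?thesis
    using dpred_comp1[of "\<lambda>A. fiber A (\<lambda>s. P (pullback A s))", OF _ t] by blast
qed

lemma dp_pullback: "dpred (\<lambda>\<rho>. P (\<rho> 0)) \<Longrightarrow> dpred (\<lambda>\<rho>. P (pullback A (\<rho> 0)))"
  by (rule dpred_comp1[of P]) (assumption, intro dt_pullback dfn)

lemma fiber_mono:
  assumes "fiber A (\<lambda>s. B (pullback A s))" "A \<epsilon> Pk \<kappa> X" "dpred (\<lambda>\<rho>. B (\<rho> 0))" "dpred (\<lambda>\<rho>. C (\<rho> 0))"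
    "\<And>a. a \<epsilon> Pk \<mu> X \<Longrightarrow> B a \<Longrightarrow> C a"
  shows "fiber A (\<lambda>s. C (pullback A s))"
  by (rule normal_quantifier.Q_mono[OF fiber_quantifier[OF assms(2)] assms(1)
        dp_pullback[OF assms(3)] dp_pullback[OF assms(4)]])
    (rule assms(5)[OF pullback_Pk[OF assms(2)]])

text \<open>Every clause passes through the inner and then the outer quantifier;
  \<open>card_\<mu>\<close> makes the completeness of the outer one applicable. Normality is used
  twice: inside it gives each \<open>A\<close> a constant value, and this value, an element of
  \<open>A\<close>, is a regressive function for the outer quantifier.\<close>

lemma limit_quantifier: "normal_quantifier E \<mu> X limit"
  apply unfold_locales
  subgoal by (rule dp_limit)
  subgoal premises pr for B C
    unfolding limit_def
    by (rule Q_mono[OF pr(1)[unfolded limit_def] dp_fiber_pullback[OF pr(2) dt_var] dp_fiber_pullback[OF pr(3) dt_var]])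
      (rule fiber_mono[OF _ _ pr(2-4)])
  subgoal premises pr for B
  proof -
    obtain A where A: "A \<epsilon> Pk \<kappa> X" "fiber A (\<lambda>s. B (pullback A s))"
      using Q_ex[OF pr(1)[unfolded limit_def] dp_fiber_pullback[OF pr(2) dt_var]] by blast
    from normal_quantifier.Q_ex[OF fiber_quantifier[OF A(1)] A(2) dp_pullback[OF pr(2)]]
    show ?thesis using pullback_Pk[OF A(1)] by blast
  qed
  subgoal premises pr for B C
    unfolding limit_def
    by (rule Q_mono[OF Q_conj[OF pr(1,2)[unfolded limit_def] dp_fiber_pullback[OF pr(3) dt_var] dp_fiber_pullback[OF pr(4) dt_var]]
          dp_conj[OF dp_fiber_pullback[OF pr(3) dt_var] dp_fiber_pullback[OF pr(4) dt_var]]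
          dp_fiber_pullback[OF dp_conj[OF pr(3,4)] dt_var]])
      (rule normal_quantifier.Q_conj[OF fiber_quantifier _ _ dp_pullback[OF pr(3)] dp_pullback[OF pr(4)]]; blast)
  subgoal premises pr for B
    unfolding limit_def
    by (rule Q_mono[OF Q_neg[OF pr(1)[unfolded limit_def] dp_fiber_pullback[OF pr(2) dt_var]]
          dp_not[OF dp_fiber_pullback[OF pr(2) dt_var]] dp_fiber_pullback[OF dp_not[OF pr(2)] dt_var]])
      (rule normal_quantifier.Q_neg[OF fiber_quantifier _ dp_pullback[OF pr(2)]])
  subgoal premises pr for I R
  proof -
    note dR = dpred_comp2[of R, OF pr(2)]
    have dF: "dpred (\<lambda>\<rho>. fiber (\<rho> 1) (\<lambda>s. R (\<rho> 0) (pullback (\<rho> 1) s)))"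
      by (intro dp_fiber dR dt_pullback dt_var)
    note dF' = dpred_comp2[of "\<lambda>i A. fiber A (\<lambda>s. R i (pullback A s))", OF dF]
    have dA: "dpred (\<lambda>\<rho>. \<forall>i. i \<epsilon> I \<longrightarrow> R i (\<rho> 0))" by (intro dR dfn)
    have all: "Q (\<lambda>A. \<forall>i. i \<epsilon> I \<longrightarrow> fiber A (\<lambda>s. R i (pullback A s)))"
      by (rule Q_all[OF card_\<mu>[OF pr(1)] dF]) (rule pr(3)[unfolded limit_def])
    show ?thesis
      unfolding limit_def
    proof (rule Q_mono[OF all _ dp_fiber_pullback[OF dA dt_var]])
      show "dpred (\<lambda>\<rho>. \<forall>i. i \<epsilon> I \<longrightarrow> fiber (\<rho> 0) (\<lambda>s. R i (pullback (\<rho> 0) s)))"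
        by (intro dF' dfn)
      show "fiber A (\<lambda>s. \<forall>i. i \<epsilon> I \<longrightarrow> R i (pullback A s))"
        if A: "A \<epsilon> Pk \<kappa> X" "\<forall>i. i \<epsilon> I \<longrightarrow> fiber A (\<lambda>s. R i (pullback A s))" for A
        by (rule normal_quantifier.Q_all[OF fiber_quantifier[OF A(1)] pr(1)])
          (intro dR dt_pullback dt_var dt_const, use A(2) in blast)
    qed
  qed
  subgoal premises pr for x
    unfolding limit_def
  proof (rule Q_mono[OF Q_fine[OF pr]])
    show "dpred (\<lambda>\<rho>. x \<epsilon> \<rho> 0)" by (intro dfn)
    then show "dpred (\<lambda>\<rho>. fiber (\<rho> 0) (\<lambda>s. x \<epsilon> pullback (\<rho> 0) s))"
      by (rule dp_fiber_pullback[OF _ dt_var])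
    fix A assume A: "A \<epsilon> Pk \<kappa> X" and x: "x \<epsilon> A"
    interpret F: normal_quantifier E \<mu> "S A" "fiber A" by (rule fiber_quantifier[OF A])
    show "fiber A (\<lambda>s. x \<epsilon> pullback A s)"
      by (rule F.Q_mono[OF F.Q_fine[OF g_mem[OF A x]]])
        (intro dfn, intro dt_pullback dfn, unfold mem_pullback, use x in blast)
  qed
  subgoal premises pr for f
  proof -
    note df = dterm_comp1[of f, OF pr(1)]
    have d1: "dpred (\<lambda>\<rho>. f (\<rho> 0) \<epsilon> \<rho> 0)" by (intro df dfn)
    define N where "N A \<longleftrightarrow> fiber A (\<lambda>s. f (pullback A s) \<epsilon> pullback A s)" for A
    have dN: "dpred (\<lambda>\<rho>. N (\<rho> 0))" unfolding N_def by (rule dp_fiber_pullback[OF d1 dt_var])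
    have QN: "Q N" unfolding N_def by (rule pr(2)[unfolded limit_def])
    have dR: "dpred (\<lambda>\<rho>. \<rho> 1 \<epsilon> \<rho> 0 \<and> fiber (\<rho> 0) (\<lambda>s. f (pullback (\<rho> 0) s) = \<rho> 1))"
      by (intro dp_conj dp_mem dp_fiber dp_eq df dt_pullback dt_var)
    have "\<exists>x. x \<epsilon> X \<and> x \<epsilon> A \<and> fiber A (\<lambda>s. f (pullback A s) = x)" if A': "A \<epsilon> Sep (Pk \<kappa> X) N" for A
    proof -
      have A: "A \<epsilon> Pk \<kappa> X" and NA: "N A" using A' unfolding mem_Sep[OF dN] by blast+
      interpret F: normal_quantifier E \<mu> "S A" "fiber A" by (rule fiber_quantifier[OF A])
      have dp: "dpred (\<lambda>\<rho>. f (pullback A (\<rho> 0)) \<epsilon> pullback A (\<rho> 0))" by (rule dp_pullback[OF d1])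
      have dgf: "dterm (\<lambda>\<rho>. app (g A) (f (pullback A (\<rho> 0))))" by (intro df dt_pullback dfn)
      \<comment> \<open>The inner measure concerns subsets of \<open>S A\<close>, so the regressive
        function is transported by \<open>g A\<close>; injectivity later brings its constant value
        back to an element of \<open>A\<close>.\<close>
      have "fiber A (\<lambda>s. app (g A) (f (pullback A s)) \<epsilon> s)"
        by (rule F.Q_mono[OF NA[unfolded N_def] dp]) (intro dp_mem dgf dt_var, unfold mem_pullback, blast)
      from F.Q_normal[OF dgf this] obtain c where c: "fiber A (\<lambda>s. app (g A) (f (pullback A s)) = c)" by blast
      have dc: "dpred (\<lambda>\<rho>. app (g A) (f (pullback A (\<rho> 0))) = c)" by (intro dp_eq dgf dt_const)
      note both = F.Q_conj[OF NA[unfolded N_def] c dp dc]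
      obtain s where "f (pullback A s) \<epsilon> pullback A s" "app (g A) (f (pullback A s)) = c"
        using F.Q_ex[OF both dp_conj[OF dp dc]] by blast
      then obtain x where x: "x \<epsilon> A" "app (g A) x = c" unfolding mem_pullback by blast
      have "fiber A (\<lambda>s. f (pullback A s) = x)"
      proof (rule F.Q_mono[OF both dp_conj[OF dp dc]])
        show "dpred (\<lambda>\<rho>. f (pullback A (\<rho> 0)) = x)" by (intro df dt_pullback dfn)
        fix s assume s: "f (pullback A s) \<epsilon> pullback A s \<and> app (g A) (f (pullback A s)) = c"
        then have "f (pullback A s) \<epsilon> A" unfolding mem_pullback by (elim conjE)
        then show "f (pullback A s) = x" by (rule g_inj[OF A _ x(1)]) (simp add: s x(2))
      qed
      then show ?thesis using x(1) A unfolding mem_Pk by blast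
    qed
    then have "\<exists>F. \<forall>A. A \<epsilon> Sep (Pk \<kappa> X) N \<longrightarrow>
        app F A \<epsilon> X \<and> app F A \<epsilon> A \<and> fiber A (\<lambda>s. f (pullback A s) = app F A)"
      by (rule choice[of "\<lambda>A x. x \<epsilon> A \<and> fiber A (\<lambda>s. f (pullback A s) = x)", OF dR])
    then obtain F where F: "\<And>A. A \<epsilon> Pk \<kappa> X \<Longrightarrow> N A \<Longrightarrow> app F A \<epsilon> A \<and> fiber A (\<lambda>s. f (pullback A s) = app F A)"
      unfolding mem_Sep[OF dN] by blast
    have "Q (\<lambda>A. app F A \<epsilon> A)"
      by (rule Q_mono[OF QN dN]) (intro dfn, use F in blast)
    then obtain c where c: "Q (\<lambda>A. app F A = c)"
      using Q_normal[of "app F"] dt_app[OF dt_const dt_var] by blast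
    have dFc: "dpred (\<lambda>\<rho>. app F (\<rho> 0) = c)" and dfc: "dpred (\<lambda>\<rho>. f (\<rho> 0) = c)" by (intro df dfn)+
    have "limit (\<lambda>a. f a = c)"
      unfolding limit_def
      by (rule Q_mono[OF Q_conj[OF QN c dN dFc] dp_conj[OF dN dFc] dp_fiber_pullback[OF dfc dt_var]])
        (use F in blast)
    then show ?thesis by blast
  qed
  done

end

lemma (in zfc_model) supercompact_of_K:
  assumes \<kappa>: "V.supercompact \<kappa>" and \<mu>: "\<mu> \<epsilon> Vset \<kappa>"
    and K: "membership_structure.supercompact (members E (Vset \<kappa>)) E \<mu>"
  shows "V.supercompact \<mu> \<and> \<mu> \<epsilon> \<kappa>"
proof -
  interpret limit_level E \<kappa> by (rule supercompact_limit_level(1)[OF \<kappa>])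
  obtain Q\<^sub>0 where "cardinal_quantifier E \<kappa> \<kappa> Q\<^sub>0" using supercompact_limit_level(2)[OF \<kappa>] by blast
  \<comment> \<open>This measure provides the regularity of \<kappa>, independently of the set
    \<open>X\<close> treated below.\<close>
  then interpret reg: cardinal_quantifier E \<kappa> \<kappa> Q\<^sub>0 .
  have \<mu>M: "\<mu> \<in> M" using \<mu> M_iff by blast
  note K' = K[unfolded K.supercompact_def]
  have card: "V.cardinal \<mu>" and unc: "V.uncountable \<mu>" and sc: "V.supercompact_for \<mu> S" if "S \<in> M" for S
    using K' K_cardinal[OF \<mu>M] K_uncountable[OF \<mu>M] K_supercompact_for[OF \<mu>M that] that by blast+
  note card = card[OF \<mu>M] and unc = unc[OF \<mu>M]
  have \<mu>\<kappa>: "\<mu> \<epsilon> \<kappa>"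
    using card ordinal_of_mem_Vset[OF ordinal_\<kappa> _ \<mu>] unfolding V.cardinal_def by blast
  have "V.supercompact_for \<mu> X" for X
  proof -
    let ?p = "Pk \<kappa> X"
    obtain W where "normal_measure \<kappa> X W"
      using \<kappa> supercompact_for_iff unfolding V.supercompact_def by blast
    from normal_measure_quantifier[OF this]
    interpret W: normal_quantifier E \<kappa> X "\<lambda>P. Sep ?p P \<epsilon> W" .
    \<comment> \<open>Injections of all \<open>A\<close> into \<kappa> are selected simultaneously;
      the power set is the range that \<open>choice\<close> asks for.\<close>
    have "\<exists>G. \<forall>A. A \<epsilon> ?p \<longrightarrow> app G A \<epsilon> Power (Times X \<kappa>) \<and> ((\<forall>x. x \<epsilon> A \<longrightarrow> app (app G A) x \<epsilon> \<kappa>) \<and>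
        (\<forall>x y. x \<epsilon> A \<longrightarrow> y \<epsilon> A \<longrightarrow> app (app G A) x = app (app G A) y \<longrightarrow> x = y))"
    proof (rule choice[of "\<lambda>A g. (\<forall>x. x \<epsilon> A \<longrightarrow> app g x \<epsilon> \<kappa>) \<and>
          (\<forall>x y. x \<epsilon> A \<longrightarrow> y \<epsilon> A \<longrightarrow> app g x = app g y \<longrightarrow> x = y)"], goal_cases)
      case 1 show ?case by (intro dfn)
    next
      case (2 A)
      then obtain F where F: "\<And>x. x \<epsilon> A \<Longrightarrow> app F x \<epsilon> \<kappa>"
        "\<And>x y. x \<epsilon> A \<Longrightarrow> y \<epsilon> A \<Longrightarrow> app F x = app F y \<Longrightarrow> x = y"
        unfolding mem_Pk V.card_less_def card_le_iff by blast
      have dF: "dterm (\<lambda>\<rho>. app F (\<rho> 0))" by (intro dfn)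
      have app: "app (Lam A (app F)) x = app F x" if "x \<epsilon> A" for x by (rule app_Lam[OF dF that])
      have "Lam A (app F) \<epsilon> Power (Times X \<kappa>)"
        using 2 F(1) unfolding mem_Power mem_Lam[OF dF] mem_Times mem_Pk by blast
      moreover have "\<forall>x. x \<epsilon> A \<longrightarrow> app (Lam A (app F)) x \<epsilon> \<kappa>" using app F(1) by simp
      moreover have "\<forall>x y. x \<epsilon> A \<longrightarrow> y \<epsilon> A \<longrightarrow> app (Lam A (app F)) x = app (Lam A (app F)) y \<longrightarrow> x = y"
        using F(2) by (simp add: app)
      ultimately show ?case by blast
    qed
    then obtain G where G: "\<And>A x. A \<epsilon> ?p \<Longrightarrow> x \<epsilon> A \<Longrightarrow> app (app G A) x \<epsilon> \<kappa>"
      "\<And>A x y. A \<epsilon> ?p \<Longrightarrow> x \<epsilon> A \<Longrightarrow> y \<epsilon> A \<Longrightarrow> app (app G A) x = app (app G A) y \<Longrightarrow> x = y" by blast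
    define S where "S A = Repl A (app (app G A))" for A
    have dGA: "dterm (\<lambda>\<rho>. app (app G A) (\<rho> 0))" for A by (intro dfn)
    have S: "z \<epsilon> S A \<longleftrightarrow> (\<exists>x. x \<epsilon> A \<and> z = app (app G A) x)" for z A
      unfolding S_def by (rule mem_Repl[OF dGA])
    have dS: "dterm (\<lambda>\<rho>. S (t \<rho>))" if "dterm t" for t
      by (rule dterm_comp1[of S, OF _ that]) (unfold S_def, intro dfn)
    have S\<kappa>: "z \<epsilon> \<kappa>" if "A \<epsilon> ?p" "z \<epsilon> S A" for A z using that G(1) unfolding S by blast
    have SM: "S A \<in> M" if A: "A \<epsilon> ?p" for A
    proof -
      have "V.card_le (S A) A" by (rule card_le_image[OF dGA]) (unfold S, blast)
      then have "V.card_less (S A) \<kappa>" using A card_le_less_trans unfolding mem_Pk by blast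
      from reg.regular[OF this S\<kappa>[OF A]] obtain s where s: "s \<epsilon> \<kappa>" "\<And>x. x \<epsilon> S A \<Longrightarrow> x \<epsilon> s" by blast
      show ?thesis by (rule M_subset[OF \<kappa>_subset_M[OF s(1)] s(2)])
    qed
    \<comment> \<open>Three power sets suffice as range: a measure is a set of sets of subsets of
      \<open>S A\<close>, and \<open>S A\<close> is a subset of \<kappa>.\<close>
    have "\<exists>U. \<forall>A. A \<epsilon> ?p \<longrightarrow> app U A \<epsilon> Power (Power (Power \<kappa>)) \<and> normal_measure \<mu> (S A) (app U A)"
    proof (rule choice[of "\<lambda>A. normal_measure \<mu> (S A)"], goal_cases)
      case 1 show ?case by (intro dp_normal_measure dS dt_var)
    next
      case (2 A)
      obtain U where U: "normal_measure \<mu> (S A) U" using sc[OF SM[OF 2]] supercompact_for_iff by blast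
      then have "z \<epsilon> Pk \<mu> (S A)" if "B \<epsilon> U" "z \<epsilon> B" for B z
        using that unfolding normal_measure_def V.ultrafilter_on_def V_subset_of ball_UNIV by blast
      then have "U \<epsilon> Power (Power (Power \<kappa>))" unfolding mem_Power mem_Pk using S\<kappa>[OF 2] by blast
      then show ?case using U by blast
    qed
    then obtain U where U: "\<And>A. A \<epsilon> ?p \<Longrightarrow> normal_measure \<mu> (S A) (app U A)" by blast
    have card: "V.card_less I \<kappa>" if "V.card_less I \<mu>" for I
      by (rule card_le_less_trans[OF _ reg.card_less_k[OF \<mu>\<kappa>]])
        (rule conjunct1[OF that[unfolded V.card_less_def]])
    interpret measure_limit E \<kappa> X "\<lambda>P. Sep ?p P \<epsilon> W" \<mu> S "app G" "app U"
    proof (unfold_locales, goal_cases)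
      case 1 then show ?case by (rule dS)
    next
      case 2 then show ?case by (rule dt_app[OF dt_const])
    next
      case 3 then show ?case by (rule dt_app[OF dt_const])
    next
      case 4 then show ?case by (rule card)
    next
      case 5 then show ?case unfolding S by blast
    next
      case 6 then show ?case by (rule G(2))
    next
      case 7 then show ?case unfolding S by blast
    next
      case 8 then show ?case by (rule U)
    qed
    show ?thesis by (rule normal_quantifier.supercompact_for[OF limit_quantifier])
  qed
  then show ?thesis using \<open>V.cardinal \<mu>\<close> unc \<mu>\<kappa> unfolding V.supercompact_def by blast
qed

theorem theorem1p2:
  fixes E :: "'v \<Rightarrow> 'v \<Rightarrow> bool" and \<kappa> :: 'v
  assumes "ZFC E"
    and "membership_structure.least_supercompact UNIV E \<kappa>"
  shows "membership_structure.SWVP (members E (V_level E \<kappa>)) E (members E (V_level E (succ E \<kappa>))) \<and>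
    \<not> (\<exists>\<mu>\<in>members E (V_level E \<kappa>).
         membership_structure.supercompact (members E (V_level E \<kappa>)) E \<mu>)"
proof -
  interpret zfc_model E by unfold_locales (rule assms(1))
  have \<kappa>: "V.supercompact \<kappa>" and least: "\<And>\<mu>. V.supercompact \<mu> \<Longrightarrow> \<kappa> = \<mu> \<or> E \<kappa> \<mu>"
    using assms(2) unfolding V.least_supercompact_def by blast+
  interpret limit_level E \<kappa> by (rule supercompact_limit_level(1)[OF \<kappa>])
  have V: "V_level E \<kappa> = Vset \<kappa>" "members E (V_level E (succ E \<kappa>)) = members E (Power (Vset \<kappa>))"
    unfolding succ_eq V_level_eq[OF ordinal_\<kappa>] V_level_eq[OF ordinal_Succ[OF ordinal_\<kappa>]] members_def
      mem_Vset_Succ[OF ordinal_\<kappa>] mem_Power by (rule refl)+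
  \<comment> \<open>Ordinals below \<kappa> are subsets of \<open>V\<^sub>\<kappa>\<close>, so
    \<open>X\<close> includes \<kappa> as \<open>cardinal_quantifier\<close> requires.\<close>
  have "E a (Power (Vset \<kappa>))" if "E a \<kappa>" for a
    using ordinal_trans[OF ordinal_\<kappa> that] ordinal_mem_Vset[OF ordinal_\<kappa>] unfolding mem_Power by blast
  from supercompact_limit_level(2)[OF \<kappa> this] obtain Q where "cardinal_quantifier E \<kappa> (Power (Vset \<kappa>)) Q" by blast
  then interpret Q: cardinal_quantifier E \<kappa> "Power (Vset \<kappa>)" Q .
  interpret universe_quantifier E \<kappa> Q by unfold_locales
  \<comment> \<open>Such a \<mu> would be supercompact and below \<kappa>, whereas leastness puts
    \<kappa> at or below \<mu>; Foundation excludes both cases.\<close>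
  have "\<not> membership_structure.supercompact (members E (Vset \<kappa>)) E \<mu>" if "E \<mu> (Vset \<kappa>)" for \<mu>
    using supercompact_of_K[OF \<kappa> that] least mem_irrefl mem_asym by blast
  then show ?thesis unfolding V using SWVP_K by (simp add: members_def)
qed

end
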